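(* Let $(M,\omega,J,g)$ be a compact almost-Kähler manifold such that the metric $g$ is a first-Chern--Einstein metric. Then the following hold. (1) If $\rho^\nabla=0$, then any holomorphic vector field is a Killing vector field. Moreover, the Lie algebra of holomorphic vector fields is abelian, and the Riemannian dual of any holomorphic vector field is harmonic with respect to the twisted Laplacian $\Delta^c=J\Delta^gJ^{-1}$. (2) If $\rho^\nabla=-\omega$, then there are no non-trivial holomorphic vector fields on $M$. (3) If $\rho^\nabla=\omega$, then the Riemannian dual $\alpha$ of a holomorphic vector field $X$ is of the form $\alpha=d^cu+dh$ with functions $u,h$ such that $$\Delta^gu=2u,\qquad \Delta^gh=2h,\qquad D^g_{(dh)^\sharp}\omega=0.$$ In particular, there are no non-trivial holomorphic vector fields if $2$ is not an eigenvalue of $\Delta^g$. Moreover, if $X$ is a Killing vector field, then $X$ is a Hamiltonian vector field.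
   Context: An almost-Kähler manifold $(M,\omega,J,g)$ of real dimension $2n$ is a symplectic manifold $(M,\omega)$ with an almost-complex structure $J$ such that $\omega(J\cdot,J\cdot)=\omega(\cdot,\cdot)$ and $g:=\omega(\cdot,J\cdot)$ is a Riemannian metric. $D^g$ is the Levi-Civita connection and $\sharp$ the $g$-Riemannian dual. The canonical Hermitian connection is $\nabla_XY=D^g_XY-\frac12 J(D^g_XJ)Y$, with curvature $R^\nabla_{X,Y}=\nabla_{[X,Y]}-[\nabla_X,\nabla_Y]$; the first-Chern--Ricci form is $\rho^\nabla(X,Y)=\frac12\sum_{i=1}^{2n}g(R^\nabla_{X,Y}e_i,Je_i)$ for a $J$-adapted $g$-orthonormal local frame $\{e_i\}$. The metric is first-Chern--Einstein if $\rho^\nabla=\lambda\omega$ with $\lambda\in\{0,1,-1\}$. $J$ acts on $p$-forms by $(J\psi)(X_1,\dots,X_p)=\psi(J^{-1}X_1,\dots,J^{-1}X_p)$, so $J\alpha=-\alpha\circ J$ on 1-forms; $d^cf=Jdf$ for functions $f$. $\Delta^g=\delta^gd+d\delta^g$ is the Riemannian (Hodge) Laplacian on forms. A real vector field $X$ is holomorphic if $\mathcal L_XJ=0$; it is Hamiltonian if $\omega(X,\cdot)=-du$ for some function $u$. *)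

theory Defs
  imports "HOL-Analysis.Analysis" "HOL-Library.Function_Algebras"
begin

text \<open>Real-valued functions, tangent vectors (derivations) and vector fields are all functions;
  they are added and scaled pointwise.\<close>

instantiation "fun" :: (type, real_vector) real_vector
begin

definition scaleR_fun :: "real \<Rightarrow> ('a \<Rightarrow> 'b) \<Rightarrow> 'a \<Rightarrow> 'b"
  where "scaleR_fun c f = (\<lambda>x. c *\<^sub>R f x)"

instance
  by standard (auto simp: scaleR_fun_def fun_eq_iff scaleR_add_right scaleR_add_left)

end


section \<open>Smooth manifolds\<close>

fun higher_differentiable_on ::
    "'a::real_normed_vector set \<Rightarrow> ('a \<Rightarrow> 'b::real_normed_vector) \<Rightarrow> nat \<Rightarrow> bool"
  where
    "higher_differentiable_on S f 0 \<longleftrightarrow> continuous_on S f"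
  | "higher_differentiable_on S f (Suc k) \<longleftrightarrow>
      (\<forall>x\<in>S. f differentiable (at x)) \<and>
      (\<forall>v. higher_differentiable_on S (\<lambda>x. frechet_derivative f (at x) v) k)"

text \<open>Only used for open sets.\<close>

definition smooth_on :: "'a::real_normed_vector set \<Rightarrow> ('a \<Rightarrow> 'b::real_normed_vector) \<Rightarrow> bool"
  where "smooth_on S f \<longleftrightarrow> (\<forall>k. higher_differentiable_on S f k)"

text \<open>A chart is a domain together with a coordinate map. The manifold is the whole type
  \<open>'m\<close>, its topology is the one of the type, and its dimension is \<open>DIM('e)\<close>. An atlas
  need not be maximal: it determines the same smooth functions as the maximal atlas it generates.\<close>

type_synonym ('m, 'e) chart = "'m set \<times> ('m \<Rightarrow> 'e)"

definition is_chart :: "('m::topological_space, 'e::euclidean_space) chart \<Rightarrow> bool"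
  where "is_chart = (\<lambda>(U, \<phi>).
    open U \<and> open (\<phi> ` U) \<and> homeomorphism U (\<phi> ` U) \<phi> (inv_into U \<phi>))"

definition smooth_atlas :: "('m::topological_space, 'e::euclidean_space) chart set \<Rightarrow> bool"
  where "smooth_atlas A \<longleftrightarrow>
    (\<forall>c\<in>A. is_chart c) \<and> (\<Union>c\<in>A. fst c) = UNIV \<and>
    (\<forall>(U, \<phi>)\<in>A. \<forall>(V, \<psi>)\<in>A. smooth_on (\<phi> ` (U \<inter> V)) (\<psi> \<circ> inv_into U \<phi>))"

definition smooth_fun :: "('m::topological_space, 'e::euclidean_space) chart set \<Rightarrow> ('m \<Rightarrow> real) set"
  where "smooth_fun A = {f. \<forall>(U, \<phi>)\<in>A. smooth_on (\<phi> ` U) (f \<circ> inv_into U \<phi>)}"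


section \<open>Tangent vectors and vector fields\<close>

text \<open>Tangent vectors at \<open>p\<close> are the derivations at \<open>p\<close> of the algebra of smooth functions. They
  are set to zero on non-smooth functions, so that equality of tangent vectors is equality of
  functions.\<close>

type_synonym 'm tangent = "('m \<Rightarrow> real) \<Rightarrow> real"
type_synonym 'm vfield = "'m \<Rightarrow> 'm tangent"

definition tangent_space ::
    "('m::topological_space, 'e::euclidean_space) chart set \<Rightarrow> 'm \<Rightarrow> 'm tangent set"
  where "tangent_space A p = {v.
    (\<forall>f\<in>smooth_fun A. \<forall>g\<in>smooth_fun A. v (f + g) = v f + v g) \<and>
    (\<forall>f\<in>smooth_fun A. \<forall>c. v (c *\<^sub>R f) = c * v f) \<and>
    (\<forall>f\<in>smooth_fun A. \<forall>g\<in>smooth_fun A. v (f * g) = v f * g p + f p * v g) \<and>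
    (\<forall>f. f \<notin> smooth_fun A \<longrightarrow> v f = 0)}"

definition vf_deriv :: "'m vfield \<Rightarrow> ('m \<Rightarrow> real) \<Rightarrow> 'm \<Rightarrow> real"
  where "vf_deriv X f = (\<lambda>p. X p f)"

definition vector_fields ::
    "('m::topological_space, 'e::euclidean_space) chart set \<Rightarrow> 'm vfield set"
  where "vector_fields A = {X.
    (\<forall>p. X p \<in> tangent_space A p) \<and> (\<forall>f\<in>smooth_fun A. vf_deriv X f \<in> smooth_fun A)}"

definition vf_scale :: "('m \<Rightarrow> real) \<Rightarrow> 'm vfield \<Rightarrow> 'm vfield" (infixr "\<odot>" 75)
  where "f \<odot> X = (\<lambda>p. f p *\<^sub>R X p)"

definition lie_bracket :: "'m vfield \<Rightarrow> 'm vfield \<Rightarrow> 'm vfield"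
  where "lie_bracket X Y = (\<lambda>p f. X p (vf_deriv Y f) - Y p (vf_deriv X f))"


section \<open>Tensor fields\<close>

text \<open>Tensor fields are the multilinear maps, over the ring of smooth functions, on the module of
  vector fields. Their values on arguments that are not vector fields are irrelevant.\<close>

type_synonym 'm form1 = "'m vfield \<Rightarrow> 'm \<Rightarrow> real"
type_synonym 'm form2 = "'m vfield \<Rightarrow> 'm vfield \<Rightarrow> 'm \<Rightarrow> real"

definition one_form :: "('m::topological_space, 'e::euclidean_space) chart set \<Rightarrow> 'm form1 \<Rightarrow> bool"
  where "one_form A \<alpha> \<longleftrightarrow>
    (\<forall>X\<in>vector_fields A. \<alpha> X \<in> smooth_fun A) \<and>
    (\<forall>X\<in>vector_fields A. \<forall>Y\<in>vector_fields A. \<alpha> (X + Y) = \<alpha> X + \<alpha> Y) \<and>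
    (\<forall>f\<in>smooth_fun A. \<forall>X\<in>vector_fields A. \<alpha> (f \<odot> X) = f * \<alpha> X)"

definition bilinear_field ::
    "('m::topological_space, 'e::euclidean_space) chart set \<Rightarrow> 'm form2 \<Rightarrow> bool"
  where "bilinear_field A B \<longleftrightarrow>
    (\<forall>X\<in>vector_fields A. one_form A (B X) \<and> one_form A (\<lambda>Y. B Y X))"

definition two_form :: "('m::topological_space, 'e::euclidean_space) chart set \<Rightarrow> 'm form2 \<Rightarrow> bool"
  where "two_form A \<psi> \<longleftrightarrow> bilinear_field A \<psi> \<and> (\<forall>X\<in>vector_fields A. \<psi> X X = 0)"

definition endo_field ::
    "('m::topological_space, 'e::euclidean_space) chart set \<Rightarrow> ('m vfield \<Rightarrow> 'm vfield) \<Rightarrow> bool"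
  where "endo_field A J \<longleftrightarrow>
    (\<forall>X\<in>vector_fields A. J X \<in> vector_fields A) \<and>
    (\<forall>X\<in>vector_fields A. \<forall>Y\<in>vector_fields A. J (X + Y) = J X + J Y) \<and>
    (\<forall>f\<in>smooth_fun A. \<forall>X\<in>vector_fields A. J (f \<odot> X) = f \<odot> J X)"

definition ext_d0 :: "('m \<Rightarrow> real) \<Rightarrow> 'm form1"
  where "ext_d0 f X = vf_deriv X f"

definition ext_d1 :: "'m form1 \<Rightarrow> 'm form2"
  where "ext_d1 \<alpha> X Y = vf_deriv X (\<alpha> Y) - vf_deriv Y (\<alpha> X) - \<alpha> (lie_bracket X Y)"

definition ext_d2 :: "'m form2 \<Rightarrow> 'm vfield \<Rightarrow> 'm vfield \<Rightarrow> 'm vfield \<Rightarrow> 'm \<Rightarrow> real"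
  where "ext_d2 \<psi> X Y Z =
    vf_deriv X (\<psi> Y Z) - vf_deriv Y (\<psi> X Z) + vf_deriv Z (\<psi> X Y)
    - \<psi> (lie_bracket X Y) Z + \<psi> (lie_bracket X Z) Y - \<psi> (lie_bracket Y Z) X"


section \<open>Almost-Kaehler structures\<close>

definition riemannian_metric ::
    "('m::topological_space, 'e::euclidean_space) chart set \<Rightarrow> 'm form2 \<Rightarrow> bool"
  where "riemannian_metric A g \<longleftrightarrow> bilinear_field A g \<and>
    (\<forall>X\<in>vector_fields A. \<forall>Y\<in>vector_fields A. g X Y = g Y X) \<and>
    (\<forall>X\<in>vector_fields A. \<forall>p. X p \<noteq> 0 \<longrightarrow> g X X p > 0)"

definition symplectic_form ::
    "('m::topological_space, 'e::euclidean_space) chart set \<Rightarrow> 'm form2 \<Rightarrow> bool"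
  where "symplectic_form A \<omega> \<longleftrightarrow> two_form A \<omega> \<and>
    (\<forall>X\<in>vector_fields A. \<forall>Y\<in>vector_fields A. \<forall>Z\<in>vector_fields A. ext_d2 \<omega> X Y Z = 0) \<and>
    (\<forall>X\<in>vector_fields A. \<forall>p. (\<forall>Y\<in>vector_fields A. \<omega> X Y p = 0) \<longrightarrow> X p = 0)"

definition almost_complex_structure ::
    "('m::topological_space, 'e::euclidean_space) chart set \<Rightarrow> ('m vfield \<Rightarrow> 'm vfield) \<Rightarrow> bool"
  where "almost_complex_structure A J \<longleftrightarrow>
    endo_field A J \<and> (\<forall>X\<in>vector_fields A. J (J X) = - X)"

definition almost_kaehler ::
    "('m::topological_space, 'e::euclidean_space) chart set \<Rightarrow>
      'm form2 \<Rightarrow> ('m vfield \<Rightarrow> 'm vfield) \<Rightarrow> 'm form2 \<Rightarrow> bool"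
  where "almost_kaehler A \<omega> J g \<longleftrightarrow>
    symplectic_form A \<omega> \<and> almost_complex_structure A J \<and>
    (\<forall>X\<in>vector_fields A. \<forall>Y\<in>vector_fields A. \<omega> (J X) (J Y) = \<omega> X Y) \<and>
    (\<forall>X\<in>vector_fields A. \<forall>Y\<in>vector_fields A. g X Y = \<omega> X (J Y)) \<and>
    riemannian_metric A g"


section \<open>Connections and curvature\<close>

type_synonym 'm connection = "'m vfield \<Rightarrow> 'm vfield \<Rightarrow> 'm vfield"

definition connection ::
    "('m::topological_space, 'e::euclidean_space) chart set \<Rightarrow> 'm connection \<Rightarrow> bool"
  where "connection A D \<longleftrightarrow>
    (\<forall>Y\<in>vector_fields A. endo_field A (\<lambda>X. D X Y)) \<and>
    (\<forall>X\<in>vector_fields A. \<forall>Y\<in>vector_fields A. \<forall>Z\<in>vector_fields A.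
      D X (Y + Z) = D X Y + D X Z) \<and>
    (\<forall>f\<in>smooth_fun A. \<forall>X\<in>vector_fields A. \<forall>Y\<in>vector_fields A.
      D X (f \<odot> Y) = vf_deriv X f \<odot> Y + f \<odot> D X Y)"

text \<open>On vector fields the Levi-Civita connection is determined uniquely by this predicate.\<close>

definition levi_civita ::
    "('m::topological_space, 'e::euclidean_space) chart set \<Rightarrow> 'm form2 \<Rightarrow> 'm connection \<Rightarrow> bool"
  where "levi_civita A g D \<longleftrightarrow> connection A D \<and>
    (\<forall>X\<in>vector_fields A. \<forall>Y\<in>vector_fields A. D X Y - D Y X = lie_bracket X Y) \<and>
    (\<forall>X\<in>vector_fields A. \<forall>Y\<in>vector_fields A. \<forall>Z\<in>vector_fields A.
      vf_deriv X (g Y Z) = g (D X Y) Z + g Y (D X Z))"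

definition cov_form1 :: "'m connection \<Rightarrow> 'm vfield \<Rightarrow> 'm form1 \<Rightarrow> 'm form1"
  where "cov_form1 D X \<alpha> Y = vf_deriv X (\<alpha> Y) - \<alpha> (D X Y)"

definition cov_form2 :: "'m connection \<Rightarrow> 'm vfield \<Rightarrow> 'm form2 \<Rightarrow> 'm form2"
  where "cov_form2 D X \<psi> Y Z = vf_deriv X (\<psi> Y Z) - \<psi> (D X Y) Z - \<psi> Y (D X Z)"

definition cov_endo ::
    "'m connection \<Rightarrow> 'm vfield \<Rightarrow> ('m vfield \<Rightarrow> 'm vfield) \<Rightarrow> 'm vfield \<Rightarrow> 'm vfield"
  where "cov_endo D X J Y = D X (J Y) - J (D X Y)"

definition canonical_connection ::
    "('m vfield \<Rightarrow> 'm vfield) \<Rightarrow> 'm connection \<Rightarrow> 'm connection"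
  where "canonical_connection J D X Y = D X Y - (1 / 2) *\<^sub>R J (cov_endo D X J Y)"

text \<open>The sign is opposite to the more common convention.\<close>

definition curvature :: "'m connection \<Rightarrow> 'm vfield \<Rightarrow> 'm vfield \<Rightarrow> 'm vfield \<Rightarrow> 'm vfield"
  where "curvature D X Y Z = D (lie_bracket X Y) Z - (D X (D Y Z) - D Y (D X Z))"

text \<open>A local frame on \<open>W\<close> consists of global vector fields that are only constrained on \<open>W\<close>.
  Every local frame is of this form after shrinking its domain.\<close>

definition orthonormal_frame ::
    "('m::topological_space, 'e::euclidean_space) chart set \<Rightarrow> 'm form2 \<Rightarrow>
      'm set \<Rightarrow> (nat \<Rightarrow> 'm vfield) \<Rightarrow> bool"
  where "orthonormal_frame A g W E \<longleftrightarrow> open W \<and>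
    (\<forall>i<DIM('e). E i \<in> vector_fields A) \<and>
    (\<forall>i<DIM('e). \<forall>j<DIM('e). \<forall>p\<in>W. g (E i) (E j) p = (if i = j then 1 else 0))"

text \<open>A \<open>J\<close>-adapted frame is ordered as \<open>E 0, J (E 0), E 2, J (E 2), \<dots>\<close>\<close>

definition adapted_frame ::
    "('m::topological_space, 'e::euclidean_space) chart set \<Rightarrow> ('m vfield \<Rightarrow> 'm vfield) \<Rightarrow>
      'm form2 \<Rightarrow> 'm set \<Rightarrow> (nat \<Rightarrow> 'm vfield) \<Rightarrow> bool"
  where "adapted_frame A J g W E \<longleftrightarrow> orthonormal_frame A g W E \<and>
    (\<forall>i. 2 * i + 1 < DIM('e) \<longrightarrow> (\<forall>p\<in>W. E (2 * i + 1) p = J (E (2 * i)) p))"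

definition chern_ricci ::
    "('m::topological_space, 'e::euclidean_space) chart set \<Rightarrow> ('m vfield \<Rightarrow> 'm vfield) \<Rightarrow>
      'm form2 \<Rightarrow> 'm connection \<Rightarrow> 'm form2"
  where "chern_ricci A J g D X Y p =
    (let E = SOME E. \<exists>W. p \<in> W \<and> adapted_frame A J g W E
     in 1 / 2 * (\<Sum>i<DIM('e). g (curvature (canonical_connection J D) X Y (E i)) (J (E i)) p))"

definition chern_ricci_eq ::
    "('m::topological_space, 'e::euclidean_space) chart set \<Rightarrow> 'm form2 \<Rightarrow>
      ('m vfield \<Rightarrow> 'm vfield) \<Rightarrow> 'm form2 \<Rightarrow> 'm connection \<Rightarrow> real \<Rightarrow> bool"
  where "chern_ricci_eq A \<omega> J g D c \<longleftrightarrow>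
    (\<forall>X\<in>vector_fields A. \<forall>Y\<in>vector_fields A. chern_ricci A J g D X Y = c *\<^sub>R \<omega> X Y)"

definition first_chern_einstein ::
    "('m::topological_space, 'e::euclidean_space) chart set \<Rightarrow> 'm form2 \<Rightarrow>
      ('m vfield \<Rightarrow> 'm vfield) \<Rightarrow> 'm form2 \<Rightarrow> 'm connection \<Rightarrow> bool"
  where "first_chern_einstein A \<omega> J g D \<longleftrightarrow> (\<exists>c\<in>{0, 1, -1}. chern_ricci_eq A \<omega> J g D c)"


section \<open>The Hodge Laplacian on functions and 1-forms\<close>

text \<open>The codifferential of the metric is minus the metric trace of the Levi-Civita covariant
  derivative: \<open>\<delta> \<psi> = - (\<Sum>i. (D_{E i} \<psi>) (E i, \<dots>))\<close> for a local orthonormal frame \<open>E\<close>. In all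
  definitions of this section \<open>D\<close> is meant to be the Levi-Civita connection of \<open>g\<close>.\<close>

definition codiff1 ::
    "('m::topological_space, 'e::euclidean_space) chart set \<Rightarrow> 'm form2 \<Rightarrow> 'm connection \<Rightarrow>
      'm form1 \<Rightarrow> 'm \<Rightarrow> real"
  where "codiff1 A g D \<alpha> p =
    (let E = SOME E. \<exists>W. p \<in> W \<and> orthonormal_frame A g W E
     in - (\<Sum>i<DIM('e). cov_form1 D (E i) \<alpha> (E i) p))"

definition codiff2 ::
    "('m::topological_space, 'e::euclidean_space) chart set \<Rightarrow> 'm form2 \<Rightarrow> 'm connection \<Rightarrow>
      'm form2 \<Rightarrow> 'm form1"
  where "codiff2 A g D \<psi> X p =
    (let E = SOME E. \<exists>W. p \<in> W \<and> orthonormal_frame A g W E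
     in - (\<Sum>i<DIM('e). cov_form2 D (E i) \<psi> (E i) X p))"

definition laplacian0 ::
    "('m::topological_space, 'e::euclidean_space) chart set \<Rightarrow> 'm form2 \<Rightarrow> 'm connection \<Rightarrow>
      ('m \<Rightarrow> real) \<Rightarrow> 'm \<Rightarrow> real"
  where "laplacian0 A g D f = codiff1 A g D (ext_d0 f)"

definition laplacian1 ::
    "('m::topological_space, 'e::euclidean_space) chart set \<Rightarrow> 'm form2 \<Rightarrow> 'm connection \<Rightarrow>
      'm form1 \<Rightarrow> 'm form1"
  where "laplacian1 A g D \<alpha> = codiff2 A g D (ext_d1 \<alpha>) + ext_d0 (codiff1 A g D \<alpha>)"

definition eigenvalue0 ::
    "('m::topological_space, 'e::euclidean_space) chart set \<Rightarrow> 'm form2 \<Rightarrow> 'm connection \<Rightarrow>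
      real \<Rightarrow> bool"
  where "eigenvalue0 A g D c \<longleftrightarrow>
    (\<exists>f\<in>smooth_fun A. f \<noteq> 0 \<and> laplacian0 A g D f = c *\<^sub>R f)"

text \<open>Here \<open>J\<inverse> = - J\<close> on vector fields; \<open>J_form\<close> is the action of \<open>J\<close> on 1-forms and
  \<open>J_form_inv\<close> its inverse.\<close>

definition J_form :: "('m vfield \<Rightarrow> 'm vfield) \<Rightarrow> 'm form1 \<Rightarrow> 'm form1"
  where "J_form J \<alpha> X = \<alpha> (- J X)"

definition J_form_inv :: "('m vfield \<Rightarrow> 'm vfield) \<Rightarrow> 'm form1 \<Rightarrow> 'm form1"
  where "J_form_inv J \<alpha> X = \<alpha> (J X)"

definition dc :: "('m vfield \<Rightarrow> 'm vfield) \<Rightarrow> ('m \<Rightarrow> real) \<Rightarrow> 'm form1"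
  where "dc J f = J_form J (ext_d0 f)"

definition twisted_laplacian1 ::
    "('m::topological_space, 'e::euclidean_space) chart set \<Rightarrow> ('m vfield \<Rightarrow> 'm vfield) \<Rightarrow>
      'm form2 \<Rightarrow> 'm connection \<Rightarrow> 'm form1 \<Rightarrow> 'm form1"
  where "twisted_laplacian1 A J g D \<alpha> = J_form J (laplacian1 A g D (J_form_inv J \<alpha>))"


section \<open>Special vector fields\<close>

definition sharp ::
    "('m::topological_space, 'e::euclidean_space) chart set \<Rightarrow> 'm form2 \<Rightarrow> 'm form1 \<Rightarrow> 'm vfield"
  where "sharp A g \<alpha> = (THE Z. Z \<in> vector_fields A \<and> (\<forall>Y\<in>vector_fields A. g Z Y = \<alpha> Y))"

definition flat :: "'m form2 \<Rightarrow> 'm vfield \<Rightarrow> 'm form1"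
  where "flat g X = (\<lambda>Y. g X Y)"

definition lie_endo ::
    "'m vfield \<Rightarrow> ('m vfield \<Rightarrow> 'm vfield) \<Rightarrow> 'm vfield \<Rightarrow> 'm vfield"
  where "lie_endo X J Y = lie_bracket X (J Y) - J (lie_bracket X Y)"

definition lie_bilinear :: "'m vfield \<Rightarrow> 'm form2 \<Rightarrow> 'm form2"
  where "lie_bilinear X B Y Z =
    vf_deriv X (B Y Z) - B (lie_bracket X Y) Z - B Y (lie_bracket X Z)"

definition holomorphic_fields ::
    "('m::topological_space, 'e::euclidean_space) chart set \<Rightarrow> ('m vfield \<Rightarrow> 'm vfield) \<Rightarrow>
      'm vfield set"
  where "holomorphic_fields A J =
    {X \<in> vector_fields A. \<forall>Y\<in>vector_fields A. lie_endo X J Y = 0}"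

definition killing_fields ::
    "('m::topological_space, 'e::euclidean_space) chart set \<Rightarrow> 'm form2 \<Rightarrow> 'm vfield set"
  where "killing_fields A g =
    {X \<in> vector_fields A. \<forall>Y\<in>vector_fields A. \<forall>Z\<in>vector_fields A. lie_bilinear X g Y Z = 0}"

definition hamiltonian_fields ::
    "('m::topological_space, 'e::euclidean_space) chart set \<Rightarrow> 'm form2 \<Rightarrow> 'm vfield set"
  where "hamiltonian_fields A \<omega> =
    {X \<in> vector_fields A. \<exists>u\<in>smooth_fun A. \<forall>Y\<in>vector_fields A. \<omega> X Y = - ext_d0 u Y}"

end

theory Submission
  imports Defs
begin

text \<open>
  The statement rests on one pointwise identity. Let \<open>X\<close> be holomorphic, let \<open>\<nabla>\<close> be the canonical
  Hermitian connection and \<open>L\<^sub>X\<close> the Lie derivative. Both \<open>\<nabla>\<^sub>X\<close> and \<open>L\<^sub>X\<close> commute with \<open>J\<close>, so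
  \<open>\<nabla>\<^sub>X - L\<^sub>X\<close> is a complex linear endomorphism of the tangent bundle. On an almost-Kaehler manifold its
  real trace is \<open>div X\<close>, and the real trace of its composition with \<open>J\<close> is \<open>div JX\<close>. Its covariant
  derivative in the direction \<open>Y\<close> is the curvature \<open>R\<^bsub>X,Y\<^esub>\<close> plus the Lie derivative of \<open>\<nabla>\<close>.
  The \<open>(0,1)\<close>-part of \<open>\<nabla>\<close> can be written with brackets and \<open>J\<close> alone (\<open>nabla_01\<close>), so that \<open>L\<^sub>X\<close>
  annihilates it. Combining the directions \<open>Y\<close> and \<open>JY\<close>, only curvature survives, and
  \<open>divergence_chern_ricci\<close> says
  \[ d(div X)(Y) + d(div JX)(JY) = - 2 \<rho>(X, JY). \]

  If \<open>\<rho> = \<lambda> \<omega>\<close>, the right-hand side is \<open>- 2 \<lambda> g(X,Y)\<close>. Hence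
  \<open>2 \<lambda> X = J grad (div JX) - grad (div X)\<close>, and since \<open>\<delta> d\<^sup>c = 0\<close> on functions, both divergences are
  eigenfunctions of the Laplacian with eigenvalue \<open>2 \<lambda>\<close> (\<open>holomorphic_decomposition\<close>).

  For \<open>\<lambda> = 1\<close> these formulas are the asserted decomposition, with \<open>u\<close> and \<open>h\<close> half the two
  divergences up to sign. The form \<open>d d\<^sup>c h = L\<^sub>X \<omega>\<close> is \<open>J\<close>-invariant because \<open>\<omega>\<close> is and the flow of \<open>X\<close>
  preserves \<open>J\<close>. Its anti-invariant part is \<open>D\<omega>\<close> in the direction of the gradient of \<open>h\<close>, so this
  vanishes. For \<open>\<lambda> = -1\<close> both divergences are eigenfunctions with a negative
  eigenvalue, so they and \<open>X\<close> are zero.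

  For \<open>\<lambda> = 0\<close> both divergences are harmonic, hence locally constant, hence zero. Then \<open>L\<^sub>X \<omega>\<close> is an exact
  primitive form of type \<open>(1,1)\<close>. Such a form is divergence-free, and integrating it against
  its potential \<open>\<omega>(X, \<cdot>)\<close> shows that it vanishes: \<open>X\<close> preserves \<open>\<omega>\<close>, and with it \<open>g\<close>. For two such fields the
  bracket is Hamiltonian with potential \<open>\<omega>(X,Y)\<close>. The potential is harmonic because the bracket is
  again holomorphic, so that the bracket is zero.

  Compactness enters only through \<open>divergence_nonneg_imp_eq_0\<close>: a vector field with nonnegative
  divergence is divergence-free. It is derived from the divergence theorem, which is proved by integrating
  against the density \<open>sqrt \<bar>det g\<bar>\<close> in coordinates, with a partition of unity.

  Since tangent vectors are derivations and tensors are maps on the module of global vector fields,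
  the geometric base is Hadamard's lemma together with bump functions: they give coordinate expansions
  of vector fields and the locality of tensors. Metric contractions are expressed by a trace \<open>tr_g\<close> of bilinear
  fields, which can be evaluated in any orthonormal basis.
\<close>

section \<open>Calculus of smooth functions\<close>

lemma higher_differentiable_on_cong:
  assumes "open S" "\<And>x. x \<in> S \<Longrightarrow> f x = g x"
  shows "higher_differentiable_on S f k \<longleftrightarrow> higher_differentiable_on S g k"
  using assms(2)
proof (induction k arbitrary: f g)
  case 0
  then show ?case by (simp cong: continuous_on_cong)
next
  case (Suc k)
  have *: "(f has_derivative d) (at x) \<longleftrightarrow> (g has_derivative d) (at x)" if "x \<in> S" for x d
    using has_derivative_transform_within_open[OF _ \<open>open S\<close> that, of f d UNIV g]
      has_derivative_transform_within_open[OF _ \<open>open S\<close> that, of g d UNIV f] Suc.prems by auto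
  have d: "f differentiable (at x) \<longleftrightarrow> g differentiable (at x)" if "x \<in> S" for x
    using *[OF that] by (simp add: differentiable_def)
  have fd: "frechet_derivative f (at x) v = frechet_derivative g (at x) v" if "x \<in> S" for x v
    using *[OF that] by (simp add: frechet_derivative_def)
  show ?case
    using Suc.IH[of "\<lambda>x. frechet_derivative f (at x) _" "\<lambda>x. frechet_derivative g (at x) _"] d fd
    by simp
qed

lemma higher_differentiable_on_Suc_D:
  "higher_differentiable_on S f (Suc k) \<Longrightarrow> higher_differentiable_on S f k"
proof (induction k arbitrary: f)
  case 0
  then show ?case
    by (auto intro!: continuous_at_imp_continuous_on differentiable_imp_continuous_within)
qed auto

lemma higher_differentiable_on_continuous:
  "higher_differentiable_on S f k \<Longrightarrow> continuous_on S f"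
proof (induction k)
  case (Suc k)
  then show ?case using higher_differentiable_on_Suc_D by blast
qed simp

lemma higher_differentiable_on_subset:
  "higher_differentiable_on S f k \<Longrightarrow> T \<subseteq> S \<Longrightarrow> higher_differentiable_on T f k"
proof (induction k arbitrary: f)
  case 0
  then show ?case using continuous_on_subset by auto
qed auto

lemma higher_differentiable_on_local:
  assumes "\<And>x. x \<in> S \<Longrightarrow> \<exists>T. open T \<and> x \<in> T \<and> higher_differentiable_on T f k"
  shows "higher_differentiable_on S f k"
  using assms
proof (induction k arbitrary: f)
  case 0
  then show ?case
    by (simp add: continuous_on_eq_continuous_at)
      (metis continuous_at_imp_continuous_on continuous_on_eq_continuous_at)
next
  case (Suc k)
  show ?case
    by (simp, intro conjI ballI allI Suc.IH) (use Suc.prems in fastforce)+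
qed

text \<open>The derivative need only be known on the open set, and only up to equality there.\<close>

lemma higher_differentiable_on_SucI:
  assumes "open S" "\<And>x. x \<in> S \<Longrightarrow> (f has_derivative f' x) (at x)"
    and "\<And>v. higher_differentiable_on S (\<lambda>x. f' x v) k"
  shows "higher_differentiable_on S f (Suc k)"
proof -
  have "frechet_derivative f (at x) v = f' x v" if "x \<in> S" for x v
    using frechet_derivative_at[OF assms(2)[OF that]] by simp
  then show ?thesis
    using assms higher_differentiable_on_cong[OF \<open>open S\<close>, of "\<lambda>x. frechet_derivative f (at x) _" "\<lambda>x. f' x _"]
    by (auto simp: differentiable_def)
qed

lemma higher_differentiable_on_SucE:
  assumes "higher_differentiable_on S f (Suc k)" "x \<in> S"
  shows "(f has_derivative frechet_derivative f (at x)) (at x)"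
  using assms frechet_derivative_works by auto

lemma higher_differentiable_on_frechet_derivative:
  "higher_differentiable_on S f (Suc k) \<Longrightarrow>
    higher_differentiable_on S (\<lambda>x. frechet_derivative f (at x) v) k"
  by simp

declare higher_differentiable_on.simps(2) [simp del]

lemma higher_differentiable_on_const [simp]:
  "open S \<Longrightarrow> higher_differentiable_on S (\<lambda>x. c) k"
  by (induction k arbitrary: c) (simp_all add: higher_differentiable_on.simps(2))

lemma higher_differentiable_on_linear:
  assumes "open S" "bounded_linear f"
  shows "higher_differentiable_on S f k"
proof (cases k)
  case 0
  then show ?thesis using assms(2) by (simp add: linear_continuous_on)
next
  case (Suc l)
  show ?thesis
    unfolding Suc
    by (rule higher_differentiable_on_SucI[OF assms(1), of _ "\<lambda>_. f"])
      (use assms in \<open>auto intro: bounded_linear_imp_has_derivative\<close>)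
qed

lemma higher_differentiable_on_bounded_linear:
  assumes "open S" "bounded_linear L" "higher_differentiable_on S f k"
  shows "higher_differentiable_on S (\<lambda>x. L (f x)) k"
  using assms(3)
proof (induction k arbitrary: f)
  case 0
  then show ?case using assms(2) by (simp add: bounded_linear.continuous_on)
next
  case (Suc k)
  show ?case
    by (rule higher_differentiable_on_SucI[OF assms(1),
          of _ "\<lambda>x v. L (frechet_derivative f (at x) v)"])
      (use Suc in \<open>auto intro: bounded_linear.has_derivative[OF assms(2)]
          higher_differentiable_on_SucE higher_differentiable_on_frechet_derivative\<close>)
qed

lemma higher_differentiable_on_add:
  assumes "open S" "higher_differentiable_on S f k" "higher_differentiable_on S g k"
  shows "higher_differentiable_on S (\<lambda>x. f x + g x) k"
  using assms(2,3)
proof (induction k arbitrary: f g)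
  case 0
  then show ?case by (simp add: continuous_on_add)
next
  case (Suc k)
  show ?case
    by (rule higher_differentiable_on_SucI[OF assms(1), of _
          "\<lambda>x v. frechet_derivative f (at x) v + frechet_derivative g (at x) v"])
      (use Suc in \<open>auto intro: has_derivative_add higher_differentiable_on_SucE
          higher_differentiable_on_frechet_derivative\<close>)
qed

lemma higher_differentiable_on_sum:
  assumes "open S" "\<And>i. i \<in> I \<Longrightarrow> higher_differentiable_on S (f i) k"
  shows "higher_differentiable_on S (\<lambda>x. \<Sum>i\<in>I. f i x) k"
  using assms(2)
  by (induction I rule: infinite_finite_induct)
    (auto simp: assms(1) intro: higher_differentiable_on_add[OF assms(1)])

lemma higher_differentiable_on_mult:
  fixes f g :: "'a::real_normed_vector \<Rightarrow> real"
  assumes "open S" "higher_differentiable_on S f k" "higher_differentiable_on S g k"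
  shows "higher_differentiable_on S (\<lambda>x. f x * g x) k"
  using assms(2,3)
proof (induction k arbitrary: f g)
  case 0
  then show ?case by (simp add: continuous_on_mult)
next
  case (Suc k)
  have fg: "higher_differentiable_on S f k" "higher_differentiable_on S g k"
    using Suc.prems by (blast intro: higher_differentiable_on_Suc_D)+
  show ?case
    by (rule higher_differentiable_on_SucI[OF assms(1), of _
          "\<lambda>x v. f x * frechet_derivative g (at x) v + frechet_derivative f (at x) v * g x"])
      (use Suc fg in \<open>auto intro!: has_derivative_mult higher_differentiable_on_SucE
          higher_differentiable_on_add[OF assms(1)] higher_differentiable_on_frechet_derivative\<close>)
qed

text \<open>Expanding the derivative of \<open>g\<close> in a basis turns the chain rule into a sum of products, to which
  the induction hypothesis applies.\<close>

lemma higher_differentiable_on_compose: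
  fixes f :: "'a::real_normed_vector \<Rightarrow> 'b::euclidean_space" and g :: "'b \<Rightarrow> real"
  assumes "open S" "open T" "f ` S \<subseteq> T"
    and "higher_differentiable_on S f k" "higher_differentiable_on T g k"
  shows "higher_differentiable_on S (\<lambda>x. g (f x)) k"
  using assms(4,5)
proof (induction k arbitrary: g)
  case 0
  then show ?case
    using assms(3) continuous_on_compose2[of T g S f] by auto
next
  case (Suc k)
  have f: "higher_differentiable_on S f k"
    using Suc.prems(1) by (rule higher_differentiable_on_Suc_D)
  have dg: "frechet_derivative g (at y) v
      = (\<Sum>b\<in>Basis. (v \<bullet> b) * frechet_derivative g (at y) b)" if "y \<in> T" for y v
  proof -
    have l: "linear (frechet_derivative g (at y))"
      using higher_differentiable_on_SucE[OF Suc.prems(2) that] has_derivative_linear by blast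
    have "frechet_derivative g (at y) v
        = frechet_derivative g (at y) (\<Sum>b\<in>Basis. (v \<bullet> b) *\<^sub>R b)"
      by (simp add: euclidean_representation)
    also have "\<dots> = (\<Sum>b\<in>Basis. (v \<bullet> b) * frechet_derivative g (at y) b)"
      by (simp add: linear_sum[OF l] linear_scale[OF l])
    finally show ?thesis .
  qed
  show ?case
  proof (rule higher_differentiable_on_SucI[OF assms(1), of _
        "\<lambda>x v. \<Sum>b\<in>Basis. (frechet_derivative f (at x) v \<bullet> b) * frechet_derivative g (at (f x)) b"])
    fix x assume x: "x \<in> S"
    then have "f x \<in> T" using assms(3) by auto
    then show "((\<lambda>x. g (f x)) has_derivative (\<lambda>v. \<Sum>b\<in>Basis.
        (frechet_derivative f (at x) v \<bullet> b) * frechet_derivative g (at (f x)) b)) (at x)"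
      unfolding dg[OF \<open>f x \<in> T\<close>, symmetric]
      using has_derivative_compose[OF higher_differentiable_on_SucE[OF Suc.prems(1) x]
          higher_differentiable_on_SucE[OF Suc.prems(2) \<open>f x \<in> T\<close>]] by simp
  next
    fix v
    have "higher_differentiable_on S (\<lambda>x. frechet_derivative f (at x) v \<bullet> b) k" for b
      by (intro higher_differentiable_on_bounded_linear[OF assms(1) bounded_linear_inner_left]
          higher_differentiable_on_frechet_derivative Suc.prems)
    moreover have "higher_differentiable_on S (\<lambda>x. frechet_derivative g (at (f x)) b) k" for b
      using Suc.IH[OF f, of "\<lambda>y. frechet_derivative g (at y) b"] Suc.prems(2)
      by (simp add: higher_differentiable_on_frechet_derivative)
    ultimately show "higher_differentiable_on S (\<lambda>x. \<Sum>b\<in>Basis.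
        (frechet_derivative f (at x) v \<bullet> b) * frechet_derivative g (at (f x)) b) k"
      by (auto intro!: higher_differentiable_on_sum higher_differentiable_on_mult assms(1))
  qed
qed

lemma higher_differentiable_on_real_SucI:
  fixes f :: "real \<Rightarrow> real"
  assumes "open S" "\<And>x. x \<in> S \<Longrightarrow> (f has_field_derivative f' x) (at x)"
    and "higher_differentiable_on S f' k"
  shows "higher_differentiable_on S f (Suc k)"
  by (rule higher_differentiable_on_SucI[OF assms(1), of _ "\<lambda>x v. f' x * v"])
    (use assms in \<open>auto simp: has_field_derivative_def intro!: higher_differentiable_on_mult\<close>)

lemma higher_differentiable_on_inverse:
  "higher_differentiable_on {x::real. x \<noteq> 0} inverse k"
proof (induction k)
  case 0
  then show ?case by (auto intro!: continuous_intros)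
next
  case (Suc k)
  have o: "open {x::real. x \<noteq> 0}"
    by (simp add: open_Collect_neq)
  have "higher_differentiable_on {x::real. x \<noteq> 0} (\<lambda>x. - 1 * (inverse x * inverse x)) k"
    by (intro higher_differentiable_on_mult higher_differentiable_on_const o Suc)
  then show ?case
    by (intro higher_differentiable_on_real_SucI[OF o, of _ "\<lambda>x. - (inverse x * inverse x)"])
      (auto intro!: derivative_eq_intros)
qed

lemma higher_differentiable_on_inverse_sqrt:
  "higher_differentiable_on {0<..} (\<lambda>x::real. inverse (sqrt x)) k"
proof (induction k)
  case 0
  then show ?case by (auto intro!: continuous_intros)
next
  case (Suc k)
  have i: "higher_differentiable_on {0<..} (inverse :: real \<Rightarrow> real) k"
    by (rule higher_differentiable_on_subset[OF higher_differentiable_on_inverse]) auto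
  have "higher_differentiable_on {0<..} (\<lambda>x::real. - (1/2) * (inverse x * inverse (sqrt x))) k"
    by (intro higher_differentiable_on_mult higher_differentiable_on_const Suc i open_greaterThan)
  moreover have "((\<lambda>x. inverse (sqrt x)) has_real_derivative
      - (1/2) * (inverse x * inverse (sqrt x))) (at x)" if "x \<in> {0<..}" for x
    using that by (auto intro!: derivative_eq_intros simp: field_simps)
  ultimately show ?case
    by (intro higher_differentiable_on_real_SucI[OF open_greaterThan]) auto
qed

lemma smooth_on_cong:
  "open S \<Longrightarrow> (\<And>x. x \<in> S \<Longrightarrow> f x = g x) \<Longrightarrow> smooth_on S f \<longleftrightarrow> smooth_on S g"
  unfolding smooth_on_def using higher_differentiable_on_cong by blast

lemma smooth_on_subset: "smooth_on S f \<Longrightarrow> T \<subseteq> S \<Longrightarrow> smooth_on T f"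
  unfolding smooth_on_def using higher_differentiable_on_subset by blast

lemma smooth_on_local:
  assumes "\<And>x. x \<in> S \<Longrightarrow> \<exists>T. open T \<and> x \<in> T \<and> smooth_on T f"
  shows "smooth_on S f"
  unfolding smooth_on_def
  using assms by (intro allI higher_differentiable_on_local) (auto simp: smooth_on_def)

lemma smooth_on_continuous: "smooth_on S f \<Longrightarrow> continuous_on S f"
  unfolding smooth_on_def using higher_differentiable_on_continuous by blast

lemma smooth_on_has_derivative:
  "smooth_on S f \<Longrightarrow> x \<in> S \<Longrightarrow> (f has_derivative frechet_derivative f (at x)) (at x)"
  unfolding smooth_on_def using higher_differentiable_on_SucE by blast

lemma smooth_on_frechet_derivative:
  "smooth_on S f \<Longrightarrow> smooth_on S (\<lambda>x. frechet_derivative f (at x) v)"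
  unfolding smooth_on_def using higher_differentiable_on_frechet_derivative by blast

lemma smooth_on_const [simp]: "open S \<Longrightarrow> smooth_on S (\<lambda>x. c)"
  by (simp add: smooth_on_def)

lemma smooth_on_linear: "open S \<Longrightarrow> bounded_linear f \<Longrightarrow> smooth_on S f"
  by (simp add: smooth_on_def higher_differentiable_on_linear)

lemma smooth_on_add:
  "open S \<Longrightarrow> smooth_on S f \<Longrightarrow> smooth_on S g \<Longrightarrow> smooth_on S (\<lambda>x. f x + g x)"
  by (simp add: smooth_on_def higher_differentiable_on_add)

lemma smooth_on_mult:
  fixes f g :: "'a::real_normed_vector \<Rightarrow> real"
  shows "open S \<Longrightarrow> smooth_on S f \<Longrightarrow> smooth_on S g \<Longrightarrow> smooth_on S (\<lambda>x. f x * g x)"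
  by (simp add: smooth_on_def higher_differentiable_on_mult)

lemma smooth_on_compose:
  fixes f :: "'a::real_normed_vector \<Rightarrow> 'b::euclidean_space" and g :: "'b \<Rightarrow> real"
  assumes "open S" "open T" "f ` S \<subseteq> T" "smooth_on S f" "smooth_on T g"
  shows "smooth_on S (\<lambda>x. g (f x))"
  using assms higher_differentiable_on_compose[OF assms(1-3)] by (auto simp: smooth_on_def)

lemma smooth_on_inverse:
  fixes f :: "'a::real_normed_vector \<Rightarrow> real"
  assumes "open S" "smooth_on S f" "\<And>x. x \<in> S \<Longrightarrow> f x \<noteq> 0"
  shows "smooth_on S (\<lambda>x. inverse (f x))"
  by (rule smooth_on_compose[OF assms(1) _ _ assms(2), of "{x. x \<noteq> 0}"])
    (use assms(3) higher_differentiable_on_inverse in \<open>auto simp: open_Collect_neq smooth_on_def\<close>)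

lemma smooth_on_inverse_sqrt:
  fixes f :: "'a::real_normed_vector \<Rightarrow> real"
  assumes "open S" "smooth_on S f" "\<And>x. x \<in> S \<Longrightarrow> f x > 0"
  shows "smooth_on S (\<lambda>x. inverse (sqrt (f x)))"
  using smooth_on_compose[OF assms(1) open_greaterThan _ assms(2), of 0 "\<lambda>x. inverse (sqrt x)"]
    assms(3) higher_differentiable_on_inverse_sqrt by (auto simp: smooth_on_def)

subsection \<open>A bump function on Euclidean space\<close>

text \<open>The functions \<open>t \<mapsto> t\<^sup>-\<^sup>n e\<^sup>-\<^sup>1\<^sup>/\<^sup>t\<close>, cut off at \<open>0\<close>, are closed under differentiation up to linear
  combinations. Stating smoothness for the whole family is what makes the induction work.\<close>

definition flat_exp :: "nat \<Rightarrow> real \<Rightarrow> real"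
  where "flat_exp n t = (if t > 0 then inverse t ^ n * exp (- inverse t) else 0)"

lemma flat_exp_tendsto_0: "((\<lambda>t. inverse t ^ n * exp (- inverse t)) \<longlongrightarrow> 0) (at_right (0::real))"
proof -
  have "((\<lambda>x::real. x ^ n / exp x) \<longlongrightarrow> 0) at_top"
    by (rule tendsto_power_div_exp_0)
  then have "((\<lambda>t::real. inverse t ^ n / exp (inverse t)) \<longlongrightarrow> 0) (at_right 0)"
    by (rule filterlim_compose[OF _ filterlim_inverse_at_top_right])
  then show ?thesis
    by (simp add: exp_minus divide_inverse)
qed

lemma flat_exp_derivative:
  "(flat_exp n has_real_derivative (flat_exp (n + 2) t - real n * flat_exp (Suc n) t)) (at t)"
proof -
  consider "t > 0" | "t < 0" | "t = 0" by linarith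
  then show ?thesis
  proof cases
    case 1
    have "((\<lambda>t. inverse t ^ n * exp (- inverse t)) has_real_derivative
        (flat_exp (n + 2) t - real n * flat_exp (Suc n) t)) (at t)"
      using 1 power_eq_if[of t "n - 1"] by (cases n)
        (auto intro!: derivative_eq_intros simp: flat_exp_def field_simps power2_eq_square)
    then show ?thesis
      by (rule has_field_derivative_transform_within_open[of _ _ _ "{0<..}"])
        (use 1 in \<open>auto simp: flat_exp_def\<close>)
  next
    case 2
    have "((\<lambda>t. 0) has_real_derivative (flat_exp (n + 2) t - real n * flat_exp (Suc n) t)) (at t)"
      using 2 by (auto simp: flat_exp_def)
    then show ?thesis
      by (rule has_field_derivative_transform_within_open[of _ _ _ "{..<0}"])
        (use 2 in \<open>auto simp: flat_exp_def\<close>)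
  next
    case 3
    have "((\<lambda>h. flat_exp n h / h) \<longlongrightarrow> 0) (at 0)"
    proof (rule filterlim_split_at)
      show "((\<lambda>h. flat_exp n h / h) \<longlongrightarrow> 0) (at_left 0)"
        by (rule tendsto_eventually) (auto simp: flat_exp_def eventually_at_filter)
      show "((\<lambda>h. flat_exp n h / h) \<longlongrightarrow> 0) (at_right 0)"
        by (rule Lim_transform_eventually[OF flat_exp_tendsto_0[of "Suc n"]])
          (auto simp: flat_exp_def eventually_at_filter field_simps)
    qed
    then show ?thesis
      using 3 by (simp add: DERIV_def flat_exp_def)
  qed
qed

lemma smooth_on_flat_exp: "smooth_on UNIV (flat_exp n)"
  unfolding smooth_on_def
proof
  fix k show "higher_differentiable_on UNIV (flat_exp n) k"
  proof (induction k arbitrary: n)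
    case 0
    show ?case
      using flat_exp_derivative by (auto intro!: DERIV_continuous_on)
  next
    case (Suc k)
    have "higher_differentiable_on UNIV (\<lambda>t. flat_exp (n + 2) t + (- real n) * flat_exp (Suc n) t) k"
      by (intro higher_differentiable_on_add higher_differentiable_on_mult
          higher_differentiable_on_const Suc open_UNIV)
    then show ?case
      by (intro higher_differentiable_on_real_SucI[OF open_UNIV flat_exp_derivative]) simp
  qed
qed

lemma flat_exp_pos: "flat_exp 0 t > 0 \<longleftrightarrow> t > 0" and flat_exp_nonneg: "flat_exp 0 t \<ge> 0"
  by (auto simp: flat_exp_def)

text \<open>The bump is the quotient \<open>u / (u + v)\<close>, where \<open>u\<close> lives inside the ball of radius \<open>R\<close> and \<open>v\<close>
  outside the ball of radius \<open>r\<close>, so that the denominator never vanishes.\<close>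

lemma bump_function_exists:
  fixes c :: "'a::euclidean_space"
  assumes "0 < r" "r < R"
  obtains b where "smooth_on UNIV b" "\<And>y. y \<in> cball c r \<Longrightarrow> b y = (1::real)"
    "\<And>y. dist c y \<ge> R \<Longrightarrow> b y = 0" "\<And>y. 0 \<le> b y"
proof -
  define s where "s y = (y - c) \<bullet> (y - c)" for y :: 'a
  have "smooth_on UNIV (\<lambda>y. (y \<bullet> b - c \<bullet> b) * (y \<bullet> b - c \<bullet> b))" for b :: 'a
  proof -
    have "smooth_on UNIV (\<lambda>y. y \<bullet> b + - (c \<bullet> b))"
      by (rule smooth_on_add[OF open_UNIV smooth_on_linear[OF open_UNIV bounded_linear_inner_left]
            smooth_on_const[OF open_UNIV]])
    then show ?thesis by (intro smooth_on_mult) auto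
  qed
  moreover have "s = (\<lambda>y. \<Sum>b\<in>Basis. (y \<bullet> b - c \<bullet> b) * (y \<bullet> b - c \<bullet> b))"
    unfolding s_def by (rule ext, subst euclidean_inner) (simp add: inner_diff_left)
  ultimately have s: "smooth_on UNIV s"
    by (auto simp: smooth_on_def intro!: higher_differentiable_on_sum)
  have affine: "smooth_on UNIV (\<lambda>y. p + q * s y)" for p q
    using s by (intro smooth_on_add smooth_on_mult) auto
  have s_dist: "s y = (dist c y)\<^sup>2" for y
    by (simp add: s_def dist_norm norm_minus_commute[of c y] power2_norm_eq_inner)
  define u v where "u y = flat_exp 0 (R\<^sup>2 - s y)" and "v y = flat_exp 0 (s y - r\<^sup>2)" for y
  have u: "smooth_on UNIV u" and v: "smooth_on UNIV v"
    using smooth_on_compose[OF open_UNIV open_UNIV _ affine[of "R\<^sup>2" "-1"] smooth_on_flat_exp[of 0]]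
      smooth_on_compose[OF open_UNIV open_UNIV _ affine[of "-r\<^sup>2" 1] smooth_on_flat_exp[of 0]]
    by (auto simp: u_def v_def[abs_def] u_def[abs_def])
  have "r\<^sup>2 < R\<^sup>2" using assms by (simp add: power_strict_mono)
  then have pos: "u y + v y > 0" for y
    using flat_exp_nonneg[of "R\<^sup>2 - s y"] flat_exp_nonneg[of "s y - r\<^sup>2"]
      flat_exp_pos[of "R\<^sup>2 - s y"] flat_exp_pos[of "s y - r\<^sup>2"]
    unfolding u_def v_def by (smt (verit))
  have "smooth_on UNIV (\<lambda>y. u y * inverse (u y + v y))"
    using u v pos by (intro smooth_on_mult smooth_on_inverse smooth_on_add) (auto simp: less_imp_neq[symmetric])
  moreover have "u y * inverse (u y + v y) = 1" if "y \<in> cball c r" for y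
  proof -
    have "s y \<le> r\<^sup>2" using that unfolding s_dist by (simp add: power_mono)
    then have "v y = 0" unfolding v_def by (simp add: flat_exp_def)
    then show ?thesis using pos[of y] by simp
  qed
  moreover have "u y * inverse (u y + v y) = 0" if "dist c y \<ge> R" for y
  proof -
    have "s y \<ge> R\<^sup>2" using that assms unfolding s_dist by (simp add: power_mono)
    then show ?thesis by (simp add: u_def flat_exp_def)
  qed
  moreover have "0 \<le> u y * inverse (u y + v y)" for y
    using pos[of y] flat_exp_nonneg[of "R\<^sup>2 - s y"] by (simp add: u_def)
  ultimately show ?thesis by (rule that)
qed

subsection \<open>Hadamard's lemma\<close>

lemma segment_in_ball:
  fixes c y :: "'a::real_normed_vector"
  assumes "y \<in> ball c r" "t \<in> {0..1}"
  shows "c + t *\<^sub>R (y - c) \<in> ball c r"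
proof -
  have "norm (t *\<^sub>R (y - c)) \<le> 1 * norm (y - c)"
    unfolding norm_scaleR using assms(2) by (intro mult_right_mono) auto
  then show ?thesis
    using assms(1) by (simp add: dist_norm norm_minus_commute)
qed

lemma continuous_on_segment_integrand:
  fixes F :: "'a::euclidean_space \<Rightarrow> real"
  assumes "continuous_on (ball c r) F"
  shows "continuous_on (ball c r \<times> cbox 0 1) (\<lambda>(y, t). t ^ m * F (c + t *\<^sub>R (y - c)))"
proof -
  have "continuous_on (ball c r \<times> cbox 0 1) (\<lambda>p. F (c + snd p *\<^sub>R (fst p - c)))"
    by (rule continuous_on_compose2[OF assms])
      (use segment_in_ball[of _ c r] in \<open>auto intro!: continuous_intros simp del: mem_ball\<close>)
  then show ?thesis
    unfolding split_beta by (intro continuous_intros)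
qed

lemma continuous_on_segment_integrand_single:
  fixes F :: "'a::euclidean_space \<Rightarrow> real"
  assumes "continuous_on (ball c r) F" "y \<in> ball c r"
  shows "continuous_on (cbox 0 1) (\<lambda>t. t ^ m * F (c + t *\<^sub>R (y - c)))"
proof -
  have "continuous_on (cbox 0 1) (\<lambda>t. F (c + t *\<^sub>R (y - c)))"
    by (rule continuous_on_compose2[OF assms(1)])
      (use segment_in_ball[of y c r] assms(2) in \<open>auto intro!: continuous_intros simp del: mem_ball\<close>)
  then show ?thesis by (intro continuous_intros)
qed

text \<open>Differentiating under the integral sign produces a factor \<open>t\<close> and a derivative of \<open>F\<close>. With the
  powers \<open>t\<^sup>m\<close> included, the family of integrals is closed under differentiation.\<close>

lemma higher_differentiable_on_segment_integral:
  fixes F :: "'a::euclidean_space \<Rightarrow> real"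
  assumes "smooth_on (ball c r) F"
  shows "higher_differentiable_on (ball c r)
    (\<lambda>y. integral (cbox 0 1) (\<lambda>t. t ^ m * F (c + t *\<^sub>R (y - c)))) k"
  using assms
proof (induction k arbitrary: m F)
  case 0
  then show ?case
    using integral_continuous_on_param[OF continuous_on_segment_integrand[OF smooth_on_continuous]]
    by simp
next
  case (Suc k)
  let ?B = "ball c r"
  define dF where "dF b y = frechet_derivative F (at y) b" for b y
  have dF: "smooth_on ?B (dF b)" for b
    unfolding dF_def using Suc.prems by (rule smooth_on_frechet_derivative)
  define L where "L y t = (\<Sum>b\<in>Basis. (t ^ Suc m * dF b (c + t *\<^sub>R (y - c))) *\<^sub>R blinfun_inner_left b)"
    for y t
  have L_cont: "continuous_on (?B \<times> cbox 0 1) (\<lambda>(y, t). L y t)"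
    unfolding L_def split_beta
    by (intro continuous_on_sum continuous_on_scaleR continuous_on_const
        continuous_on_segment_integrand[OF smooth_on_continuous[OF dF], unfolded split_beta])
  have F_cont: "continuous_on (cbox 0 1) (\<lambda>t. t ^ m * F (c + t *\<^sub>R (y - c)))" if "y \<in> ?B" for y
    using that by (rule continuous_on_segment_integrand_single[OF smooth_on_continuous[OF Suc.prems]])
  have L_int: "L y integrable_on cbox 0 1" if "y \<in> ?B" for y
    unfolding L_def
    by (intro integrable_continuous continuous_on_sum continuous_on_scaleR continuous_on_const
        continuous_on_segment_integrand_single[OF smooth_on_continuous[OF dF] that])
  have deriv: "((\<lambda>y. integral (cbox 0 1) (\<lambda>t. t ^ m * F (c + t *\<^sub>R (y - c))))
      has_derivative integral (cbox 0 1) (L y)) (at y)" if y: "y \<in> ?B" for y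
  proof -
    have "((\<lambda>y. t ^ m * F (c + t *\<^sub>R (y - c))) has_derivative L y t) (at y within ?B)"
      if "y \<in> ?B" "t \<in> cbox 0 1" for y t
    proof -
      let ?z = "c + t *\<^sub>R (y - c)"
      have z: "?z \<in> ?B" using segment_in_ball[of y c r t] that by auto
      have F': "(F has_derivative frechet_derivative F (at ?z)) (at ?z)"
        by (rule smooth_on_has_derivative[OF Suc.prems z])
      have "((\<lambda>y. t ^ m * F (c + t *\<^sub>R (y - c))) has_derivative
          (\<lambda>v. t ^ m * frechet_derivative F (at ?z) (t *\<^sub>R v))) (at y within ?B)"
        by (rule has_derivative_mult_right, rule has_derivative_compose[where g=F and f="\<lambda>y. c + t *\<^sub>R (y - c)", OF _ F'])
          (auto intro!: derivative_eq_intros)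
      moreover have "t ^ m * frechet_derivative F (at ?z) (t *\<^sub>R v) = L y t v" for v
      proof -
        have l: "linear (frechet_derivative F (at ?z))"
          using F' has_derivative_linear by blast
        have "frechet_derivative F (at ?z) v = frechet_derivative F (at ?z) (\<Sum>b\<in>Basis. (v \<bullet> b) *\<^sub>R b)"
          by (simp add: euclidean_representation)
        also have "\<dots> = (\<Sum>b\<in>Basis. (v \<bullet> b) * dF b ?z)"
          by (simp add: linear_sum[OF l] linear_scale[OF l] dF_def)
        finally show ?thesis
          by (simp add: L_def blinfun.sum_left blinfun.scaleR_left linear_scale[OF l]
              sum_distrib_left mult_ac)
      qed
      ultimately show ?thesis by simp
    qed
    then show ?thesis
      using leibniz_rule[of ?B 0 1 "\<lambda>y t. t ^ m * F (c + t *\<^sub>R (y - c))" L y]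
        integrable_continuous[OF F_cont] L_cont y at_within_open[OF y open_ball]
      by (simp add: convex_ball del: mem_ball)
  qed
  show ?case
  proof (rule higher_differentiable_on_SucI[OF open_ball deriv])
    fix v
    have "integral (cbox 0 1) (L y) v
        = (\<Sum>b\<in>Basis. (v \<bullet> b) * integral (cbox 0 1) (\<lambda>t. t ^ Suc m * dF b (c + t *\<^sub>R (y - c))))"
      if y: "y \<in> ?B" for y
    proof -
      have int: "(\<lambda>t. t ^ Suc m * dF b (c + t *\<^sub>R (y - c))) integrable_on cbox 0 1" for b
        by (rule integrable_continuous,
            rule continuous_on_segment_integrand_single[OF smooth_on_continuous[OF dF] y])
      have "integral (cbox 0 1) (L y) v = integral (cbox 0 1) (\<lambda>t. L y t v)"
        using integral_linear[OF L_int[OF y] blinfun.bounded_linear_left[of v]] by (simp add: o_def)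
      also have "\<dots> = integral (cbox 0 1)
          (\<lambda>t. \<Sum>b\<in>Basis. (v \<bullet> b) * (t ^ Suc m * dF b (c + t *\<^sub>R (y - c))))"
        by (simp add: L_def blinfun.sum_left blinfun.scaleR_left mult_ac)
      also have "\<dots> = (\<Sum>b\<in>Basis. (v \<bullet> b) *
          integral (cbox 0 1) (\<lambda>t. t ^ Suc m * dF b (c + t *\<^sub>R (y - c))))"
        using int by (subst integral_sum) (auto intro!: integrable_on_mult_right simp del: power_Suc)
      finally show ?thesis .
    qed
    moreover have "higher_differentiable_on ?B (\<lambda>y. \<Sum>b\<in>Basis. (v \<bullet> b) *
        integral (cbox 0 1) (\<lambda>t. t ^ Suc m * dF b (c + t *\<^sub>R (y - c)))) k"
      by (intro higher_differentiable_on_sum higher_differentiable_on_mult higher_differentiable_on_const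
          Suc.IH dF open_ball)
    ultimately show "higher_differentiable_on ?B (\<lambda>y. integral (cbox 0 1) (L y) v) k"
      using higher_differentiable_on_cong[OF open_ball] by (smt (verit, best))
  qed
qed

text \<open>A derivation at a point is determined by its values on the coordinates because a smooth
  function is, up to a constant, a combination of centred coordinates with smooth coefficients.\<close>

lemma Hadamard:
  fixes F :: "'a::euclidean_space \<Rightarrow> real"
  assumes "smooth_on (ball c r) F" "0 < r"
  obtains H where "\<And>b. smooth_on (ball c r) (H b)"
    "\<And>y. y \<in> ball c r \<Longrightarrow> F y = F c + (\<Sum>b\<in>Basis. ((y - c) \<bullet> b) * H b y)"
    "\<And>b. H b c = frechet_derivative F (at c) b"
proof
  define H where "H b y = integral (cbox 0 1)
    (\<lambda>t. t ^ 0 * frechet_derivative F (at (c + t *\<^sub>R (y - c))) b)" for b y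
  show "smooth_on (ball c r) (H b)" for b
    unfolding smooth_on_def H_def
    by (intro allI higher_differentiable_on_segment_integral smooth_on_frechet_derivative assms)
  show "H b c = frechet_derivative F (at c) b" for b
    by (simp add: H_def)
  fix y assume y: "y \<in> ball c r"
  let ?z = "\<lambda>t. c + t *\<^sub>R (y - c)"
  have deriv: "((\<lambda>t. F (?z t)) has_vector_derivative
      (\<Sum>b\<in>Basis. ((y - c) \<bullet> b) * frechet_derivative F (at (?z t)) b)) (at t within {0..1})"
    if t: "t \<in> {0..1}" for t
  proof -
    have F': "(F has_derivative frechet_derivative F (at (?z t))) (at (?z t))"
      by (rule smooth_on_has_derivative[OF assms(1) segment_in_ball[OF y t]])
    then have l: "linear (frechet_derivative F (at (?z t)))"
      using has_derivative_linear by blast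
    have "((\<lambda>t. F (?z t)) has_derivative (\<lambda>s. frechet_derivative F (at (?z t)) (s *\<^sub>R (y - c))))
        (at t within {0..1})"
      by (rule has_derivative_compose[where g=F and f="?z", OF _ F']) (auto intro!: derivative_eq_intros)
    moreover have "frechet_derivative F (at (?z t)) (y - c)
        = frechet_derivative F (at (?z t)) (\<Sum>b\<in>Basis. ((y - c) \<bullet> b) *\<^sub>R b)"
      by (simp add: euclidean_representation)
    then have "frechet_derivative F (at (?z t)) (y - c)
        = (\<Sum>b\<in>Basis. ((y - c) \<bullet> b) * frechet_derivative F (at (?z t)) b)"
      by (simp add: linear_sum[OF l] linear_scale[OF l])
    ultimately show ?thesis
      by (simp add: has_vector_derivative_def linear_scale[OF l])
  qed
  have int: "(\<lambda>t. frechet_derivative F (at (?z t)) b) integrable_on {0..1}" for b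
    using integrable_continuous[OF continuous_on_segment_integrand_single[OF smooth_on_continuous[OF
            smooth_on_frechet_derivative[OF assms(1)]] y], of 0 b]
    by simp
  have H: "((\<lambda>t. frechet_derivative F (at (?z t)) b) has_integral H b y) {0..1}" for b
    using integrable_integral[OF int[of b]] unfolding H_def power_0 mult_1 box_real .
  have "((\<lambda>t. \<Sum>b\<in>Basis. ((y - c) \<bullet> b) * frechet_derivative F (at (?z t)) b)
      has_integral (F (?z 1) - F (?z 0))) {0..1}"
    by (rule fundamental_theorem_of_calculus[OF zero_le_one deriv])
  moreover have "((\<lambda>t. \<Sum>b\<in>Basis. ((y - c) \<bullet> b) * frechet_derivative F (at (?z t)) b)
      has_integral (\<Sum>b\<in>Basis. ((y - c) \<bullet> b) * H b y)) {0..1}"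
    by (intro has_integral_sum finite_Basis has_integral_mult_right H)
  ultimately have "F (?z 1) - F (?z 0) = (\<Sum>b\<in>Basis. ((y - c) \<bullet> b) * H b y)"
    by (rule has_integral_unique)
  then show "F y = F c + (\<Sum>b\<in>Basis. ((y - c) \<bullet> b) * H b y)"
    by (simp add: algebra_simps)
qed

section \<open>A finite index type of the dimension\<close>

text \<open>Determinants and changes of variables live on vectors indexed by a finite, well-ordered type,
  while charts take values in an arbitrary Euclidean space \<open>'e\<close>. The type \<open>'e coord\<close> indexes an
  orthonormal basis of \<open>'e\<close>.\<close>

typedef (overloaded) ('e::euclidean_space) coord = "{..<DIM('e)}"
  by (rule exI[of _ 0]) simp

instantiation coord :: (euclidean_space) wellorder
begin

definition less_eq_coord :: "'a coord \<Rightarrow> 'a coord \<Rightarrow> bool"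
  where "less_eq_coord i j \<longleftrightarrow> Rep_coord i \<le> Rep_coord j"

definition less_coord :: "'a coord \<Rightarrow> 'a coord \<Rightarrow> bool"
  where "less_coord i j \<longleftrightarrow> Rep_coord i < Rep_coord j"

instance
proof
  fix P :: "'a coord \<Rightarrow> bool" and a
  assume *: "\<And>x. (\<And>y. y < x \<Longrightarrow> P y) \<Longrightarrow> P x"
  show "P a"
    by (induction a rule: measure_induct_rule[of Rep_coord]) (use * in \<open>auto simp: less_coord_def\<close>)
qed (auto simp: less_eq_coord_def less_coord_def Rep_coord_inject)

end

instance coord :: (euclidean_space) finite
proof
  have "inj (Rep_coord :: 'a coord \<Rightarrow> nat)"
    by (auto intro: injI simp: Rep_coord_inject)
  moreover have "finite (range (Rep_coord :: 'a coord \<Rightarrow> nat))"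
    by (rule finite_subset[OF image_subsetI[OF Rep_coord] finite_lessThan])
  ultimately show "finite (UNIV :: 'a coord set)"
    using finite_imageD by blast
qed

definition axis_of :: "'e coord \<Rightarrow> 'e::euclidean_space"
  where "axis_of = (SOME h. bij_betw h {0..<DIM('e)} Basis) \<circ> Rep_coord"

lemma bij_axis_of: "bij_betw (axis_of :: 'e coord \<Rightarrow> 'e::euclidean_space) UNIV Basis"
proof -
  let ?h = "SOME h. bij_betw h {0..<DIM('e)} (Basis :: 'e set)"
  have "bij_betw ?h {0..<DIM('e)} (Basis :: 'e set)"
    using someI_ex[OF ex_bij_betw_nat_finite[OF finite_Basis]] .
  moreover have "bij_betw (Rep_coord :: 'e coord \<Rightarrow> nat) UNIV {0..<DIM('e)}"
    using type_definition.Rep_range[OF type_definition_coord]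
    by (auto simp: bij_betw_def inj_on_def Rep_coord_inject)
  ultimately show ?thesis
    unfolding axis_of_def using bij_betw_trans by blast
qed

lemma axis_of_Basis [simp]: "axis_of k \<in> Basis"
  using bij_axis_of by (auto simp: bij_betw_def)

lemma sum_axis_of: "(\<Sum>k\<in>UNIV. f (axis_of k)) = (\<Sum>b\<in>Basis. f b)"
  by (rule sum.reindex_bij_betw[OF bij_axis_of])

lemma inner_axis_of: "axis_of k \<bullet> axis_of l = (if k = l then 1 else 0)"
  using bij_axis_of by (auto simp: inner_Basis bij_betw_def inj_on_def)

lemma card_coord: "CARD('e coord) = DIM('e::euclidean_space)"
  using bij_betw_same_card[OF bij_axis_of[where 'e='e]] by simp

definition to_coords :: "'e::euclidean_space \<Rightarrow> real ^ 'e coord"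
  where "to_coords y = (\<chi> k. y \<bullet> axis_of k)"

definition from_coords :: "real ^ 'e coord \<Rightarrow> 'e::euclidean_space"
  where "from_coords x = (\<Sum>k\<in>UNIV. (x $ k) *\<^sub>R axis_of k)"

lemma from_to_coords [simp]: "from_coords (to_coords y) = y"
  unfolding from_coords_def to_coords_def
  using sum_axis_of[of "\<lambda>b. (y \<bullet> b) *\<^sub>R b"] by (simp add: euclidean_representation)

lemma to_from_coords [simp]: "to_coords (from_coords x) = x"
  by (simp add: to_coords_def from_coords_def inner_sum_left inner_axis_of vec_eq_iff
      sum.delta' if_distrib cong: if_cong)

lemma bounded_linear_from_coords: "bounded_linear (from_coords :: real ^ 'e coord \<Rightarrow> 'e::euclidean_space)"
  unfolding from_coords_def[abs_def]
  by (intro bounded_linear_sum bounded_linear_scaleR_const bounded_linear_vec_nth)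

lemma bounded_linear_to_coords: "bounded_linear (to_coords :: 'e::euclidean_space \<Rightarrow> real ^ 'e coord)"
  by (intro linear_conv_bounded_linear[THEN iffD1] linearI)
    (auto simp: to_coords_def vec_eq_iff inner_add_left)

section \<open>Smooth functions, tangent vectors and vector fields\<close>

locale smooth_manifold =
  fixes A :: "('m::t2_space, 'e::euclidean_space) chart set"
  assumes atlas: "smooth_atlas A"
begin

lemma chartD:
  assumes "(U, \<phi>) \<in> A"
  shows "open U" "open (\<phi> ` U)" "homeomorphism U (\<phi> ` U) \<phi> (inv_into U \<phi>)"
  using atlas assms by (auto simp: smooth_atlas_def is_chart_def)

lemma chart_exists:
  obtains U \<phi> where "(U, \<phi>) \<in> A" "p \<in> U"
proof -
  have "p \<in> (\<Union>c\<in>A. fst c)" using atlas by (simp add: smooth_atlas_def)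
  then show ?thesis using that by (metis UN_E prod.collapse)
qed

lemma chart_inv:
  assumes "(U, \<phi>) \<in> A" "q \<in> U" shows "inv_into U \<phi> (\<phi> q) = q"
  using homeomorphism_apply1[OF chartD(3)[OF assms(1)] assms(2)] .

lemma open_chart_image:
  assumes "(U, \<phi>) \<in> A" "open W" "W \<subseteq> U" shows "open (\<phi> ` W)"
  using homeomorphism_imp_open_map[OF chartD(3)[OF assms(1)], of W] assms chartD[OF assms(1)]
  by (auto simp: openin_open_eq open_subset)

lemma open_chart_preimage:
  assumes "(U, \<phi>) \<in> A" "open B" shows "open (U \<inter> \<phi> -` B)"
  using continuous_open_preimage[OF homeomorphism_cont1[OF chartD(3)[OF assms(1)]] chartD(1)[OF assms(1)] assms(2)] .

lemma smooth_funD: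
  "f \<in> smooth_fun A \<Longrightarrow> (U, \<phi>) \<in> A \<Longrightarrow> smooth_on (\<phi> ` U) (f \<circ> inv_into U \<phi>)"
  by (auto simp: smooth_fun_def)

text \<open>Compatibility of the charts makes it enough to test smoothness near each point in one chart.\<close>

lemma smooth_funI:
  assumes "\<And>p. \<exists>U \<phi> W. (U, \<phi>) \<in> A \<and> open W \<and> p \<in> W \<and> W \<subseteq> U \<and>
    smooth_on (\<phi> ` W) (f \<circ> inv_into U \<phi>)"
  shows "f \<in> smooth_fun A"
proof -
  have "smooth_on (\<psi> ` V) (f \<circ> inv_into V \<psi>)" if V: "(V, \<psi>) \<in> A" for V \<psi>
  proof (rule smooth_on_local)
    fix y assume "y \<in> \<psi> ` V"
    then obtain p where p: "p \<in> V" "y = \<psi> p" by auto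
    obtain U \<phi> W where W: "(U, \<phi>) \<in> A" "open W" "p \<in> W" "W \<subseteq> U"
      "smooth_on (\<phi> ` W) (f \<circ> inv_into U \<phi>)" using assms by blast
    let ?T = "\<psi> ` (W \<inter> V)" and ?t = "\<phi> \<circ> inv_into V \<psi>"
    have "open (W \<inter> V)" using W(2) chartD(1)[OF V] by blast
    then have T: "open ?T" using open_chart_image[OF V, of "W \<inter> V"] by blast
    have inv: "inv_into V \<psi> (\<psi> q) = q" if "q \<in> V" for q using chart_inv[OF V that] .
    have "smooth_on (\<psi> ` (V \<inter> U)) ?t"
      using atlas V W(1) by (auto simp: smooth_atlas_def)
    then have t: "smooth_on ?T ?t"
      by (rule smooth_on_subset) (use W(4) in auto)
    have "smooth_on ?T (\<lambda>x. (f \<circ> inv_into U \<phi>) (?t x))"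
      by (rule smooth_on_compose[OF T open_chart_image[OF W(1,2,4)] _ t W(5)]) (auto simp: inv)
    moreover have "(f \<circ> inv_into U \<phi>) (?t x) = (f \<circ> inv_into V \<psi>) x" if "x \<in> ?T" for x
      using that W(4) by (auto simp: inv chart_inv[OF W(1)] subset_iff)
    ultimately have "smooth_on ?T (f \<circ> inv_into V \<psi>)"
      by (rule smooth_on_cong[OF T, THEN iffD1, rotated])
    then show "\<exists>T. open T \<and> y \<in> T \<and> smooth_on T (f \<circ> inv_into V \<psi>)"
      using T p W(3) by blast
  qed
  then show ?thesis by (auto simp: smooth_fun_def)
qed

lemma smooth_fun_local:
  assumes "\<And>p. \<exists>W h. open W \<and> p \<in> W \<and> h \<in> smooth_fun A \<and> (\<forall>q\<in>W. f q = h q)"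
  shows "f \<in> smooth_fun A"
proof (rule smooth_funI)
  fix p
  obtain W h where W: "open W" "p \<in> W" "h \<in> smooth_fun A" "\<forall>q\<in>W. f q = h q" using assms by blast
  obtain U \<phi> where U: "(U, \<phi>) \<in> A" "p \<in> U" by (rule chart_exists)
  have o: "open (U \<inter> W)" using chartD(1)[OF U(1)] W(1) by blast
  have "smooth_on (\<phi> ` (U \<inter> W)) (h \<circ> inv_into U \<phi>)"
    using smooth_funD[OF W(3) U(1)] by (rule smooth_on_subset) auto
  then have "smooth_on (\<phi> ` (U \<inter> W)) (f \<circ> inv_into U \<phi>)"
    by (subst smooth_on_cong[OF open_chart_image[OF U(1) o], of _ "h \<circ> inv_into U \<phi>"])
      (use W(4) chart_inv[OF U(1)] in auto)
  then show "\<exists>U \<phi> W. (U, \<phi>) \<in> A \<and> open W \<and> p \<in> W \<and> W \<subseteq> U \<and> smooth_on (\<phi> ` W) (f \<circ> inv_into U \<phi>)"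
    using o U W by blast
qed

lemma smooth_fun_pointwise:
  assumes "\<And>S (F :: 'e \<Rightarrow> real) G. open S \<Longrightarrow> smooth_on S F \<Longrightarrow> smooth_on S G
      \<Longrightarrow> smooth_on S (\<lambda>y. bop (F y) (G y))"
    and "f \<in> smooth_fun A" "h \<in> smooth_fun A"
  shows "(\<lambda>q. bop (f q) (h q)) \<in> smooth_fun A"
  using assms(1)[OF _ smooth_funD[OF assms(2)] smooth_funD[OF assms(3)]] chartD(2)
  by (auto simp: smooth_fun_def o_def)

lemma smooth_fun_const [simp, intro]: "(\<lambda>q. c) \<in> smooth_fun A"
  using chartD(2) by (auto simp: smooth_fun_def o_def)

lemma smooth_fun_zero [simp, intro]: "0 \<in> smooth_fun A"
  using smooth_fun_const[of 0] by (simp add: zero_fun_def)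

lemma smooth_fun_one [simp, intro]: "1 \<in> smooth_fun A"
  using smooth_fun_const[of 1] by (simp add: one_fun_def)

lemma smooth_fun_add [simp, intro]:
  "f \<in> smooth_fun A \<Longrightarrow> h \<in> smooth_fun A \<Longrightarrow> f + h \<in> smooth_fun A"
  unfolding plus_fun_def by (rule smooth_fun_pointwise) (auto intro: smooth_on_add)

lemma smooth_fun_mult [simp, intro]:
  "f \<in> smooth_fun A \<Longrightarrow> h \<in> smooth_fun A \<Longrightarrow> f * h \<in> smooth_fun A"
  unfolding times_fun_def by (rule smooth_fun_pointwise) (auto intro: smooth_on_mult)

lemma scaleR_fun_eq_mult: "c *\<^sub>R f = (\<lambda>_. c) * (f :: 'a \<Rightarrow> real)"
  by (simp add: fun_eq_iff scaleR_fun_def)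

lemma smooth_fun_scaleR [simp, intro]: "f \<in> smooth_fun A \<Longrightarrow> c *\<^sub>R f \<in> smooth_fun A"
  unfolding scaleR_fun_eq_mult by auto

lemma smooth_fun_uminus [simp, intro]: "f \<in> smooth_fun A \<Longrightarrow> - f \<in> smooth_fun A"
  using smooth_fun_scaleR[of f "-1"] by simp

lemma smooth_fun_diff [simp, intro]:
  "f \<in> smooth_fun A \<Longrightarrow> h \<in> smooth_fun A \<Longrightarrow> f - h \<in> smooth_fun A"
  using smooth_fun_add[of f "- h"] by simp

lemma smooth_fun_sum [intro]:
  "(\<And>i. i \<in> I \<Longrightarrow> f i \<in> smooth_fun A) \<Longrightarrow> (\<Sum>i\<in>I. f i) \<in> smooth_fun A"
  by (induction I rule: infinite_finite_induct) auto

lemma smooth_fun_prod [intro]: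
  "(\<And>i. i \<in> I \<Longrightarrow> f i \<in> smooth_fun A) \<Longrightarrow> (\<Prod>i\<in>I. f i) \<in> smooth_fun A"
  by (induction I rule: infinite_finite_induct) auto

lemma smooth_fun_inverse:
  assumes "f \<in> smooth_fun A" "\<And>q. f q \<noteq> 0"
  shows "(\<lambda>q. inverse (f q)) \<in> smooth_fun A"
  using smooth_on_inverse[OF chartD(2) smooth_funD[OF assms(1)]] assms(2)
  by (auto simp: smooth_fun_def o_def)

lemma smooth_fun_inverse_sqrt:
  assumes "f \<in> smooth_fun A" "\<And>q. f q > 0"
  shows "(\<lambda>q. inverse (sqrt (f q))) \<in> smooth_fun A"
  using smooth_on_inverse_sqrt[OF chartD(2) smooth_funD[OF assms(1)]] assms(2)
  by (auto simp: smooth_fun_def o_def)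

lemma smooth_fun_continuous:
  assumes "f \<in> smooth_fun A" shows "continuous_on UNIV f"
proof -
  have "\<exists>U. open U \<and> p \<in> U \<and> continuous_on U f" for p
  proof -
    obtain U \<phi> where U: "(U, \<phi>) \<in> A" "p \<in> U" by (rule chart_exists)
    have "continuous_on U (\<lambda>q. (f \<circ> inv_into U \<phi>) (\<phi> q))"
      by (rule continuous_on_compose2[OF smooth_on_continuous[OF smooth_funD[OF assms U(1)]]
            homeomorphism_cont1[OF chartD(3)[OF U(1)]]]) auto
    then have "continuous_on U f"
      by (rule continuous_on_eq) (simp add: chart_inv[OF U(1)])
    then show ?thesis using U chartD(1) by blast
  qed
  then show ?thesis
    by (meson UNIV_I continuous_at_imp_continuous_on continuous_on_eq_continuous_at)
qed

lemma open_smooth_pos: "f \<in> smooth_fun A \<Longrightarrow> open {q. f q > 0}"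
  by (intro open_Collect_less continuous_on_const smooth_fun_continuous)

text \<open>Extension by zero from a chart. That the extension is smooth uses that compact sets of the
  manifold are closed.\<close>

lemma smooth_fun_extend:
  assumes U: "(U, \<phi>) \<in> A" and B: "open B" "B \<subseteq> \<phi> ` U" and K: "compact K" "K \<subseteq> B"
    and u: "smooth_on B u" "\<And>y. y \<notin> K \<Longrightarrow> u y = 0"
  shows "(\<lambda>q. if q \<in> U then u (\<phi> q) else 0) \<in> smooth_fun A" (is "?f \<in> _")
proof (rule smooth_funI)
  fix p
  let ?K = "inv_into U \<phi> ` K"
  have "compact ?K"
    using homeomorphism_cont2[OF chartD(3)[OF U]] K B continuous_on_subset
    by (intro compact_continuous_image) blast+
  then have K_closed: "closed ?K" by (rule compact_imp_closed)
  show "\<exists>V \<psi> W. (V, \<psi>) \<in> A \<and> open W \<and> p \<in> W \<and> W \<subseteq> V \<and> smooth_on (\<psi> ` W) (?f \<circ> inv_into V \<psi>)"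
  proof (cases "p \<in> U \<and> \<phi> p \<in> B")
    case True
    let ?W = "U \<inter> \<phi> -` B"
    have W: "open ?W" by (rule open_chart_preimage[OF U B(1)])
    have "smooth_on (\<phi> ` ?W) u" by (rule smooth_on_subset[OF u(1)]) auto
    then have "smooth_on (\<phi> ` ?W) (?f \<circ> inv_into U \<phi>)"
      by (rule smooth_on_cong[OF open_chart_image[OF U W Int_lower1], THEN iffD1, rotated])
        (auto simp: chart_inv[OF U])
    then show ?thesis using U W True by blast
  next
    case False
    have "p \<notin> ?K"
    proof
      assume "p \<in> ?K"
      then obtain y where y: "y \<in> K" "p = inv_into U \<phi> y" by auto
      then have "y \<in> \<phi> ` U" using K B by auto
      then show False
        using False y K(2) inv_into_into[of y \<phi> U] f_inv_into_f[of y \<phi> U] by auto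
    qed
    moreover obtain V \<psi> where V: "(V, \<psi>) \<in> A" "p \<in> V" by (rule chart_exists)
    moreover have W: "open (V - ?K)" using chartD(1)[OF V(1)] K_closed by blast
    have zero: "?f q = 0" if "q \<notin> ?K" for q
      using that u(2)[of "\<phi> q"] chart_inv[OF U, of q] by (metis image_eqI)
    have "(0::real) = (?f \<circ> inv_into V \<psi>) y" if y: "y \<in> \<psi> ` (V - ?K)" for y
    proof -
      obtain x where "x \<in> V - ?K" "y = \<psi> x" using y by blast
      then show ?thesis using zero[of x] chart_inv[OF V(1), of x] by (auto split: if_splits)
    qed
    then have "smooth_on (\<psi> ` (V - ?K)) (?f \<circ> inv_into V \<psi>)"
      using smooth_on_const[OF open_chart_image[OF V(1) W]]
        smooth_on_cong[OF open_chart_image[OF V(1) W], of "\<lambda>_. 0" "?f \<circ> inv_into V \<psi>"] by blast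
    ultimately show ?thesis using W by blast
  qed
qed

lemma bump_exists:
  assumes "open W" "p \<in> W"
  obtains \<theta> N K where "\<theta> \<in> smooth_fun A" "open N" "p \<in> N" "N \<subseteq> W" "\<And>q. q \<in> N \<Longrightarrow> \<theta> q = 1"
    "closed K" "K \<subseteq> W" "\<And>q. q \<notin> K \<Longrightarrow> \<theta> q = 0" "\<And>q. 0 \<le> \<theta> q"
proof -
  obtain U \<phi> where U: "(U, \<phi>) \<in> A" "p \<in> U" by (rule chart_exists)
  have o: "open (\<phi> ` (U \<inter> W))" "\<phi> p \<in> \<phi> ` (U \<inter> W)"
    using open_chart_image[OF U(1), of "U \<inter> W"] chartD(1)[OF U(1)] assms U(2) by auto
  then obtain R where R: "R > 0" "cball (\<phi> p) R \<subseteq> \<phi> ` (U \<inter> W)"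
    using open_contains_cball by blast
  obtain b where b: "smooth_on UNIV b" "\<And>y. y \<in> cball (\<phi> p) (R/2) \<Longrightarrow> b y = (1::real)"
    "\<And>y. dist (\<phi> p) y \<ge> R \<Longrightarrow> b y = 0" "\<And>y. 0 \<le> b y"
    using bump_function_exists[of "R/2" R "\<phi> p"] R(1) by auto
  let ?\<theta> = "\<lambda>q. if q \<in> U then b (\<phi> q) else 0"
  let ?N = "U \<inter> \<phi> -` ball (\<phi> p) (R/2)"
  let ?K = "inv_into U \<phi> ` cball (\<phi> p) R"
  have sub: "\<phi> ` (U \<inter> W) \<subseteq> \<phi> ` U" by auto
  have preimage: "q \<in> W" if q: "q \<in> U" "\<phi> q \<in> cball (\<phi> p) R" for q
  proof -
    obtain q' where "q' \<in> U \<inter> W" "\<phi> q = \<phi> q'" using q(2) R(2) by blast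
    then show ?thesis using chart_inv[OF U(1)] q(1) by (metis IntE)
  qed
  show ?thesis
  proof (rule that[of ?\<theta> ?N ?K])
    show "?\<theta> \<in> smooth_fun A"
      by (rule smooth_fun_extend[OF U(1) o(1) sub compact_cball R(2)])
        (use b(3) smooth_on_subset[OF b(1)] in auto)
    show "open ?N" by (rule open_chart_preimage[OF U(1) open_ball])
    show "p \<in> ?N" using U R(1) by auto
    show "?N \<subseteq> W"
      using preimage R(1) by (auto simp: mem_cball)
    show "?\<theta> q = 1" if "q \<in> ?N" for q using that b(2) by auto
    have "continuous_on (cball (\<phi> p) R) (inv_into U \<phi>)"
      using homeomorphism_cont2[OF chartD(3)[OF U(1)]] R(2) sub continuous_on_subset by blast
    then show "closed ?K" by (intro compact_imp_closed compact_continuous_image compact_cball)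
    show "?K \<subseteq> W"
    proof
      fix q assume "q \<in> ?K"
      then obtain y where y: "y \<in> cball (\<phi> p) R" "q = inv_into U \<phi> y" by auto
      then obtain q' where "q' \<in> U \<inter> W" "y = \<phi> q'" using R(2) by blast
      then show "q \<in> W" using y chart_inv[OF U(1)] by auto
    qed
    show "?\<theta> q = 0" if "q \<notin> ?K" for q
      using that b(3)[of "\<phi> q"] chart_inv[OF U(1), of q] by (metis image_eqI linear mem_cball)
    show "0 \<le> ?\<theta> q" for q using b(4) by simp
  qed
qed

text \<open>Makes reciprocals and square roots of functions that are positive near a point available as
  global smooth functions, as the Gram--Schmidt process requires.\<close>

lemma smooth_fun_pos_near:
  assumes "f \<in> smooth_fun A" "f p > 0"
  obtains h W where "h \<in> smooth_fun A" "open W" "p \<in> W" "\<And>q. q \<in> W \<Longrightarrow> h q = f q" "\<And>q. h q > 0"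
proof -
  obtain \<theta> N K where \<theta>: "\<theta> \<in> smooth_fun A" "open N" "p \<in> N" "N \<subseteq> {q. f q > 0}"
    "\<And>q. q \<in> N \<Longrightarrow> \<theta> q = 1" "closed K" "K \<subseteq> {q. f q > 0}" "\<And>q. q \<notin> K \<Longrightarrow> \<theta> q = 0" "\<And>q. 0 \<le> \<theta> q"
    using bump_exists[OF open_smooth_pos[OF assms(1)], of p] assms(2)
    by (metis (no_types, lifting) mem_Collect_eq)
  \<comment> \<open>The first summand is positive where \<open>\<theta> \<noteq> 0\<close>, the second one elsewhere.\<close>
  let ?h = "\<theta> * f + (1 - \<theta>) * (1 - \<theta>)"
  show ?thesis
  proof (rule that[of ?h N])
    show "?h q > 0" for q
    proof (cases "q \<in> K \<and> \<theta> q \<noteq> 0")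
      case True
      then have "\<theta> q * f q > 0" using \<theta>(7,9) by (auto intro!: mult_pos_pos simp: less_le)
      then show ?thesis by (simp add: add_pos_nonneg)
    next
      case False
      then show ?thesis using \<theta>(8)[of q] by auto
    qed
  qed (use \<theta> assms in auto)
qed

subsection \<open>Tangent vectors\<close>

lemma tangent_add: "v \<in> tangent_space A p \<Longrightarrow> f \<in> smooth_fun A \<Longrightarrow> h \<in> smooth_fun A \<Longrightarrow> v (f + h) = v f + v h"
  and tangent_scaleR: "v \<in> tangent_space A p \<Longrightarrow> f \<in> smooth_fun A \<Longrightarrow> v (c *\<^sub>R f) = c * v f"
  and tangent_mult: "v \<in> tangent_space A p \<Longrightarrow> f \<in> smooth_fun A \<Longrightarrow> h \<in> smooth_fun A
    \<Longrightarrow> v (f * h) = v f * h p + f p * v h"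
  and tangent_nonsmooth: "v \<in> tangent_space A p \<Longrightarrow> f \<notin> smooth_fun A \<Longrightarrow> v f = 0"
  by (simp_all add: tangent_space_def)

lemma tangent_const: "v \<in> tangent_space A p \<Longrightarrow> v (\<lambda>_. c) = 0"
proof -
  assume v: "v \<in> tangent_space A p"
  have "v (1 * 1) = v 1 * 1 p + 1 p * v 1" by (rule tangent_mult[OF v]) auto
  then have "v 1 = 0" by simp
  moreover have "(\<lambda>_::'m. c) = c *\<^sub>R 1" by (simp add: fun_eq_iff scaleR_fun_def)
  ultimately show ?thesis using tangent_scaleR[OF v smooth_fun_one, of c] by simp
qed

lemma tangent_uminus:
  assumes "v \<in> tangent_space A p" "f \<in> smooth_fun A" shows "v (- f) = - v f"
  using tangent_scaleR[OF assms, of "-1"] by simp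

lemma tangent_diff:
  assumes "v \<in> tangent_space A p" "f \<in> smooth_fun A" "h \<in> smooth_fun A"
  shows "v (f - h) = v f - v h"
  using tangent_add[OF assms(1,2), of "- h"] tangent_uminus[OF assms(1,3)] assms(3) by simp

lemma tangent_sum:
  assumes "v \<in> tangent_space A p" "\<And>i. i \<in> I \<Longrightarrow> f i \<in> smooth_fun A"
  shows "v (\<Sum>i\<in>I. f i) = (\<Sum>i\<in>I. v (f i))"
  using assms(2)
proof (induction I rule: infinite_finite_induct)
  case (insert i I)
  then have "v (f i + (\<Sum>i\<in>I. f i)) = v (f i) + v (\<Sum>i\<in>I. f i)"
    by (intro tangent_add[OF assms(1)] smooth_fun_sum) auto
  moreover have "(\<Sum>i\<in>insert i I. f i) = f i + (\<Sum>i\<in>I. f i)"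
    by (rule sum.insert[OF insert.hyps])
  ultimately show ?case using insert by (metis insert_iff sum.insert)
qed (use tangent_const[OF assms(1), of 0] in \<open>auto simp: zero_fun_def\<close>)

text \<open>If \<open>f = h\<close> near \<open>p\<close>, then \<open>f - h\<close> is a product of itself and of a function \<open>1 - \<theta>\<close>, both of
  which vanish at \<open>p\<close>.\<close>

lemma tangent_local:
  assumes v: "v \<in> tangent_space A p" and f: "f \<in> smooth_fun A" "h \<in> smooth_fun A"
    and W: "open W" "p \<in> W" "\<And>q. q \<in> W \<Longrightarrow> f q = h q"
  shows "v f = v h"
proof -
  obtain \<theta> N K where \<theta>: "\<theta> \<in> smooth_fun A" "open N" "p \<in> N" "N \<subseteq> W" "\<And>q. q \<in> N \<Longrightarrow> \<theta> q = 1"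
    "closed K" "K \<subseteq> W" "\<And>q. q \<notin> K \<Longrightarrow> \<theta> q = 0" "\<And>q. 0 \<le> \<theta> q"
    using bump_exists[OF W(1,2)] by metis
  have "f - h = (f - h) * (1 - \<theta>)"
    using W(3) \<theta>(7,8) by (fastforce simp: fun_eq_iff)
  then have "v (f - h) = v ((f - h) * (1 - \<theta>))" by simp
  also have "\<dots> = v (f - h) * (1 - \<theta>) p + (f - h) p * v (1 - \<theta>)"
    by (rule tangent_mult[OF v]) (use f \<theta> in auto)
  also have "\<dots> = 0" using \<theta>(3,5) W by simp
  finally show ?thesis using tangent_diff[OF v f] by simp
qed

lemma tangent_space_add: "v \<in> tangent_space A p \<Longrightarrow> w \<in> tangent_space A p \<Longrightarrow> v + w \<in> tangent_space A p"
  by (auto simp: tangent_space_def algebra_simps)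

lemma tangent_space_scaleR: "v \<in> tangent_space A p \<Longrightarrow> c *\<^sub>R v \<in> tangent_space A p"
  by (auto simp: tangent_space_def scaleR_fun_def algebra_simps)

subsection \<open>The module of vector fields\<close>

lemma vector_fieldsI:
  "(\<And>p. X p \<in> tangent_space A p) \<Longrightarrow> (\<And>f. f \<in> smooth_fun A \<Longrightarrow> vf_deriv X f \<in> smooth_fun A)
    \<Longrightarrow> X \<in> vector_fields A"
  by (simp add: vector_fields_def)

lemma vf_tangent: "X \<in> vector_fields A \<Longrightarrow> X p \<in> tangent_space A p"
  by (simp add: vector_fields_def)

lemma vf_deriv_smooth [simp, intro]:
  "X \<in> vector_fields A \<Longrightarrow> f \<in> smooth_fun A \<Longrightarrow> vf_deriv X f \<in> smooth_fun A"
  by (simp add: vector_fields_def)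

text \<open>Two vector fields need only be compared on smooth functions, because tangent vectors are zero on
  all others.\<close>

lemma vf_eqI:
  assumes "X \<in> vector_fields A" "Y \<in> vector_fields A"
    "\<And>f p. f \<in> smooth_fun A \<Longrightarrow> X p f = Y p f"
  shows "X = Y"
proof (intro ext)
  fix p f show "X p f = Y p f"
    using assms tangent_nonsmooth[OF vf_tangent] by (cases "f \<in> smooth_fun A") metis+
qed

lemma vf_add [simp, intro]:
  "X \<in> vector_fields A \<Longrightarrow> Y \<in> vector_fields A \<Longrightarrow> X + Y \<in> vector_fields A"
proof -
  assume *: "X \<in> vector_fields A" "Y \<in> vector_fields A"
  have "vf_deriv (X + Y) f = vf_deriv X f + vf_deriv Y f" for f
    by (simp add: vf_deriv_def fun_eq_iff)
  then show ?thesis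
    using * by (intro vector_fieldsI) (auto intro: tangent_space_add vf_tangent)
qed

lemma vf_scale_closed [simp, intro]:
  "f \<in> smooth_fun A \<Longrightarrow> X \<in> vector_fields A \<Longrightarrow> f \<odot> X \<in> vector_fields A"
proof -
  assume *: "f \<in> smooth_fun A" "X \<in> vector_fields A"
  have "vf_deriv (f \<odot> X) h = f * vf_deriv X h" for h
    by (simp add: vf_deriv_def vf_scale_def scaleR_fun_def fun_eq_iff)
  then show ?thesis
    using * by (intro vector_fieldsI) (auto simp: vf_scale_def intro: tangent_space_scaleR vf_tangent)
qed

lemma scaleR_eq_vf_scale: "c *\<^sub>R X = (\<lambda>_. c) \<odot> X"
  by (simp add: vf_scale_def scaleR_fun_def fun_eq_iff)

lemma vf_scaleR [simp, intro]: "X \<in> vector_fields A \<Longrightarrow> c *\<^sub>R X \<in> vector_fields A"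
  unfolding scaleR_eq_vf_scale by auto

lemma vf_uminus [simp, intro]: "X \<in> vector_fields A \<Longrightarrow> - X \<in> vector_fields A"
  using vf_scaleR[of X "-1"] by simp

lemma vf_diff [simp, intro]:
  "X \<in> vector_fields A \<Longrightarrow> Y \<in> vector_fields A \<Longrightarrow> X - Y \<in> vector_fields A"
  using vf_add[of X "- Y"] by simp

lemma vf_zero [simp, intro]: "0 \<in> vector_fields A"
proof -
  have "vf_deriv 0 f = (0 :: 'm \<Rightarrow> real)" for f by (simp add: vf_deriv_def fun_eq_iff)
  then show ?thesis by (intro vector_fieldsI) (auto simp: tangent_space_def)
qed

lemma vf_sum [intro]:
  "(\<And>i. i \<in> I \<Longrightarrow> X i \<in> vector_fields A) \<Longrightarrow> (\<Sum>i\<in>I. X i) \<in> vector_fields A"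
  by (induction I rule: infinite_finite_induct) auto

lemma vf_deriv_add [simp]: "vf_deriv (X + Y) f = vf_deriv X f + vf_deriv Y f"
  and vf_deriv_diff [simp]: "vf_deriv (X - Y) f = vf_deriv X f - vf_deriv Y f"
  and vf_deriv_uminus [simp]: "vf_deriv (- X) f = - vf_deriv X f"
  and vf_deriv_scale [simp]: "vf_deriv (h \<odot> X) f = h * vf_deriv X f"
  and vf_deriv_zero [simp]: "vf_deriv 0 f = 0"
  and vf_deriv_scaleR [simp]: "vf_deriv (c *\<^sub>R X) f = c *\<^sub>R vf_deriv X f"
  by (simp_all add: vf_deriv_def fun_eq_iff vf_scale_def scaleR_fun_def)

lemma vf_deriv_fun_add:
  "X \<in> vector_fields A \<Longrightarrow> f \<in> smooth_fun A \<Longrightarrow> h \<in> smooth_fun A \<Longrightarrow>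
    vf_deriv X (f + h) = vf_deriv X f + vf_deriv X h"
  and vf_deriv_fun_diff:
  "X \<in> vector_fields A \<Longrightarrow> f \<in> smooth_fun A \<Longrightarrow> h \<in> smooth_fun A \<Longrightarrow>
    vf_deriv X (f - h) = vf_deriv X f - vf_deriv X h"
  and vf_deriv_fun_uminus:
  "X \<in> vector_fields A \<Longrightarrow> f \<in> smooth_fun A \<Longrightarrow> vf_deriv X (- f) = - vf_deriv X f"
  and vf_deriv_fun_mult:
  "X \<in> vector_fields A \<Longrightarrow> f \<in> smooth_fun A \<Longrightarrow> h \<in> smooth_fun A \<Longrightarrow>
    vf_deriv X (f * h) = vf_deriv X f * h + f * vf_deriv X h"
  and vf_deriv_fun_scaleR:
  "X \<in> vector_fields A \<Longrightarrow> f \<in> smooth_fun A \<Longrightarrow> vf_deriv X (c *\<^sub>R f) = c *\<^sub>R vf_deriv X f"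
  and vf_deriv_fun_zero: "X \<in> vector_fields A \<Longrightarrow> vf_deriv X 0 = 0"
  using tangent_add[OF vf_tangent] tangent_diff[OF vf_tangent] tangent_uminus[OF vf_tangent]
    tangent_mult[OF vf_tangent] tangent_scaleR[OF vf_tangent] tangent_const[OF vf_tangent, of X _ 0]
  by (auto simp: vf_deriv_def fun_eq_iff scaleR_fun_def zero_fun_def)

lemma lie_bracket_deriv:
  "vf_deriv (lie_bracket X Y) f = vf_deriv X (vf_deriv Y f) - vf_deriv Y (vf_deriv X f)"
  by (simp add: vf_deriv_def lie_bracket_def fun_eq_iff)

lemma lie_bracket_closed [simp, intro]:
  assumes "X \<in> vector_fields A" "Y \<in> vector_fields A"
  shows "lie_bracket X Y \<in> vector_fields A"
proof -
  have zero: "vf_deriv Z f = (\<lambda>_. 0)" if "Z \<in> vector_fields A" "f \<notin> smooth_fun A" for Z f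
    using tangent_nonsmooth[OF vf_tangent[OF that(1)] that(2)] by (simp add: vf_deriv_def)
  have eq: "lie_bracket X Y p f = vf_deriv X (vf_deriv Y f) p - vf_deriv Y (vf_deriv X f) p" for p f
    by (simp add: vf_deriv_def lie_bracket_def)
  have "lie_bracket X Y p \<in> tangent_space A p" for p
    unfolding tangent_space_def mem_Collect_eq eq
  proof (intro conjI ballI allI impI)
    fix f h assume fh: "f \<in> smooth_fun A" "h \<in> smooth_fun A"
    show "vf_deriv X (vf_deriv Y (f + h)) p - vf_deriv Y (vf_deriv X (f + h)) p =
      vf_deriv X (vf_deriv Y f) p - vf_deriv Y (vf_deriv X f) p +
      (vf_deriv X (vf_deriv Y h) p - vf_deriv Y (vf_deriv X h) p)"
      using assms fh by (simp add: vf_deriv_fun_add)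
    show "vf_deriv X (vf_deriv Y (f * h)) p - vf_deriv Y (vf_deriv X (f * h)) p =
      (vf_deriv X (vf_deriv Y f) p - vf_deriv Y (vf_deriv X f) p) * h p +
      f p * (vf_deriv X (vf_deriv Y h) p - vf_deriv Y (vf_deriv X h) p)"
      using assms fh by (simp add: vf_deriv_fun_add vf_deriv_fun_mult algebra_simps)
  next
    fix f :: "'m \<Rightarrow> real" and c :: real assume f: "f \<in> smooth_fun A"
    show "vf_deriv X (vf_deriv Y (c *\<^sub>R f)) p - vf_deriv Y (vf_deriv X (c *\<^sub>R f)) p =
      c * (vf_deriv X (vf_deriv Y f) p - vf_deriv Y (vf_deriv X f) p)"
      using assms f by (simp add: vf_deriv_fun_scaleR) (simp add: scaleR_fun_def algebra_simps)
  next
    fix f assume "f \<notin> smooth_fun A"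
    then show "vf_deriv X (vf_deriv Y f) p - vf_deriv Y (vf_deriv X f) p = 0"
      using zero[of X f] zero[of Y f] assms
      by (simp add: vf_deriv_def tangent_const[OF vf_tangent[OF assms(1)]]
          tangent_const[OF vf_tangent[OF assms(2)]])
  qed
  then show ?thesis
    using assms by (intro vector_fieldsI) (auto simp: lie_bracket_deriv)
qed

end

section \<open>Coordinate systems and locality of tensor fields\<close>

lemma sum_fun_apply: "(\<Sum>i\<in>I. f i) x = (\<Sum>i\<in>I. f i x)"
  by (induction I rule: infinite_finite_induct) auto

lemma prod_fun_apply: "(\<Prod>i\<in>I. f i) x = (\<Prod>i\<in>I. f i x)"
  by (induction I rule: infinite_finite_induct) auto

context smooth_manifold
begin

text \<open>Coordinates \<open>\<xi>\<close> on an open set \<open>N\<close> with inverse \<open>\<eta>\<close>, together with global vector fields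
  \<open>e k\<close> and global functions \<open>x k\<close> that restrict on \<open>N\<close> to the coordinate fields and to the
  components of \<open>\<xi>\<close>.\<close>

definition coord_system ::
    "'m set \<Rightarrow> ('m \<Rightarrow> real ^ 'e coord) \<Rightarrow> (real ^ 'e coord \<Rightarrow> 'm) \<Rightarrow> ('e coord \<Rightarrow> 'm vfield)
      \<Rightarrow> ('e coord \<Rightarrow> 'm \<Rightarrow> real) \<Rightarrow> bool"
  where "coord_system N \<xi> \<eta> e x \<longleftrightarrow>
    open N \<and> open (\<xi> ` N) \<and> homeomorphism N (\<xi> ` N) \<xi> \<eta> \<and>
    (\<forall>k. e k \<in> vector_fields A \<and> x k \<in> smooth_fun A) \<and>
    (\<forall>q\<in>N. \<forall>k. x k q = \<xi> q $ k) \<and>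
    (\<forall>q\<in>N. \<forall>X\<in>vector_fields A. \<forall>f. X q f = (\<Sum>k\<in>UNIV. X q (x k) * e k q f)) \<and>
    (\<forall>f\<in>smooth_fun A. \<forall>y\<in>\<xi> ` N.
      (f \<circ> \<eta> has_derivative (\<lambda>v. \<Sum>k\<in>UNIV. v $ k * e k (\<eta> y) f)) (at y))"

lemma frechet_derivative_chart:
  assumes "(U, \<phi>) \<in> A" "q \<in> U" "f \<in> smooth_fun A"
  shows "(f \<circ> inv_into U \<phi> has_derivative frechet_derivative (f \<circ> inv_into U \<phi>) (at (\<phi> q))) (at (\<phi> q))"
  using smooth_on_has_derivative[OF smooth_funD[OF assms(3,1)]] assms(2) by blast

text \<open>Coordinate fields become global vector fields after a cut-off in the chart.\<close>

lemma chart_field: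
  assumes U: "(U, \<phi>) \<in> A" and K: "compact K" "K \<subseteq> \<phi> ` U"
    and b: "smooth_on UNIV b" "\<And>y. y \<notin> K \<Longrightarrow> b y = (0::real)"
  shows "(\<lambda>q f. if f \<in> smooth_fun A \<and> q \<in> U
    then b (\<phi> q) * frechet_derivative (f \<circ> inv_into U \<phi>) (at (\<phi> q)) v else 0) \<in> vector_fields A"
    (is "?X \<in> _")
proof (rule vector_fieldsI)
  fix q
  show "?X q \<in> tangent_space A q"
  proof (cases "q \<in> U")
    case False
    then show ?thesis by (simp add: tangent_space_def)
  next
    case q: True
    let ?d = "\<lambda>f. frechet_derivative (f \<circ> inv_into U \<phi>) (at (\<phi> q))"
    note D = frechet_derivative_chart[OF U q]
    have "?d (f + h) = (\<lambda>v. ?d f v + ?d h v)"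
      and "?d (f * h) = (\<lambda>v. f q * ?d h v + ?d f v * h q)"
      if "f \<in> smooth_fun A" "h \<in> smooth_fun A" for f h
      using frechet_derivative_at[OF has_derivative_add[OF D[OF that(1)] D[OF that(2)]]]
        frechet_derivative_at[OF has_derivative_mult[OF D[OF that(1)] D[OF that(2)]]] chart_inv[OF U q]
      by (simp_all add: o_def plus_fun_def times_fun_def)
    moreover have "?d (c *\<^sub>R f) = (\<lambda>v. c * ?d f v)" if "f \<in> smooth_fun A" for f c
      using frechet_derivative_at[OF has_derivative_mult_right[OF D[OF that], of c]]
      by (simp add: o_def scaleR_fun_def)
    ultimately show ?thesis
      using q by (auto simp: tangent_space_def algebra_simps)
  qed
next
  fix f assume f: "f \<in> smooth_fun A"
  have "vf_deriv ?X f = (\<lambda>q. if q \<in> U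
      then (if \<phi> q \<in> \<phi> ` U then b (\<phi> q) * frechet_derivative (f \<circ> inv_into U \<phi>) (at (\<phi> q)) v else 0) else 0)"
    using f by (auto simp: vf_deriv_def fun_eq_iff)
  also have "\<dots> \<in> smooth_fun A"
  proof (rule smooth_fun_extend[OF U chartD(2)[OF U] order_refl K])
    have "smooth_on (\<phi> ` U) (\<lambda>y. b y * frechet_derivative (f \<circ> inv_into U \<phi>) (at y) v)"
      by (rule smooth_on_mult[OF chartD(2)[OF U] smooth_on_subset[OF b(1) subset_UNIV]
            smooth_on_frechet_derivative[OF smooth_funD[OF f U]]])
    then show "smooth_on (\<phi> ` U) (\<lambda>y. if y \<in> \<phi> ` U
        then b y * frechet_derivative (f \<circ> inv_into U \<phi>) (at y) v else 0)"
      by (rule smooth_on_cong[OF chartD(2)[OF U], THEN iffD1, rotated]) simp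
  qed (use b(2) in auto)
  finally show "vf_deriv ?X f \<in> smooth_fun A" .
qed

text \<open>In a chart every tangent vector is the derivative in the direction whose components are its
  values on the coordinate functions. This is where Hadamard's lemma enters.\<close>

lemma tangent_chart_expansion:
  assumes U: "(U, \<phi>) \<in> A" and q: "q \<in> U" "open W" "q \<in> W" and v: "v \<in> tangent_space A q"
    and x: "\<And>k. x k \<in> smooth_fun A" "\<And>k q. q \<in> W \<Longrightarrow> q \<in> U \<Longrightarrow> x k q = \<phi> q \<bullet> axis_of k"
    and f: "f \<in> smooth_fun A"
  shows "v f = (\<Sum>k\<in>UNIV. v (x k) * frechet_derivative (f \<circ> inv_into U \<phi>) (at (\<phi> q)) (axis_of k))"
proof -
  let ?F = "f \<circ> inv_into U \<phi>" and ?c = "\<phi> q"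
  obtain s where s: "s > 0" "ball ?c s \<subseteq> \<phi> ` U"
    using chartD(2)[OF U] q(1) by (meson image_eqI open_contains_ball)
  have F: "smooth_on (ball ?c s) ?F"
    by (rule smooth_on_subset[OF smooth_funD[OF f U] s(2)])
  obtain H where H: "\<And>b. smooth_on (ball ?c s) (H b)"
    "\<And>y. y \<in> ball ?c s \<Longrightarrow> ?F y = ?F ?c + (\<Sum>b\<in>Basis. ((y - ?c) \<bullet> b) * H b y)"
    "\<And>b. H b ?c = frechet_derivative ?F (at ?c) b"
    by (rule Hadamard[OF F s(1)]) blast
  have "0 < s/3" "s/3 < s/2" using s(1) by auto
  then obtain b where b: "smooth_on UNIV b" "\<And>y. y \<in> cball ?c (s/3) \<Longrightarrow> b y = (1::real)"
    "\<And>y. dist ?c y \<ge> s/2 \<Longrightarrow> b y = 0"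
    by (rule bump_function_exists[of "s/3" "s/2" ?c]) blast
  define h where "h k = (\<lambda>q. if q \<in> U then b (\<phi> q) * H (axis_of k) (\<phi> q) else 0)" for k
  have h: "h k \<in> smooth_fun A" for k
    unfolding h_def
  proof (rule smooth_fun_extend[OF U open_ball s(2) compact_cball[of ?c "s/2"]])
    show "smooth_on (ball ?c s) (\<lambda>y. b y * H (axis_of k) y)"
      by (rule smooth_on_mult[OF open_ball smooth_on_subset[OF b(1) subset_UNIV] H(1)])
  qed (use b(3) s(1) in auto)
  let ?G = "(\<lambda>_. f q) + (\<Sum>k\<in>UNIV. (x k - (\<lambda>_. x k q)) * h k)"
  have "v f = v ?G"
  proof (rule tangent_local[OF v f])
    show "open (W \<inter> (U \<inter> \<phi> -` ball ?c (s/3)))"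
      using q(2) open_chart_preimage[OF U open_ball] by blast
    show "q \<in> W \<inter> (U \<inter> \<phi> -` ball ?c (s/3))" using q s(1) by auto
    fix q' assume q': "q' \<in> W \<inter> (U \<inter> \<phi> -` ball ?c (s/3))"
    then have bb: "b (\<phi> q') = 1" and in_ball: "\<phi> q' \<in> ball ?c s" using b(2) s(1) by auto
    have "f q' = f q + (\<Sum>b\<in>Basis. ((\<phi> q' - ?c) \<bullet> b) * H b (\<phi> q'))"
      using H(2)[OF in_ball] chart_inv[OF U] q(1) q' by simp
    also have "(\<Sum>b\<in>Basis. ((\<phi> q' - ?c) \<bullet> b) * H b (\<phi> q'))
        = (\<Sum>k\<in>UNIV. (x k q' - x k q) * h k q')"
      unfolding sum_axis_of[symmetric, of "\<lambda>b. ((\<phi> q' - ?c) \<bullet> b) * H b (\<phi> q')"]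
      using q' q x(2) bb by (simp add: h_def inner_diff_left)
    finally show "f q' = ?G q'" by (simp add: sum_fun_apply)
  qed (use x(1) h in \<open>auto intro!: smooth_fun_add smooth_fun_sum\<close>)
  also have "\<dots> = v (\<lambda>_. f q) + (\<Sum>k\<in>UNIV. v ((x k - (\<lambda>_. x k q)) * h k))"
    using x(1) h by (subst tangent_add[OF v]; (subst tangent_sum[OF v])?) (auto intro!: smooth_fun_sum)
  also have "\<dots> = (\<Sum>k\<in>UNIV. v (x k) * h k q)"
    using x(1) h by (simp add: tangent_mult[OF v] tangent_diff[OF v] tangent_const[OF v])
  also have "\<dots> = (\<Sum>k\<in>UNIV. v (x k) * frechet_derivative ?F (at ?c) (axis_of k))"
    using q(1) b(2)[of ?c] H(3) s(1) by (simp add: h_def)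
  finally show ?thesis .
qed

lemma coord_system_exists:
  obtains N \<xi> \<eta> e x where "coord_system N \<xi> \<eta> e x" "p \<in> N"
proof -
  obtain U \<phi> where U: "(U, \<phi>) \<in> A" "p \<in> U" by (rule chart_exists)
  let ?c = "\<phi> p" and ?\<phi>i = "inv_into U \<phi>"
  obtain R where R: "R > 0" "cball ?c R \<subseteq> \<phi> ` U"
    using chartD(2)[OF U(1)] U(2) by (meson image_eqI open_contains_cball)
  obtain b where b: "smooth_on UNIV b" "\<And>y. y \<in> cball ?c (R/2) \<Longrightarrow> b y = (1::real)"
    "\<And>y. dist ?c y \<ge> R \<Longrightarrow> b y = 0"
    using bump_function_exists[of "R/2" R ?c] R(1)
    by (metis half_gt_zero field_sum_of_halves less_add_same_cancel1)
  let ?B = "ball ?c (R/2)"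
  define N where "N = U \<inter> \<phi> -` ?B"
  define \<xi> where "\<xi> q = to_coords (\<phi> q)" for q
  define \<eta> where "\<eta> y = ?\<phi>i (from_coords y)" for y :: "real ^ 'e coord"
  define x where "x k = (\<lambda>q. if q \<in> U then b (\<phi> q) * (\<phi> q \<bullet> axis_of k) else 0)" for k
  define e where "e k = (\<lambda>q f. if f \<in> smooth_fun A \<and> q \<in> U
    then b (\<phi> q) * frechet_derivative (f \<circ> ?\<phi>i) (at (\<phi> q)) (axis_of k) else 0)" for k
  have N: "open N" unfolding N_def by (rule open_chart_preimage[OF U(1) open_ball])
  have B_sub: "?B \<subseteq> \<phi> ` U" using R by auto
  have b1: "b (\<phi> q) = 1" if "q \<in> N" for q using that b(2) by (auto simp: N_def)
  have \<phi>_N: "\<phi> ` N = ?B" using B_sub by (auto simp: N_def)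
  have \<xi>_N: "\<xi> ` N = from_coords -` ?B"
  proof
    show "\<xi> ` N \<subseteq> from_coords -` ?B" by (auto simp: \<xi>_def N_def)
    show "from_coords -` ?B \<subseteq> \<xi> ` N"
    proof
      fix y :: "real ^ 'e coord" assume "y \<in> from_coords -` ?B"
      then have "from_coords y \<in> \<phi> ` N" using \<phi>_N by simp
      then obtain q where "q \<in> N" "from_coords y = \<phi> q" by blast
      then have "\<xi> q = y" by (metis \<xi>_def to_from_coords)
      then show "y \<in> \<xi> ` N" using \<open>q \<in> N\<close> by blast
    qed
  qed
  have from_cont: "continuous_on S (from_coords :: real ^ 'e coord \<Rightarrow> 'e)" for S
    by (rule linear_continuous_on[OF bounded_linear_from_coords])
  have to_cont: "continuous_on S (to_coords :: 'e \<Rightarrow> _)" for S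
    by (rule linear_continuous_on[OF bounded_linear_to_coords])
  have open_\<xi>: "open (\<xi> ` N)"
    unfolding \<xi>_N using continuous_on_open_vimage[OF open_UNIV, of from_coords] from_cont open_ball by auto
  have hom: "homeomorphism N (\<xi> ` N) \<xi> \<eta>"
  proof (rule homeomorphismI)
    show "continuous_on N \<xi>"
      unfolding \<xi>_def[abs_def]
      by (rule continuous_on_compose2[OF to_cont[of UNIV]
            continuous_on_subset[OF homeomorphism_cont1[OF chartD(3)[OF U(1)]]]]) (auto simp: N_def)
    show "continuous_on (\<xi> ` N) \<eta>"
      unfolding \<eta>_def[abs_def] \<xi>_N
      by (rule continuous_on_compose2[OF homeomorphism_cont2[OF chartD(3)[OF U(1)]] from_cont])
        (use B_sub in auto)
    show inv: "\<eta> (\<xi> q) = q" if "q \<in> N" for q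
      using that chart_inv[OF U(1)] by (simp add: \<eta>_def \<xi>_def N_def)
    then show "\<eta> ` \<xi> ` N \<subseteq> N" by auto
    show "\<xi> (\<eta> y) = y" if "y \<in> \<xi> ` N" for y using that inv by auto
  qed auto
  have x: "x k \<in> smooth_fun A" for k
    unfolding x_def
  proof (rule smooth_fun_extend[OF U(1) chartD(2)[OF U(1)] order_refl compact_cball R(2)])
    show "smooth_on (\<phi> ` U) (\<lambda>y. b y * (y \<bullet> axis_of k))"
      by (rule smooth_on_mult[OF chartD(2)[OF U(1)] smooth_on_subset[OF b(1) subset_UNIV]
            smooth_on_linear[OF chartD(2)[OF U(1)] bounded_linear_inner_left]])
  qed (use b(3) in auto)
  have e: "e k \<in> vector_fields A" for k
    unfolding e_def by (rule chart_field[OF U(1) compact_cball R(2) b(1)]) (use b(3) in auto)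
  have "X q f = (\<Sum>k\<in>UNIV. X q (x k) * e k q f)"
    if "q \<in> N" "X \<in> vector_fields A" for X q f
  proof (cases "f \<in> smooth_fun A")
    case True
    have "X q f = (\<Sum>k\<in>UNIV. X q (x k) * frechet_derivative (f \<circ> ?\<phi>i) (at (\<phi> q)) (axis_of k))"
      by (rule tangent_chart_expansion[OF U(1) _ N that(1) vf_tangent[OF that(2)] x _ True])
        (use that(1) b1 in \<open>auto simp: x_def N_def\<close>)
    then show ?thesis
      using that(1) True b1[OF that(1)] by (simp add: e_def N_def)
  next
    case False
    then show ?thesis
      using tangent_nonsmooth[OF vf_tangent[OF that(2)] False] by (simp add: e_def)
  qed
  moreover have "(f \<circ> \<eta> has_derivative (\<lambda>v. \<Sum>k\<in>UNIV. v $ k * e k (\<eta> y) f)) (at y)"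
    if f: "f \<in> smooth_fun A" and y: "y \<in> \<xi> ` N" for f y
  proof -
    obtain q where q: "q \<in> N" "y = \<xi> q" using y by blast
    then have qU: "q \<in> U" and fy: "from_coords y = \<phi> q" and \<eta>y: "\<eta> y = q"
      using chart_inv[OF U(1)] by (auto simp: \<xi>_def \<eta>_def N_def)
    note D = frechet_derivative_chart[OF U(1) qU f]
    then have l: "linear (frechet_derivative (f \<circ> ?\<phi>i) (at (\<phi> q)))" using has_derivative_linear by blast
    have "((\<lambda>y. (f \<circ> ?\<phi>i) (from_coords y)) has_derivative
        (\<lambda>v. frechet_derivative (f \<circ> ?\<phi>i) (at (\<phi> q)) (from_coords v))) (at y)"
      by (rule has_derivative_compose[where g = "f \<circ> ?\<phi>i",
            OF bounded_linear_imp_has_derivative[OF bounded_linear_from_coords]], unfold fy, rule D)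
    moreover have "frechet_derivative (f \<circ> ?\<phi>i) (at (\<phi> q)) (from_coords v)
        = (\<Sum>k\<in>UNIV. v $ k * e k (\<eta> y) f)" for v
      using qU f b1[OF q(1)] \<eta>y
      by (simp add: from_coords_def linear_sum[OF l] linear_scale[OF l] e_def)
    ultimately show ?thesis by (simp add: o_def \<eta>_def)
  qed
  ultimately have "coord_system N \<xi> \<eta> e x"
    unfolding coord_system_def using N open_\<xi> hom x e b1
    by (auto simp: x_def \<xi>_def to_coords_def N_def)
  then show ?thesis
    by (rule that) (use U R in \<open>auto simp: N_def\<close>)
qed

lemma coord_field_coord:
  assumes "coord_system N \<xi> \<eta> e x" "p \<in> N"
  shows "e k p (x l) = (if k = l then 1 else 0)"
proof -
  have cs: "open (\<xi> ` N)" "homeomorphism N (\<xi> ` N) \<xi> \<eta>" "\<And>k. x k \<in> smooth_fun A"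
    "\<And>q k. q \<in> N \<Longrightarrow> x k q = \<xi> q $ k"
    "\<And>f y. f \<in> smooth_fun A \<Longrightarrow> y \<in> \<xi> ` N \<Longrightarrow>
      (f \<circ> \<eta> has_derivative (\<lambda>v. \<Sum>k\<in>UNIV. v $ k * e k (\<eta> y) f)) (at y)"
    using assms(1) by (auto simp: coord_system_def)
  have \<eta>: "\<eta> (\<xi> p) = p" using homeomorphism_apply1[OF cs(2) assms(2)] .
  have y: "\<xi> p \<in> \<xi> ` N" using assms(2) by simp
  have "((\<lambda>y. y $ l) has_derivative (\<lambda>v. \<Sum>k\<in>UNIV. v $ k * e k p (x l))) (at (\<xi> p))"
  proof (rule has_derivative_transform_within_open[OF cs(5)[OF cs(3) y, unfolded \<eta>] cs(1) y])
    fix y assume "y \<in> \<xi> ` N"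
    then show "(x l \<circ> \<eta>) y = y $ l"
      using cs(4) homeomorphism_apply1[OF cs(2)] by auto
  qed
  moreover have "((\<lambda>y. y $ l) has_derivative (\<lambda>v. v $ l)) (at (\<xi> p))"
    by (rule bounded_linear_imp_has_derivative[OF bounded_linear_vec_nth])
  ultimately have "(\<lambda>v. \<Sum>k\<in>UNIV. v $ k * e k p (x l)) = (\<lambda>v. v $ l)"
    by (rule has_derivative_unique)
  then have "(\<Sum>m\<in>UNIV. axis k (1::real) $ m * e m p (x l)) = axis k 1 $ l" by (rule fun_cong)
  then show ?thesis by (auto simp: axis_def if_distrib[of "\<lambda>z. z * _"] sum.delta cong: if_cong)
qed

lemma one_formD:
  assumes "one_form A \<alpha>"
  shows one_form_closed: "X \<in> vector_fields A \<Longrightarrow> \<alpha> X \<in> smooth_fun A"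
    and one_form_add: "X \<in> vector_fields A \<Longrightarrow> Y \<in> vector_fields A \<Longrightarrow> \<alpha> (X + Y) = \<alpha> X + \<alpha> Y"
    and one_form_scale: "f \<in> smooth_fun A \<Longrightarrow> X \<in> vector_fields A \<Longrightarrow> \<alpha> (f \<odot> X) = f * \<alpha> X"
  using assms by (auto simp: one_form_def)

lemma one_form_scaleR:
  "one_form A \<alpha> \<Longrightarrow> X \<in> vector_fields A \<Longrightarrow> \<alpha> (c *\<^sub>R X) = c *\<^sub>R \<alpha> X"
  unfolding scaleR_eq_vf_scale scaleR_fun_eq_mult by (rule one_form_scale) auto

lemma one_form_zero: "one_form A \<alpha> \<Longrightarrow> \<alpha> 0 = 0"
  using one_form_scaleR[of \<alpha> 0 0] by simp

lemma one_form_uminus: "one_form A \<alpha> \<Longrightarrow> X \<in> vector_fields A \<Longrightarrow> \<alpha> (- X) = - \<alpha> X"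
  using one_form_scaleR[of \<alpha> X "-1"] by simp

lemma one_form_diff:
  "one_form A \<alpha> \<Longrightarrow> X \<in> vector_fields A \<Longrightarrow> Y \<in> vector_fields A \<Longrightarrow> \<alpha> (X - Y) = \<alpha> X - \<alpha> Y"
  using one_form_add[of \<alpha> X "- Y"] one_form_uminus[of \<alpha> Y] by simp

lemma one_form_sum:
  assumes "one_form A \<alpha>" "\<And>i. i \<in> I \<Longrightarrow> X i \<in> vector_fields A"
  shows "\<alpha> (\<Sum>i\<in>I. X i) = (\<Sum>i\<in>I. \<alpha> (X i))"
  using assms(2)
proof (induction I rule: infinite_finite_induct)
  case (insert i I)
  have "\<alpha> (X i + (\<Sum>i\<in>I. X i)) = \<alpha> (X i) + \<alpha> (\<Sum>i\<in>I. X i)"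
    by (rule one_form_add[OF assms(1)]) (use insert.prems in auto)
  then show ?case using insert by (metis insert_iff sum.insert)
qed (use one_form_zero[OF assms(1)] in auto)

text \<open>The coordinate expansion holds on \<open>N\<close> only. Multiplied by a bump function \<open>\<theta>\<close> it becomes an
  identity of global vector fields, to which linearity of \<open>\<alpha>\<close> applies.\<close>

lemma one_form_coord_expansion:
  assumes "coord_system N \<xi> \<eta> e x" "p \<in> N" "one_form A \<alpha>" "X \<in> vector_fields A"
  shows "\<alpha> X p = (\<Sum>k\<in>UNIV. X p (x k) * \<alpha> (e k) p)"
proof -
  have cs: "open N" "\<And>k. e k \<in> vector_fields A" "\<And>k. x k \<in> smooth_fun A"
    "\<And>q f. q \<in> N \<Longrightarrow> X q f = (\<Sum>k\<in>UNIV. X q (x k) * e k q f)"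
    using assms(1,4) by (auto simp: coord_system_def)
  obtain \<theta> M K where \<theta>: "\<theta> \<in> smooth_fun A" "open M" "p \<in> M" "M \<subseteq> N" "\<And>q. q \<in> M \<Longrightarrow> \<theta> q = 1"
    "closed K" "K \<subseteq> N" "\<And>q. q \<notin> K \<Longrightarrow> \<theta> q = 0" "\<And>q. 0 \<le> \<theta> q"
    using bump_exists[OF cs(1) assms(2)] by metis
  have "\<theta> \<odot> X = (\<Sum>k\<in>UNIV. (\<theta> * vf_deriv X (x k)) \<odot> e k)"
  proof (intro ext)
    fix q f
    show "(\<theta> \<odot> X) q f = (\<Sum>k\<in>UNIV. (\<theta> * vf_deriv X (x k)) \<odot> e k) q f"
    proof (cases "q \<in> N")
      case True
      then show ?thesis using cs(4)[OF True, of f]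
        by (simp add: vf_scale_def scaleR_fun_def sum_fun_apply vf_deriv_def sum_distrib_left mult_ac)
    next
      case False
      then have "\<theta> q = 0" using \<theta> by blast
      then show ?thesis by (simp add: vf_scale_def scaleR_fun_def sum_fun_apply)
    qed
  qed
  then have "\<alpha> (\<theta> \<odot> X) = (\<Sum>k\<in>UNIV. \<alpha> ((\<theta> * vf_deriv X (x k)) \<odot> e k))"
    using \<theta>(1) cs assms(4)
    by (simp only:) (rule one_form_sum[OF assms(3)], auto intro!: vf_scale_closed)
  also have "\<dots> = (\<Sum>k\<in>UNIV. (\<theta> * vf_deriv X (x k)) * \<alpha> (e k))"
    using \<theta>(1) cs assms(4)
    by (intro sum.cong refl one_form_scale[OF assms(3)] smooth_fun_mult vf_deriv_smooth)
  finally have "\<alpha> (\<theta> \<odot> X) = (\<Sum>k\<in>UNIV. (\<theta> * vf_deriv X (x k)) * \<alpha> (e k))" .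
  moreover have "\<alpha> (\<theta> \<odot> X) = \<theta> * \<alpha> X" by (rule one_form_scale[OF assms(3) \<theta>(1) assms(4)])
  ultimately have "(\<theta> * \<alpha> X) p = (\<Sum>k\<in>UNIV. (\<theta> * vf_deriv X (x k)) * \<alpha> (e k)) p"
    by (simp only:)
  then have "\<theta> p * \<alpha> X p = (\<Sum>k\<in>UNIV. \<theta> p * X p (x k) * \<alpha> (e k) p)"
    by (simp add: sum_fun_apply vf_deriv_def)
  then show ?thesis using \<theta>(3,5) by simp
qed

lemma one_form_local:
  assumes "one_form A \<alpha>" "X \<in> vector_fields A" "Y \<in> vector_fields A" "X p = Y p"
  shows "\<alpha> X p = \<alpha> Y p"
proof -
  obtain N \<xi> \<eta> e x where "coord_system N \<xi> \<eta> e x" "p \<in> N" by (rule coord_system_exists)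
  then show ?thesis
    by (simp add: one_form_coord_expansion[OF _ _ assms(1,2)] one_form_coord_expansion[OF _ _ assms(1,3)]
        assms(4))
qed

lemma bilinear_fieldD:
  assumes "bilinear_field A B" "X \<in> vector_fields A"
  shows "one_form A (B X)" "one_form A (\<lambda>Y. B Y X)"
  using assms by (auto simp: bilinear_field_def)

end

context smooth_manifold
begin

definition onb_at :: "'m form2 \<Rightarrow> 'm \<Rightarrow> (nat \<Rightarrow> 'm vfield) \<Rightarrow> bool"
  where "onb_at g p E \<longleftrightarrow> (\<forall>i<DIM('e). E i \<in> vector_fields A) \<and>
    (\<forall>i<DIM('e). \<forall>j<DIM('e). g (E i) (E j) p = (if i = j then 1 else 0))"

lemma orthonormal_frame_onb_at: "orthonormal_frame A g W E \<Longrightarrow> p \<in> W \<Longrightarrow> onb_at g p E"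
  by (auto simp: orthonormal_frame_def onb_at_def)

end

section \<open>Frames and traces on an almost Hermitian manifold\<close>

locale almost_hermitian = smooth_manifold A
  for A :: "('m::t2_space, 'e::euclidean_space) chart set" +
  fixes g :: "'m form2" and J :: "'m vfield \<Rightarrow> 'm vfield" and n :: nat
  assumes dim_even: "DIM('e) = 2 * n"
    and metric: "riemannian_metric A g"
    and J_endo: "endo_field A J"
    and J_J [simp]: "X \<in> vector_fields A \<Longrightarrow> J (J X) = - X"
    and g_J_J: "X \<in> vector_fields A \<Longrightarrow> Y \<in> vector_fields A \<Longrightarrow> g (J X) (J Y) = g X Y"
begin

lemma g_bilinear: "bilinear_field A g"
  using metric by (simp add: riemannian_metric_def)

lemmas g_left = bilinear_fieldD(1)[OF g_bilinear] and g_right = bilinear_fieldD(2)[OF g_bilinear]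

lemma g_commute: "X \<in> vector_fields A \<Longrightarrow> Y \<in> vector_fields A \<Longrightarrow> g X Y = g Y X"
  using metric by (simp add: riemannian_metric_def)

lemma g_pos: "X \<in> vector_fields A \<Longrightarrow> X p \<noteq> 0 \<Longrightarrow> g X X p > 0"
  using metric by (simp add: riemannian_metric_def)

lemma g_smooth [simp, intro]:
  "X \<in> vector_fields A \<Longrightarrow> Y \<in> vector_fields A \<Longrightarrow> g X Y \<in> smooth_fun A"
  by (rule one_form_closed[OF g_left])

lemma g_linear:
  assumes "X \<in> vector_fields A" "Y \<in> vector_fields A" "Z \<in> vector_fields A"
  shows "g (X + Y) Z = g X Z + g Y Z" "g Z (X + Y) = g Z X + g Z Y"
    "g (X - Y) Z = g X Z - g Y Z" "g Z (X - Y) = g Z X - g Z Y"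
  using one_form_add[OF g_left] one_form_add[OF g_right] one_form_diff[OF g_left]
    one_form_diff[OF g_right] assms by auto

lemma g_scale:
  assumes "X \<in> vector_fields A" "Z \<in> vector_fields A"
  shows "f \<in> smooth_fun A \<Longrightarrow> g (f \<odot> X) Z = f * g X Z" "f \<in> smooth_fun A \<Longrightarrow> g Z (f \<odot> X) = f * g Z X"
    "g (c *\<^sub>R X) Z = c *\<^sub>R g X Z" "g Z (c *\<^sub>R X) = c *\<^sub>R g Z X"
    "g (- X) Z = - g X Z" "g Z (- X) = - g Z X"
  using one_form_scale[OF g_left] one_form_scale[OF g_right] one_form_uminus[OF g_left]
    one_form_uminus[OF g_right] one_form_scaleR[OF g_left] one_form_scaleR[OF g_right] assms by auto

lemma g_eq_0_iff: "X \<in> vector_fields A \<Longrightarrow> g X X p = 0 \<longleftrightarrow> X p = 0"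
proof
  assume X: "X \<in> vector_fields A" "X p = 0"
  show "g X X p = 0"
    using one_form_local[OF g_left[OF X(1)] X(1) vf_zero, of p] X(2) one_form_zero[OF g_left[OF X(1)]]
    by simp
qed (use g_pos in force)

lemma g_nonneg: "X \<in> vector_fields A \<Longrightarrow> g X X p \<ge> 0"
  using g_pos[of X p] g_eq_0_iff[of X p] by (cases "X p = 0") auto

lemma vf_eq_via_g:
  assumes "X \<in> vector_fields A" "Y \<in> vector_fields A"
    "\<And>Z. Z \<in> vector_fields A \<Longrightarrow> g X Z = g Y Z"
  shows "X = Y"
proof
  fix p
  have "g (X - Y) (X - Y) = 0"
    using assms by (simp add: g_linear)
  then have "(X - Y) p = 0" using g_eq_0_iff[of "X - Y" p] assms(1,2) by simp
  then show "X p = Y p" by simp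
qed

lemma J_closed [simp, intro]: "X \<in> vector_fields A \<Longrightarrow> J X \<in> vector_fields A"
  and J_add: "X \<in> vector_fields A \<Longrightarrow> Y \<in> vector_fields A \<Longrightarrow> J (X + Y) = J X + J Y"
  and J_scale: "f \<in> smooth_fun A \<Longrightarrow> X \<in> vector_fields A \<Longrightarrow> J (f \<odot> X) = f \<odot> J X"
  using J_endo by (auto simp: endo_field_def)

lemma J_scaleR: "X \<in> vector_fields A \<Longrightarrow> J (c *\<^sub>R X) = c *\<^sub>R J X"
  unfolding scaleR_eq_vf_scale by (rule J_scale) auto

lemma J_zero: "J 0 = 0"
  using J_scaleR[of 0 0] by (simp only: scaleR_zero_left vf_zero)

lemma J_uminus: "X \<in> vector_fields A \<Longrightarrow> J (- X) = - J X"
  using J_scaleR[of X "-1"] by simp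

lemma J_diff: "X \<in> vector_fields A \<Longrightarrow> Y \<in> vector_fields A \<Longrightarrow> J (X - Y) = J X - J Y"
  using J_add[of X "- Y"] J_uminus[of Y] by simp

lemma g_J: "X \<in> vector_fields A \<Longrightarrow> Y \<in> vector_fields A \<Longrightarrow> g (J X) Y = - g X (J Y)"
  using g_J_J[of X "J Y"] by (simp add: g_scale) (metis minus_minus)

lemma g_J_self: "X \<in> vector_fields A \<Longrightarrow> g X (J X) = 0"
proof -
  assume X: "X \<in> vector_fields A"
  have "g X (J X) = - g X (J X)" using g_J[OF X X] g_commute[of "J X" X] X by simp
  then show ?thesis by (simp add: fun_eq_iff)
qed

lemma g_sum_left:
  assumes "\<And>i. i \<in> I \<Longrightarrow> X i \<in> vector_fields A" "Y \<in> vector_fields A"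
  shows "g (\<Sum>i\<in>I. X i) Y = (\<Sum>i\<in>I. g (X i) Y)"
  by (rule one_form_sum[OF g_right]) (use assms in auto)

subsection \<open>Orthonormal bases of the tangent spaces\<close>

text \<open>The components of the \<open>E i\<close> in coordinates are \<open>DIM('e)\<close> independent vectors, so they span;
  pairing with the \<open>E j\<close> identifies the coefficients.\<close>

lemma onb_expansion:
  assumes E: "onb_at g p E" and \<alpha>: "one_form A \<alpha>" and X: "X \<in> vector_fields A"
  shows "\<alpha> X p = (\<Sum>i<DIM('e). g X (E i) p * \<alpha> (E i) p)"
proof -
  have E_vf: "E i \<in> vector_fields A" if "i < DIM('e)" for i using E that by (simp add: onb_at_def)
  have E_on: "g (E i) (E j) p = (if i = j then 1 else 0)" if "i < DIM('e)" "j < DIM('e)" for i j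
    using E that by (simp add: onb_at_def)
  obtain N \<xi> \<eta> e x where cs: "coord_system N \<xi> \<eta> e x" "p \<in> N" by (rule coord_system_exists)
  define c where "c X = (\<chi> k. X p (x k))" for X :: "'m vfield"
  have lin: "\<beta> X p = (\<Sum>i<DIM('e). a i * \<beta> (E i) p)"
    if \<beta>: "one_form A \<beta>" and X: "X \<in> vector_fields A" and cX: "c X = (\<Sum>i<DIM('e). a i *\<^sub>R c (E i))"
    for \<beta> X a
  proof -
    have "X p (x k) = (\<Sum>i<DIM('e). a i * E i p (x k))" for k
      using arg_cong[OF cX, of "\<lambda>v. v $ k"] by (simp add: c_def)
    then have "\<beta> X p = (\<Sum>k\<in>UNIV. (\<Sum>i<DIM('e). a i * E i p (x k)) * \<beta> (e k) p)"
      using one_form_coord_expansion[OF cs \<beta> X] by simp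
    also have "\<dots> = (\<Sum>i<DIM('e). a i * (\<Sum>k\<in>UNIV. E i p (x k) * \<beta> (e k) p))"
      unfolding sum_distrib_left sum_distrib_right mult.assoc by (rule sum.swap)
    also have "\<dots> = (\<Sum>i<DIM('e). a i * \<beta> (E i) p)"
      using one_form_coord_expansion[OF cs \<beta> E_vf] by simp
    finally show ?thesis .
  qed
  have coef: "a j = g X (E j) p"
    if "j < DIM('e)" "X \<in> vector_fields A" "c X = (\<Sum>i<DIM('e). a i *\<^sub>R c (E i))" for X a j
  proof -
    have "g X (E j) p = (\<Sum>i<DIM('e). a i * g (E i) (E j) p)"
      by (rule lin[OF g_right[OF E_vf[OF that(1)]] that(2,3)])
    also have "\<dots> = a j" using E_on that(1) by (simp add: mult_delta_right)
    finally show ?thesis by simp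
  qed
  let ?S = "(\<lambda>i. c (E i)) ` {..<DIM('e)}"
  have inj: "inj_on (\<lambda>i. c (E i)) {..<DIM('e)}"
  proof (rule inj_onI)
    fix i j assume ij: "i \<in> {..<DIM('e)}" "j \<in> {..<DIM('e)}" "c (E i) = c (E j)"
    have "c (E i) = (\<Sum>m<DIM('e). (if m = j then 1 else 0) *\<^sub>R c (E m))"
      using ij by (simp add: if_distrib[of "\<lambda>z. z *\<^sub>R _"] sum.delta cong: if_cong)
    then have "(if i = i then 1 else 0) = g (E i) (E i) p \<and> (if i = j then 1 else 0) = g (E i) (E i) p"
      using coef[of i "E i" "\<lambda>m. if m = j then 1 else 0"] E_on[of i i] E_vf[of i] ij by auto
    then show "i = j" by (auto split: if_splits)
  qed
  have "independent ?S"
  proof (rule independent_if_scalars_zero)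
    fix u v assume u: "(\<Sum>v\<in>?S. u v *\<^sub>R v) = 0" and v: "v \<in> ?S"
    then obtain j where j: "j < DIM('e)" "v = c (E j)" by auto
    have "c 0 = (\<Sum>i<DIM('e). u (c (E i)) *\<^sub>R c (E i))"
      using u sum.reindex[OF inj, of "\<lambda>v. u v *\<^sub>R v"] by (simp add: c_def vec_eq_iff o_def)
    then have "u (c (E j)) = g 0 (E j) p" using coef[OF j(1) vf_zero, of "\<lambda>i. u (c (E i))"] by simp
    then show "u v = 0" using one_form_zero[OF g_right[OF E_vf[OF j(1)]]] j by simp
  qed simp
  moreover have "card ?S = DIM(real ^ 'e coord)"
    using card_image[OF inj] by (simp add: card_coord)
  ultimately have "span ?S = UNIV"
    using dim_eq_full[of ?S] dim_eq_card_independent[of ?S] by simp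
  then have "c X \<in> range (\<lambda>u. \<Sum>v\<in>?S. u v *\<^sub>R v)"
    using span_finite[of ?S] by simp
  then obtain u where "c X = (\<Sum>v\<in>?S. u v *\<^sub>R v)" by blast
  then have cX: "c X = (\<Sum>i<DIM('e). u (c (E i)) *\<^sub>R c (E i))"
    using sum.reindex[OF inj, of "\<lambda>v. u v *\<^sub>R v"] by (simp add: o_def)
  show ?thesis
    using lin[OF \<alpha> X cX] coef[OF _ X cX] by simp
qed

lemma exists_outside_span:
  assumes "m < DIM('e)"
  shows "\<exists>Y\<in>vector_fields A. Y p \<noteq> (\<Sum>i<m. a Y i *\<^sub>R E i p)"
proof (rule ccontr)
  assume "\<not> ?thesis"
  then have *: "Y p = (\<Sum>i<m. a Y i *\<^sub>R E i p)" if "Y \<in> vector_fields A" for Y using that by blast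
  obtain N \<xi> \<eta> e x where cs: "coord_system N \<xi> \<eta> e x" "p \<in> N" by (rule coord_system_exists)
  define c where "c v = (\<chi> k. v (x k))" for v :: "'m tangent"
  let ?S = "(\<lambda>i. c (E i p)) ` {..<m}"
  have "axis k 1 \<in> span ?S" for k
  proof -
    have "axis k 1 = c (e k p)"
      by (auto simp: c_def vec_eq_iff axis_def coord_field_coord[OF cs])
    also have "\<dots> = (\<Sum>i<m. a (e k) i *\<^sub>R c (E i p))"
    proof -
      have "e k \<in> vector_fields A" using cs(1) by (simp add: coord_system_def)
      from arg_cong[OF *[OF this], of c] show ?thesis
        by (simp add: c_def vec_eq_iff sum_fun_apply scaleR_fun_def)
    qed
    also have "\<dots> \<in> span ?S"
      by (intro span_sum span_scale span_base) auto
    finally show ?thesis .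
  qed
  then have "(Basis :: (real ^ 'e coord) set) \<subseteq> span ?S"
    by (auto simp: Basis_vec_def)
  then have "span ?S = UNIV"
    using span_mono[of Basis "span ?S"] by (auto simp: span_span)
  then have "dim ?S = DIM(real ^ 'e coord)" using dim_eq_full by blast
  moreover have "dim ?S \<le> card ?S" by (rule dim_le_card') simp
  moreover have "card ?S \<le> m" using card_image_le[of "{..<m}" "\<lambda>i. c (E i p)"] by simp
  ultimately show False using assms by (simp add: card_coord)
qed

text \<open>The Gram--Schmidt step. The field \<open>J F\<close> is orthogonal to the previous fields as well, because
  their span is invariant under \<open>J\<close>.\<close>

lemma adapted_frame_step:
  assumes k: "k < n" and W: "open W" "p \<in> W"
    and E: "\<And>i. i < 2 * k \<Longrightarrow> E i \<in> vector_fields A"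
      "\<And>i j q. i < 2 * k \<Longrightarrow> j < 2 * k \<Longrightarrow> q \<in> W \<Longrightarrow> g (E i) (E j) q = (if i = j then 1 else 0)"
      "\<And>i. i < k \<Longrightarrow> E (2 * i + 1) = J (E (2 * i))"
  shows "\<exists>F W'. open W' \<and> p \<in> W' \<and> W' \<subseteq> W \<and> F \<in> vector_fields A \<and> (\<forall>q\<in>W'. g F F q = 1) \<and>
    (\<forall>i<2 * k. \<forall>q\<in>W'. g F (E i) q = 0 \<and> g (J F) (E i) q = 0)"
proof -
  have "2 * k < DIM('e)" using k dim_even by simp
  from exists_outside_span[OF this, of p "\<lambda>Y i. g Y (E i) p" E]
  obtain Y where Y: "Y \<in> vector_fields A" "Y p \<noteq> (\<Sum>i<2*k. g Y (E i) p *\<^sub>R E i p)" by blast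
  define Z where "Z = Y - (\<Sum>i<2*k. g Y (E i) \<odot> E i)"
  have Z: "Z \<in> vector_fields A" unfolding Z_def using Y E(1) by (auto intro!: vf_diff vf_sum)
  have "Z p \<noteq> 0" using Y(2) by (simp add: Z_def sum_fun_apply vf_scale_def)
  then have "g Z Z p > 0" by (rule g_pos[OF Z])
  then obtain h W1 where h: "h \<in> smooth_fun A" "open W1" "p \<in> W1" "\<And>q. q \<in> W1 \<Longrightarrow> h q = g Z Z q" "\<And>q. h q > 0"
    using smooth_fun_pos_near[of "g Z Z" p] Z by auto
  \<comment> \<open>\<open>h\<close> is the squared length of \<open>Z\<close> near \<open>p\<close>, but positive everywhere, so \<open>f\<close> is globally smooth.\<close>
  define f where "f = (\<lambda>q. inverse (sqrt (h q)))"
  have f: "f \<in> smooth_fun A" unfolding f_def by (rule smooth_fun_inverse_sqrt[OF h(1,5)])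
  define F where "F = f \<odot> Z"
  have F: "F \<in> vector_fields A" using f Z by (auto simp: F_def)
  have ZE: "g Z (E i) q = 0" if "i < 2 * k" "q \<in> W" for i q
  proof -
    have "g Z (E i) = g Y (E i) - (\<Sum>j<2*k. g Y (E j) * g (E j) (E i))"
      unfolding Z_def using Y E(1) that(1)
      by (subst g_linear; (subst g_sum_left)?) (auto intro!: vf_sum sum.cong simp: g_scale)
    then have "g Z (E i) q = g Y (E i) q - (\<Sum>j<2*k. g Y (E j) q * g (E j) (E i) q)"
      by (simp add: sum_fun_apply)
    also have "(\<Sum>j<2*k. g Y (E j) q * g (E j) (E i) q) = (\<Sum>j<2*k. if j = i then g Y (E j) q else 0)"
      using E(2) that by (intro sum.cong) auto
    also have "g Y (E i) q - \<dots> = 0" using that by (simp add: sum.delta)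
    finally show ?thesis .
  qed
  have FE: "g F (E i) q = 0" if "i < 2 * k" "q \<in> W" for i q
    using ZE[OF that] f Z E(1)[OF that(1)] by (simp add: F_def g_scale)
  have FJE: "g F (J (E i)) q = 0" if i: "i < 2 * k" and q: "q \<in> W" for i q
  proof (cases "even i")
    case True
    then obtain m where m: "i = 2 * m" by blast
    then have "J (E i) = E (2 * m + 1)" using E(3)[of m] i by simp
    then show ?thesis using FE[of "2 * m + 1" q] i m q by simp
  next
    case False
    then obtain m where m: "i = 2 * m + 1" using oddE by blast
    then have "J (E i) = - E (2 * m)" using E(3)[of m] E(1)[of "2 * m"] i by simp
    then show ?thesis using FE[of "2 * m" q] i m q E(1)[of "2 * m"] F by (simp add: g_scale)
  qed
  show ?thesis
  proof (intro exI[of _ F] exI[of _ "W \<inter> W1"] conjI ballI allI impI)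
    show "g F F q = 1" if "q \<in> W \<inter> W1" for q
      using that h(4,5)[of q] f Z
      by (simp add: F_def g_scale f_def real_sqrt_mult[symmetric] field_simps)
    show "g F (E i) q = 0" "g (J F) (E i) q = 0" if "i < 2 * k" "q \<in> W \<inter> W1" for i q
      using FE FJE that g_J[OF F E(1)[OF that(1)]] by simp_all
  qed (use W h F in auto)
qed

lemma adapted_frame_partial:
  assumes "k \<le> n"
  shows "\<exists>E W. open W \<and> p \<in> W \<and> (\<forall>i<2*k. E i \<in> vector_fields A) \<and>
    (\<forall>i<2*k. \<forall>j<2*k. \<forall>q\<in>W. g (E i) (E j) q = (if i = j then 1 else 0)) \<and>
    (\<forall>i<k. E (2 * i + 1) = J (E (2 * i)))"
  using assms
proof (induction k)
  case 0
  then show ?case by (intro exI[of _ "\<lambda>_. 0"] exI[of _ UNIV]) auto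
next
  case (Suc k)
  then obtain E W where W: "open W" "p \<in> W" and E: "\<And>i. i < 2 * k \<Longrightarrow> E i \<in> vector_fields A"
      "\<And>i j q. i < 2 * k \<Longrightarrow> j < 2 * k \<Longrightarrow> q \<in> W \<Longrightarrow> g (E i) (E j) q = (if i = j then 1 else 0)"
      "\<And>i. i < k \<Longrightarrow> E (2 * i + 1) = J (E (2 * i))"
    by (metis Suc_leD)
  have "k < n" using Suc.prems by simp
  from adapted_frame_step[OF this W E] obtain F W' where F: "open W'" "p \<in> W'" "W' \<subseteq> W" "F \<in> vector_fields A"
    "\<And>q. q \<in> W' \<Longrightarrow> g F F q = 1"
    "\<And>i q. i < 2 * k \<Longrightarrow> q \<in> W' \<Longrightarrow> g F (E i) q = 0 \<and> g (J F) (E i) q = 0"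
    by blast
  have F': "g (E i) F q = 0" "g (E i) (J F) q = 0" if "i < 2 * k" "q \<in> W'" for i q
    using F(6)[OF that] g_commute[of "E i" F] g_commute[of "E i" "J F"] E(1)[OF that(1)] F(4) by auto
  have FJ: "g F (J F) = 0" "g (J F) F = 0" "g (J F) (J F) = g F F"
    using F(4) g_J_self[of F] g_commute[of "J F" F] g_J_J[of F F] by auto
  let ?E = "E(2 * k := F, 2 * k + 1 := J F)"
  have "(\<forall>i<2 * Suc k. ?E i \<in> vector_fields A)"
    using E(1) F(4) by (auto simp: less_Suc_eq)
  moreover have "\<forall>i<2 * Suc k. \<forall>j<2 * Suc k. \<forall>q\<in>W'. g (?E i) (?E j) q = (if i = j then 1 else 0)"
  proof (intro allI impI ballI)
    fix i j q assume ij: "i < 2 * Suc k" "j < 2 * Suc k" and q: "q \<in> W'"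
    then have "i < 2 * k \<or> i = 2 * k \<or> i = 2 * k + 1" "j < 2 * k \<or> j = 2 * k \<or> j = 2 * k + 1" by auto
    then show "g (?E i) (?E j) q = (if i = j then 1 else 0)"
      using E(2) F(3,5,6) F' FJ q by (elim disjE) (auto simp: subset_iff)
  qed
  moreover have "\<forall>i<Suc k. ?E (2 * i + 1) = J (?E (2 * i))"
    using E(3) by (auto simp: less_Suc_eq)
  ultimately show ?case using F(1,2) by blast
qed

lemma adapted_frame_exists:
  obtains E W where "p \<in> W" "adapted_frame A J g W E"
proof -
  obtain E W where EW: "open W" "p \<in> W" "\<forall>i<2*n. E i \<in> vector_fields A"
    "\<forall>i<2*n. \<forall>j<2*n. \<forall>q\<in>W. g (E i) (E j) q = (if i = j then 1 else 0)"
    "\<forall>i<n. E (2 * i + 1) = J (E (2 * i))"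
    using adapted_frame_partial[OF order_refl, of p] by blast
  then have "adapted_frame A J g W E"
    using dim_even by (auto simp: adapted_frame_def orthonormal_frame_def)
  then show ?thesis using that EW(2) by blast
qed

lemma orthonormal_frame_exists:
  obtains E W where "p \<in> W" "orthonormal_frame A g W E"
  using adapted_frame_exists by (metis adapted_frame_def)

end

text \<open>From here on functions and vector fields are calculated with as elements of a ring and of a
  module over it, so the pointwise evaluation rules must not fire by default.\<close>

lemmas fun_app = plus_fun_apply times_fun_apply minus_apply uminus_apply zero_fun_apply

declare fun_app [simp del]

context smooth_manifold
begin

lemma lie_bracket_linear:
  assumes "X \<in> vector_fields A" "Y \<in> vector_fields A" "Z \<in> vector_fields A"
  shows "lie_bracket X (Y + Z) = lie_bracket X Y + lie_bracket X Z"
    "lie_bracket X (Y - Z) = lie_bracket X Y - lie_bracket X Z"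
    "lie_bracket X (c *\<^sub>R Y) = c *\<^sub>R lie_bracket X Y"
proof -
  have eqI: "P = Q" if "P \<in> vector_fields A" "Q \<in> vector_fields A"
    "\<And>f. f \<in> smooth_fun A \<Longrightarrow> vf_deriv P f = vf_deriv Q f" for P Q
    using that(3) by (intro vf_eqI[OF that(1,2)]) (simp add: vf_deriv_def fun_eq_iff)
  show "lie_bracket X (Y + Z) = lie_bracket X Y + lie_bracket X Z"
    "lie_bracket X (Y - Z) = lie_bracket X Y - lie_bracket X Z"
    "lie_bracket X (c *\<^sub>R Y) = c *\<^sub>R lie_bracket X Y"
    by (rule eqI; use assms in \<open>simp add: lie_bracket_deriv vf_deriv_fun_add vf_deriv_fun_diff
          vf_deriv_fun_scaleR scaleR_right_diff_distrib\<close>)+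
qed

lemma lie_bracket_skew: "lie_bracket X Y = - lie_bracket Y X"
  by (simp add: lie_bracket_def fun_eq_iff fun_app)

lemma Jacobi:
  assumes "X \<in> vector_fields A" "Y \<in> vector_fields A" "Z \<in> vector_fields A"
  shows "lie_bracket X (lie_bracket Y Z) = lie_bracket (lie_bracket X Y) Z + lie_bracket Y (lie_bracket X Z)"
proof (rule vf_eqI)
  fix f p assume f: "f \<in> smooth_fun A"
  have "vf_deriv (lie_bracket X (lie_bracket Y Z)) f
      = vf_deriv (lie_bracket (lie_bracket X Y) Z + lie_bracket Y (lie_bracket X Z)) f"
    using assms f by (simp add: lie_bracket_deriv vf_deriv_fun_diff algebra_simps)
  then show "lie_bracket X (lie_bracket Y Z) p f
      = (lie_bracket (lie_bracket X Y) Z + lie_bracket Y (lie_bracket X Z)) p f"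
    by (simp add: vf_deriv_def fun_eq_iff)
qed (use assms in auto)

lemma one_formI:
  assumes "\<And>X. X \<in> vector_fields A \<Longrightarrow> \<alpha> X \<in> smooth_fun A"
    "\<And>X Y. X \<in> vector_fields A \<Longrightarrow> Y \<in> vector_fields A \<Longrightarrow> \<alpha> (X + Y) = \<alpha> X + \<alpha> Y"
    "\<And>f X. f \<in> smooth_fun A \<Longrightarrow> X \<in> vector_fields A \<Longrightarrow> \<alpha> (f \<odot> X) = f * \<alpha> X"
  shows "one_form A \<alpha>"
  using assms by (auto simp: one_form_def)

lemma bilinear_fieldI:
  assumes "\<And>X. X \<in> vector_fields A \<Longrightarrow> one_form A (B X)"
    "\<And>X. X \<in> vector_fields A \<Longrightarrow> one_form A (\<lambda>Y. B Y X)"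
  shows "bilinear_field A B"
  using assms by (auto simp: bilinear_field_def)

lemma endo_fieldI:
  assumes "\<And>X. X \<in> vector_fields A \<Longrightarrow> F X \<in> vector_fields A"
    "\<And>X Y. X \<in> vector_fields A \<Longrightarrow> Y \<in> vector_fields A \<Longrightarrow> F (X + Y) = F X + F Y"
    "\<And>f X. f \<in> smooth_fun A \<Longrightarrow> X \<in> vector_fields A \<Longrightarrow> F (f \<odot> X) = f \<odot> F X"
  shows "endo_field A F"
  using assms by (auto simp: endo_field_def)

lemma endo_fieldD:
  assumes "endo_field A F"
  shows "X \<in> vector_fields A \<Longrightarrow> F X \<in> vector_fields A"
    "X \<in> vector_fields A \<Longrightarrow> Y \<in> vector_fields A \<Longrightarrow> F (X + Y) = F X + F Y"
    "f \<in> smooth_fun A \<Longrightarrow> X \<in> vector_fields A \<Longrightarrow> F (f \<odot> X) = f \<odot> F X"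
  using assms by (auto simp: endo_field_def)

lemma one_form_compose: "one_form A \<alpha> \<Longrightarrow> endo_field A F \<Longrightarrow> one_form A (\<lambda>X. \<alpha> (F X))"
  by (rule one_formI) (simp_all add: one_formD endo_fieldD)

lemma bilinear_field_compose:
  assumes "bilinear_field A B" "endo_field A F" "endo_field A G"
  shows "bilinear_field A (\<lambda>X Y. B (F X) (G Y))"
  using assms one_form_compose[OF bilinear_fieldD(1)[OF assms(1)] assms(3)]
    one_form_compose[OF bilinear_fieldD(2)[OF assms(1)] assms(2)]
  by (intro bilinear_fieldI) (simp_all add: endo_fieldD)

lemma endo_field_id: "endo_field A (\<lambda>X. X)"
  by (rule endo_fieldI) auto

lemma one_form_times: "f \<in> smooth_fun A \<Longrightarrow> one_form A \<alpha> \<Longrightarrow> one_form A (\<lambda>X. f * \<alpha> X)"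
  by (rule one_formI) (simp_all add: one_formD algebra_simps)

lemma one_form_times': "f \<in> smooth_fun A \<Longrightarrow> one_form A \<alpha> \<Longrightarrow> one_form A (\<lambda>X. \<alpha> X * f)"
  by (rule one_formI) (simp_all add: one_formD algebra_simps)

lemma bilinear_field_tensor:
  "one_form A \<alpha> \<Longrightarrow> one_form A \<beta> \<Longrightarrow> bilinear_field A (\<lambda>X Y. \<alpha> X * \<beta> Y)"
  by (intro bilinear_fieldI one_form_times one_form_times') (auto simp: one_form_closed)

lemma one_form_plus: "one_form A \<alpha> \<Longrightarrow> one_form A \<beta> \<Longrightarrow> one_form A (\<lambda>X. \<alpha> X + \<beta> X)"
  and one_form_minus: "one_form A \<alpha> \<Longrightarrow> one_form A \<beta> \<Longrightarrow> one_form A (\<lambda>X. \<alpha> X - \<beta> X)"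
  by (rule one_formI; simp add: one_formD algebra_simps)+

lemma bilinear_field_flip: "bilinear_field A B \<Longrightarrow> bilinear_field A (\<lambda>X Y. B Y X)"
  by (auto simp: bilinear_field_def)

lemma bilinear_field_plus:
    "bilinear_field A B \<Longrightarrow> bilinear_field A C \<Longrightarrow> bilinear_field A (\<lambda>X Y. B X Y + C X Y)"
  and bilinear_field_minus:
    "bilinear_field A B \<Longrightarrow> bilinear_field A C \<Longrightarrow> bilinear_field A (\<lambda>X Y. B X Y - C X Y)"
  by (auto simp: bilinear_field_def intro: one_form_plus one_form_minus)

lemma one_form_ext_d0: "f \<in> smooth_fun A \<Longrightarrow> one_form A (\<lambda>X. vf_deriv X f)"
  by (rule one_formI) auto

end

context almost_hermitian
begin

text \<open>Metric trace. The basis is chosen separately at each point; that the result is smooth follows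
  from independence of the choice, by comparing with a local frame.\<close>

definition tr_g :: "'m form2 \<Rightarrow> 'm \<Rightarrow> real"
  where "tr_g B p = (let E = SOME E. onb_at g p E in \<Sum>i<DIM('e). B (E i) (E i) p)"

lemma onb_at_some: "onb_at g p (SOME E. onb_at g p E)"
proof -
  obtain E W where "p \<in> W" "orthonormal_frame A g W E" by (rule orthonormal_frame_exists)
  then show ?thesis using someI[of "onb_at g p"] orthonormal_frame_onb_at by blast
qed

lemma onb_at_vf: "onb_at g p E \<Longrightarrow> i < DIM('e) \<Longrightarrow> E i \<in> vector_fields A"
  and onb_at_g: "onb_at g p E \<Longrightarrow> i < DIM('e) \<Longrightarrow> j < DIM('e) \<Longrightarrow> g (E i) (E j) p = (if i = j then 1 else 0)"
  by (simp_all add: onb_at_def)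

lemma tr_g_eq:
  assumes B: "bilinear_field A B" and E: "onb_at g p E"
  shows "tr_g B p = (\<Sum>i<DIM('e). B (E i) (E i) p)"
proof -
  let ?F = "SOME E. onb_at g p E"
  have F: "onb_at g p ?F" by (rule onb_at_some)
  let ?I = "{..<DIM('e)}"
  have "tr_g B p = (\<Sum>i\<in>?I. B (?F i) (?F i) p)" by (simp add: tr_g_def Let_def)
  also have "\<dots> = (\<Sum>i\<in>?I. \<Sum>j\<in>?I. \<Sum>k\<in>?I. g (?F i) (E j) p * (g (?F i) (E k) p * B (E j) (E k) p))"
  proof (intro sum.cong refl)
    fix i assume "i \<in> ?I"
    then have i: "?F i \<in> vector_fields A" using onb_at_vf[OF F] by simp
    have "B (?F i) (?F i) p = (\<Sum>j\<in>?I. g (?F i) (E j) p * B (E j) (?F i) p)"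
      by (rule onb_expansion[OF E bilinear_fieldD(2)[OF B i] i])
    also have "\<dots> = (\<Sum>j\<in>?I. g (?F i) (E j) p * (\<Sum>k\<in>?I. g (?F i) (E k) p * B (E j) (E k) p))"
      by (intro sum.cong refl arg_cong[of _ _ "\<lambda>z. _ * z"]
          onb_expansion[OF E bilinear_fieldD(1)[OF B] i] onb_at_vf[OF E]) simp
    finally show "B (?F i) (?F i) p
        = (\<Sum>j\<in>?I. \<Sum>k\<in>?I. g (?F i) (E j) p * (g (?F i) (E k) p * B (E j) (E k) p))"
      by (simp add: sum_distrib_left)
  qed
  also have "\<dots> = (\<Sum>j\<in>?I. \<Sum>k\<in>?I. \<Sum>i\<in>?I. g (?F i) (E j) p * (g (?F i) (E k) p * B (E j) (E k) p))"
    by (subst sum.swap, intro sum.cong refl sum.swap)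
  also have "\<dots> = (\<Sum>j\<in>?I. \<Sum>k\<in>?I. (if j = k then 1 else 0) * B (E j) (E k) p)"
  proof (intro sum.cong refl)
    fix j k assume jk: "j \<in> ?I" "k \<in> ?I"
    then have vf: "E j \<in> vector_fields A" "E k \<in> vector_fields A" using onb_at_vf[OF E] by auto
    have "(if j = k then 1 else 0) = g (E j) (E k) p" using onb_at_g[OF E] jk by simp
    also have "\<dots> = (\<Sum>i\<in>?I. g (E j) (?F i) p * g (?F i) (E k) p)"
      by (rule onb_expansion[OF F g_right[OF vf(2)] vf(1)])
    also have "\<dots> = (\<Sum>i\<in>?I. g (?F i) (E j) p * g (?F i) (E k) p)"
      using g_commute[OF vf(1) onb_at_vf[OF F]] by (intro sum.cong refl) simp
    finally show "(\<Sum>i\<in>?I. g (?F i) (E j) p * (g (?F i) (E k) p * B (E j) (E k) p))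
        = (if j = k then 1 else 0) * B (E j) (E k) p"
      by (simp add: sum_distrib_right mult.assoc)
  qed
  also have "\<dots> = (\<Sum>j\<in>?I. B (E j) (E j) p)"
    by (intro sum.cong refl) (simp add: mult_delta_left)
  finally show ?thesis .
qed

lemma tr_g_smooth [intro]:
  assumes B: "bilinear_field A B" shows "tr_g B \<in> smooth_fun A"
proof (rule smooth_fun_local)
  fix p
  obtain E W where E: "p \<in> W" "orthonormal_frame A g W E" by (rule orthonormal_frame_exists)
  have vf: "E i \<in> vector_fields A" if "i < DIM('e)" for i using E(2) that by (simp add: orthonormal_frame_def)
  have "(\<Sum>i<DIM('e). B (E i) (E i)) \<in> smooth_fun A"
    using vf one_form_closed[OF bilinear_fieldD(1)[OF B]] by auto
  moreover have "\<forall>q\<in>W. tr_g B q = (\<Sum>i<DIM('e). B (E i) (E i)) q"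
    using tr_g_eq[OF B orthonormal_frame_onb_at[OF E(2)]] by (simp add: sum_fun_apply)
  moreover have "open W" using E(2) by (simp add: orthonormal_frame_def)
  ultimately show "\<exists>W h. open W \<and> p \<in> W \<and> h \<in> smooth_fun A \<and> (\<forall>q\<in>W. tr_g B q = h q)"
    using E(1) by blast
qed

lemma tr_g_add: "tr_g (\<lambda>X Y. B X Y + C X Y) = tr_g B + tr_g C"
  and tr_g_diff: "tr_g (\<lambda>X Y. B X Y - C X Y) = tr_g B - tr_g C"
  and tr_g_uminus: "tr_g (\<lambda>X Y. - B X Y) = - tr_g B"
  and tr_g_times: "tr_g (\<lambda>X Y. f * B X Y) = f * tr_g B"
  and tr_g_scaleR: "tr_g (\<lambda>X Y. c *\<^sub>R B X Y) = c *\<^sub>R tr_g B"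
  by (auto simp: fun_app tr_g_def fun_eq_iff Let_def sum.distrib sum_subtractf sum_negf sum_distrib_left scaleR_fun_def)

lemma tr_g_cong: "(\<And>X. X \<in> vector_fields A \<Longrightarrow> B X X = C X X) \<Longrightarrow> tr_g B = tr_g C"
  using onb_at_vf[OF onb_at_some] by (auto simp: tr_g_def fun_eq_iff Let_def)

lemma tr_g_J:
  assumes B: "bilinear_field A B" shows "tr_g (\<lambda>X Y. B (J X) (J Y)) = tr_g B"
proof
  fix p
  let ?F = "SOME E. onb_at g p E"
  have F: "onb_at g p ?F" by (rule onb_at_some)
  then have "onb_at g p (\<lambda>i. J (?F i))" by (simp add: onb_at_def g_J_J)
  from tr_g_eq[OF B this] tr_g_eq[OF bilinear_field_compose[OF B J_endo J_endo] F]
  show "tr_g (\<lambda>X Y. B (J X) (J Y)) p = tr_g B p" by simp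
qed

text \<open>Rotating the basis by \<open>J\<close> changes the sign of the trace of a \<open>J\<close>-anti-invariant form. The
  traces of the terms in \<open>DJ\<close> that distinguish almost-Kaehler from Kaehler geometry vanish for this reason.\<close>

lemma tr_g_J_anti:
  assumes B: "bilinear_field A B"
    and anti: "\<And>X. X \<in> vector_fields A \<Longrightarrow> B (J X) (J X) = - B X X"
  shows "tr_g B = 0"
proof -
  have "tr_g B = tr_g (\<lambda>X Y. B (J X) (J Y))" by (rule tr_g_J[OF B, symmetric])
  also have "\<dots> = tr_g (\<lambda>X Y. - B X Y)" by (rule tr_g_cong) (rule anti)
  finally have "tr_g B = tr_g (\<lambda>X Y. - B X Y)" .
  then have "tr_g B = - tr_g B" by (rule trans[OF _ tr_g_uminus])
  then show ?thesis by (simp add: fun_eq_iff fun_app)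
qed

lemma tr_g_J_right:
  assumes B: "bilinear_field A B" shows "tr_g (\<lambda>X Y. B (J X) Y) = - tr_g (\<lambda>X Y. B X (J Y))"
proof -
  have "tr_g (\<lambda>X Y. B (J X) Y) = tr_g (\<lambda>X Y. B (J (J X)) (J Y))"
    using tr_g_J[OF bilinear_field_compose[OF B J_endo endo_field_id]] by simp
  also have "\<dots> = tr_g (\<lambda>X Y. - B X (J Y))"
    by (rule tr_g_cong) (simp add: one_form_uminus[OF bilinear_fieldD(2)[OF B]])
  finally show ?thesis by (simp add: tr_g_uminus)
qed

lemma tr_g_contract:
  assumes "one_form A \<alpha>" "X \<in> vector_fields A"
  shows "tr_g (\<lambda>Y Z. g X Y * \<alpha> Z) = \<alpha> X"
proof
  fix p show "tr_g (\<lambda>Y Z. g X Y * \<alpha> Z) p = \<alpha> X p"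
    using onb_expansion[OF onb_at_some assms] by (simp add: tr_g_def Let_def fun_app)
qed

text \<open>Differentiating a trace: the rotation of a local orthonormal frame is skew and drops out.\<close>

lemma vf_deriv_tr_g:
  assumes E: "orthonormal_frame A g W E" "p \<in> W" and B: "bilinear_field A B"
    and Y: "Y \<in> vector_fields A"
    and N: "\<And>Z. Z \<in> vector_fields A \<Longrightarrow> N Z \<in> vector_fields A"
      "\<And>Z Z'. Z \<in> vector_fields A \<Longrightarrow> Z' \<in> vector_fields A \<Longrightarrow>
        vf_deriv Y (g Z Z') = g (N Z) Z' + g Z (N Z')"
  shows "vf_deriv Y (tr_g B) p
    = (\<Sum>i<DIM('e). (vf_deriv Y (B (E i) (E i)) - B (N (E i)) (E i) - B (E i) (N (E i))) p)"
proof -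
  let ?I = "{..<DIM('e)}"
  have onb: "onb_at g q E" if "q \<in> W" for q by (rule orthonormal_frame_onb_at[OF E(1) that])
  have vf: "E i \<in> vector_fields A" if "i \<in> ?I" for i using onb_at_vf[OF onb[OF E(2)]] that by simp
  have W: "open W" using E(1) by (simp add: orthonormal_frame_def)
  have sm: "B (E i) (E i) \<in> smooth_fun A" if "i \<in> ?I" for i
    using one_form_closed[OF bilinear_fieldD(1)[OF B]] vf[OF that] by simp
  have "Y p (tr_g B) = Y p (\<Sum>i\<in>?I. B (E i) (E i))"
    by (rule tangent_local[OF vf_tangent[OF Y] tr_g_smooth[OF B] _ W E(2)])
      (use sm tr_g_eq[OF B onb] in \<open>auto simp: sum_fun_apply\<close>)
  also have "\<dots> = (\<Sum>i\<in>?I. Y p (B (E i) (E i)))"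
    by (rule tangent_sum[OF vf_tangent[OF Y]]) (use sm in auto)
  finally have Y_tr: "vf_deriv Y (tr_g B) p = (\<Sum>i\<in>?I. vf_deriv Y (B (E i) (E i)) p)"
    by (simp add: vf_deriv_def)
  \<comment> \<open>The matrix of the infinitesimal rotation of the frame.\<close>
  define c where "c i j = g (N (E i)) (E j) p" for i j
  have skew: "c j i = - c i j" if "i \<in> ?I" "j \<in> ?I" for i j
  proof -
    have "Y p (g (E i) (E j)) = Y p (\<lambda>_. if i = j then 1 else 0)"
      by (rule tangent_local[OF vf_tangent[OF Y] _ _ W E(2)])
        (use vf that onb_at_g[OF onb] in auto)
    then have "vf_deriv Y (g (E i) (E j)) p = 0"
      using tangent_const[OF vf_tangent[OF Y]] by (simp add: vf_deriv_def)
    then show ?thesis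
      using N(2)[OF vf[OF that(1)] vf[OF that(2)]] g_commute[OF vf[OF that(1)] N(1)[OF vf[OF that(2)]]]
      by (simp add: c_def fun_app)
  qed
  have S: "(\<Sum>i\<in>?I. (B (N (E i)) (E i) + B (E i) (N (E i))) p)
      = (\<Sum>i\<in>?I. \<Sum>j\<in>?I. c i j * (B (E j) (E i) p + B (E i) (E j) p))" (is "_ = ?R")
  proof (intro sum.cong refl)
    fix i assume i: "i \<in> ?I"
    show "(B (N (E i)) (E i) + B (E i) (N (E i))) p
        = (\<Sum>j\<in>?I. c i j * (B (E j) (E i) p + B (E i) (E j) p))"
      using onb_expansion[OF onb[OF E(2)] bilinear_fieldD(2)[OF B vf[OF i]] N(1)[OF vf[OF i]]]
        onb_expansion[OF onb[OF E(2)] bilinear_fieldD(1)[OF B vf[OF i]] N(1)[OF vf[OF i]]]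
      by (simp add: c_def sum.distrib distrib_left fun_app)
  qed
  have "?R = (\<Sum>i\<in>?I. \<Sum>j\<in>?I. c j i * (B (E i) (E j) p + B (E j) (E i) p))"
    by (rule sum.swap)
  also have "\<dots> = (\<Sum>i\<in>?I. \<Sum>j\<in>?I. - (c i j * (B (E j) (E i) p + B (E i) (E j) p)))"
  proof (intro sum.cong refl)
    fix i j assume "i \<in> ?I" "j \<in> ?I"
    from skew[OF this] show "c j i * (B (E i) (E j) p + B (E j) (E i) p)
        = - (c i j * (B (E j) (E i) p + B (E i) (E j) p))"
      by (simp add: algebra_simps)
  qed
  also have "\<dots> = - ?R" by (simp add: sum_negf)
  finally have "(\<Sum>i\<in>?I. (B (N (E i)) (E i) + B (E i) (N (E i))) p) = 0" unfolding S by simp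
  then show ?thesis
    unfolding Y_tr by (simp add: sum_subtractf sum.distrib fun_app)
qed

subsection \<open>The musical isomorphism\<close>

text \<open>The vector field \<open>\<Sum>i. \<alpha> (E i) E i\<close>, written as a trace so that smoothness and independence of
  the frame come for free.\<close>

definition raise :: "'m form1 \<Rightarrow> 'm vfield"
  where "raise \<alpha> = (\<lambda>p f. if f \<in> smooth_fun A then tr_g (\<lambda>Y Z. \<alpha> Y * vf_deriv Z f) p else 0)"

lemma raise_closed [intro]:
  assumes \<alpha>: "one_form A \<alpha>" shows "raise \<alpha> \<in> vector_fields A"
proof (rule vector_fieldsI)
  fix f assume f: "f \<in> smooth_fun A"
  have "vf_deriv (raise \<alpha>) f = tr_g (\<lambda>Y Z. \<alpha> Y * vf_deriv Z f)"
    using f by (simp add: vf_deriv_def raise_def fun_eq_iff)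
  then show "vf_deriv (raise \<alpha>) f \<in> smooth_fun A"
    using bilinear_field_tensor[OF \<alpha> one_form_ext_d0[OF f]] by auto
next
  fix p
  let ?E = "SOME E. onb_at g p E"
  let ?I = "{..<DIM('e)}"
  have eq: "raise \<alpha> p f = (\<Sum>i\<in>?I. \<alpha> (?E i) p * ?E i p f)" if "f \<in> smooth_fun A" for f
    using that by (simp add: raise_def tr_g_def vf_deriv_def Let_def fun_app)
  have v: "?E i p \<in> tangent_space A p" if "i \<in> ?I" for i
    using vf_tangent[OF onb_at_vf[OF onb_at_some]] that by simp
  show "raise \<alpha> p \<in> tangent_space A p"
    unfolding tangent_space_def mem_Collect_eq
  proof (intro conjI ballI allI impI)
    fix f h assume fh: "f \<in> smooth_fun A" "h \<in> smooth_fun A"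
    show "raise \<alpha> p (f + h) = raise \<alpha> p f + raise \<alpha> p h"
      using fh eq tangent_add[OF v fh] by (simp add: distrib_left sum.distrib)
    show "raise \<alpha> p (f * h) = raise \<alpha> p f * h p + f p * raise \<alpha> p h"
      using fh eq tangent_mult[OF v fh]
      by (simp add: algebra_simps sum.distrib sum_distrib_left sum_distrib_right)
  next
    fix f c assume f: "f \<in> smooth_fun A"
    show "raise \<alpha> p (c *\<^sub>R f) = c * raise \<alpha> p f"
      using f eq tangent_scaleR[OF v f] by (simp add: algebra_simps sum_distrib_left)
  qed (simp add: raise_def)
qed

lemma g_raise:
  assumes \<alpha>: "one_form A \<alpha>" and Y: "Y \<in> vector_fields A" shows "g (raise \<alpha>) Y = \<alpha> Y"
proof
  fix p
  let ?E = "SOME E. onb_at g p E"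
  let ?I = "{..<DIM('e)}"
  have E: "onb_at g p ?E" by (rule onb_at_some)
  have vf: "?E i \<in> vector_fields A" if "i \<in> ?I" for i using onb_at_vf[OF E] that by simp
  define X where "X = (\<Sum>i\<in>?I. \<alpha> (?E i) p *\<^sub>R ?E i)"
  have X: "X \<in> vector_fields A" unfolding X_def using vf by (intro vf_sum vf_scaleR)
  have "raise \<alpha> p = X p"
  proof
    fix f show "raise \<alpha> p f = X p f"
    proof (cases "f \<in> smooth_fun A")
      case True
      then show ?thesis
        by (simp add: raise_def tr_g_def Let_def X_def sum_fun_apply scaleR_fun_def vf_deriv_def fun_app)
    next
      case False
      then show ?thesis using tangent_nonsmooth[OF vf_tangent[OF X]] by (simp add: raise_def)
    qed
  qed
  then have "g (raise \<alpha>) Y p = g X Y p"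
    by (rule one_form_local[OF g_right[OF Y] raise_closed[OF \<alpha>] X])
  also have "\<dots> = (\<Sum>i\<in>?I. \<alpha> (?E i) p * g (?E i) Y p)"
    using g_sum_left[of ?I "\<lambda>i. \<alpha> (?E i) p *\<^sub>R ?E i" Y] vf Y
    by (simp add: X_def g_scale sum_fun_apply) (simp add: scaleR_fun_def)
  also have "\<dots> = (\<Sum>i\<in>?I. g Y (?E i) p * \<alpha> (?E i) p)"
    using vf g_commute[OF Y] by (intro sum.cong refl) simp
  also have "\<dots> = \<alpha> Y p" by (rule onb_expansion[OF E \<alpha> Y, symmetric])
  finally show "g (raise \<alpha>) Y p = \<alpha> Y p" .
qed

lemma sharp_eq_raise:
  assumes \<alpha>: "one_form A \<alpha>" shows "sharp A g \<alpha> = raise \<alpha>"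
  unfolding sharp_def
proof (rule the_equality)
  show "raise \<alpha> \<in> vector_fields A \<and> (\<forall>Y\<in>vector_fields A. g (raise \<alpha>) Y = \<alpha> Y)"
    using \<alpha> g_raise by auto
  fix Z assume "Z \<in> vector_fields A \<and> (\<forall>Y\<in>vector_fields A. g Z Y = \<alpha> Y)"
  then show "Z = raise \<alpha>" using \<alpha> g_raise by (intro vf_eq_via_g) auto
qed

end

section \<open>The Levi-Civita connection and divergence\<close>

locale almost_hermitian_lc = almost_hermitian A g J n
  for A :: "('m::t2_space, 'e::euclidean_space) chart set" and g J n +
  fixes D :: "'m connection"
  assumes levi_civita: "levi_civita A g D"
begin

lemma D_conn: "connection A D" using levi_civita by (simp add: levi_civita_def)

lemma D_endo: "Y \<in> vector_fields A \<Longrightarrow> endo_field A (\<lambda>X. D X Y)"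
  using D_conn by (simp add: connection_def)

lemma D_closed [simp, intro]: "X \<in> vector_fields A \<Longrightarrow> Y \<in> vector_fields A \<Longrightarrow> D X Y \<in> vector_fields A"
  using endo_fieldD(1)[OF D_endo] .

lemma D_left:
  assumes "X \<in> vector_fields A" "Y \<in> vector_fields A"
  shows "Z \<in> vector_fields A \<Longrightarrow> D (X + Z) Y = D X Y + D Z Y"
    "f \<in> smooth_fun A \<Longrightarrow> D (f \<odot> X) Y = f \<odot> D X Y"
  using endo_fieldD[OF D_endo[OF assms(2)]] assms by auto

lemma D_add: "X \<in> vector_fields A \<Longrightarrow> Y \<in> vector_fields A \<Longrightarrow> Z \<in> vector_fields A \<Longrightarrow>
    D X (Y + Z) = D X Y + D X Z"
  and D_scale: "f \<in> smooth_fun A \<Longrightarrow> X \<in> vector_fields A \<Longrightarrow> Y \<in> vector_fields A \<Longrightarrow>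
    D X (f \<odot> Y) = vf_deriv X f \<odot> Y + f \<odot> D X Y"
  using D_conn by (auto simp: connection_def)

lemma D_scaleR: "X \<in> vector_fields A \<Longrightarrow> Y \<in> vector_fields A \<Longrightarrow> D X (c *\<^sub>R Y) = c *\<^sub>R D X Y"
  unfolding scaleR_eq_vf_scale
  by (subst D_scale) (auto simp: vf_deriv_def tangent_const[OF vf_tangent] vf_scale_def fun_eq_iff
      scaleR_fun_def fun_app)

lemma D_uminus: "X \<in> vector_fields A \<Longrightarrow> Y \<in> vector_fields A \<Longrightarrow> D X (- Y) = - D X Y"
  using D_scaleR[of X Y "-1"] by simp

lemma D_diff: "X \<in> vector_fields A \<Longrightarrow> Y \<in> vector_fields A \<Longrightarrow> Z \<in> vector_fields A \<Longrightarrow>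
    D X (Y - Z) = D X Y - D X Z"
  using D_add[of X Y "- Z"] D_uminus[of X Z] by simp

lemma D_torsion: "X \<in> vector_fields A \<Longrightarrow> Y \<in> vector_fields A \<Longrightarrow> lie_bracket X Y = D X Y - D Y X"
  and D_metric: "X \<in> vector_fields A \<Longrightarrow> Y \<in> vector_fields A \<Longrightarrow> Z \<in> vector_fields A \<Longrightarrow>
    vf_deriv X (g Y Z) = g (D X Y) Z + g Y (D X Z)"
  using levi_civita by (auto simp: levi_civita_def)

lemma cov_form1_bilinear:
  assumes \<alpha>: "one_form A \<alpha>" shows "bilinear_field A (\<lambda>X Y. cov_form1 D X \<alpha> Y)"
proof (intro bilinear_fieldI one_formI)
qed (auto simp: cov_form1_def one_formD[OF \<alpha>] vf_deriv_fun_add vf_deriv_fun_mult D_add D_scale D_left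
    algebra_simps)

text \<open>The divergence is minus the codifferential of the dual 1-form; it is the form in which the
  codifferential enters all computations below.\<close>

definition divergence :: "'m vfield \<Rightarrow> 'm \<Rightarrow> real"
  where "divergence X = tr_g (\<lambda>Y Z. g (D Y X) Z)"

lemma divergence_bilinear: "X \<in> vector_fields A \<Longrightarrow> bilinear_field A (\<lambda>Y Z. g (D Y X) Z)"
  by (rule bilinear_field_compose[OF g_bilinear D_endo endo_field_id])

lemma divergence_smooth [simp, intro]: "X \<in> vector_fields A \<Longrightarrow> divergence X \<in> smooth_fun A"
  unfolding divergence_def by (intro tr_g_smooth divergence_bilinear)

lemma divergence_add: "X \<in> vector_fields A \<Longrightarrow> Y \<in> vector_fields A \<Longrightarrow>
    divergence (X + Y) = divergence X + divergence Y"
  unfolding divergence_def tr_g_add[symmetric] by (rule tr_g_cong) (simp add: D_add g_linear)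

lemma divergence_scale:
  assumes "f \<in> smooth_fun A" "X \<in> vector_fields A"
  shows "divergence (f \<odot> X) = f * divergence X + vf_deriv X f"
proof -
  have "divergence (f \<odot> X) = tr_g (\<lambda>Y Z. f * g (D Y X) Z + g X Z * vf_deriv Y f)"
    unfolding divergence_def using assms
    by (intro tr_g_cong) (simp add: D_scale g_linear g_scale algebra_simps)
  also have "\<dots> = f * divergence X + tr_g (\<lambda>Y Z. g X Z * vf_deriv Y f)"
    by (simp add: tr_g_add tr_g_times divergence_def)
  also have "tr_g (\<lambda>Y Z. g X Z * vf_deriv Y f) = tr_g (\<lambda>Y Z. g X Y * vf_deriv Z f)"
    by (rule tr_g_cong) simp
  also have "\<dots> = vf_deriv X f" by (rule tr_g_contract[OF one_form_ext_d0[OF assms(1)] assms(2)])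
  finally show ?thesis .
qed

lemma divergence_uminus: "X \<in> vector_fields A \<Longrightarrow> divergence (- X) = - divergence X"
  unfolding divergence_def tr_g_uminus[symmetric] by (rule tr_g_cong) (simp add: D_uminus g_scale)

lemma divergence_diff: "X \<in> vector_fields A \<Longrightarrow> Y \<in> vector_fields A \<Longrightarrow>
    divergence (X - Y) = divergence X - divergence Y"
  using divergence_add[of X "- Y"] divergence_uminus[of Y] by simp

lemma divergence_scaleR: "X \<in> vector_fields A \<Longrightarrow> divergence (c *\<^sub>R X) = c *\<^sub>R divergence X"
  unfolding divergence_def tr_g_scaleR[symmetric] by (rule tr_g_cong) (simp add: D_scaleR g_scale(3))

lemma codiff1_eq_tr_g:
  assumes \<alpha>: "one_form A \<alpha>" shows "codiff1 A g D \<alpha> = - tr_g (\<lambda>X Y. cov_form1 D X \<alpha> Y)"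
proof
  fix p
  let ?E = "SOME E. \<exists>W. p \<in> W \<and> orthonormal_frame A g W E"
  obtain E W where "p \<in> W" "orthonormal_frame A g W E" by (rule orthonormal_frame_exists)
  then have "\<exists>W. p \<in> W \<and> orthonormal_frame A g W ?E"
    using someI[of "\<lambda>E. \<exists>W. p \<in> W \<and> orthonormal_frame A g W E" E] by blast
  then have "onb_at g p ?E" using orthonormal_frame_onb_at by blast
  from tr_g_eq[OF cov_form1_bilinear[OF \<alpha>] this]
  show "codiff1 A g D \<alpha> p = (- tr_g (\<lambda>X Y. cov_form1 D X \<alpha> Y)) p"
    by (simp add: codiff1_def Let_def fun_app)
qed

lemma codiff1_eq_divergence:
  assumes "one_form A \<alpha>" "X \<in> vector_fields A" "\<And>Y. Y \<in> vector_fields A \<Longrightarrow> \<alpha> Y = g X Y"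
  shows "codiff1 A g D \<alpha> = - divergence X"
  unfolding codiff1_eq_tr_g[OF assms(1)] divergence_def
  using assms(2,3) by (intro arg_cong[of _ _ uminus] tr_g_cong) (simp add: cov_form1_def D_metric)

definition gradient :: "('m \<Rightarrow> real) \<Rightarrow> 'm vfield"
  where "gradient f = raise (ext_d0 f)"

lemma ext_d0_one_form: "f \<in> smooth_fun A \<Longrightarrow> one_form A (ext_d0 f)"
  using one_form_ext_d0[of f] by (simp add: ext_d0_def[abs_def])

lemma gradient_closed [simp, intro]: "f \<in> smooth_fun A \<Longrightarrow> gradient f \<in> vector_fields A"
  unfolding gradient_def by (intro raise_closed ext_d0_one_form)

lemma g_gradient: "f \<in> smooth_fun A \<Longrightarrow> Y \<in> vector_fields A \<Longrightarrow> g (gradient f) Y = vf_deriv Y f"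
  unfolding gradient_def by (subst g_raise) (auto simp: ext_d0_one_form ext_d0_def)

lemma gradient_scaleR:
  assumes "f \<in> smooth_fun A" shows "gradient (c *\<^sub>R f) = c *\<^sub>R gradient f"
  by (rule vf_eq_via_g) (use assms in \<open>auto simp: g_gradient g_scale(3) vf_deriv_fun_scaleR\<close>)

lemma gradient_uminus:
  assumes "f \<in> smooth_fun A" shows "gradient (- f) = - gradient f"
  using gradient_scaleR[OF assms, of "-1"] by simp

lemma gradient_zero: "gradient 0 = 0"
  using gradient_scaleR[OF smooth_fun_zero, of 0] by (simp only: scaleR_zero_left)

lemma laplacian0_eq: "f \<in> smooth_fun A \<Longrightarrow> laplacian0 A g D f = - divergence (gradient f)"
  unfolding laplacian0_def
  by (rule codiff1_eq_divergence[OF ext_d0_one_form]) (auto simp: g_gradient ext_d0_def)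

end

section \<open>Integration in coordinates\<close>

subsection \<open>Tools on Euclidean space\<close>

lemma sum_det_replace_row_mult:
  fixes A B :: "real^'n^'n"
  shows "(\<Sum>k\<in>UNIV. det (\<chi> i. if i = k then (B ** A) $ i else A $ i)) = trace B * det A"
proof -
  have "det (\<chi> i. if i = k then (B ** A) $ i else A $ i) = B $ k $ k * det A" for k
  proof -
    have row: "(B ** A) $ i = (\<Sum>m\<in>UNIV. B $ i $ m *s A $ m)" for i
      by (simp add: matrix_matrix_mult_def vec_eq_iff)
    have "det (\<chi> i. if i = k then (B ** A) $ i else A $ i)
        = (\<Sum>m\<in>UNIV. det (\<chi> i. if i = k then B $ i $ m *s A $ m else A $ i))"
      unfolding row by (rule det_linear_row_sum) simp
    also have "\<dots> = (\<Sum>m\<in>UNIV. if m = k then B $ k $ k * det A else 0)"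
    proof (intro sum.cong refl)
      fix m
      have "det (\<chi> i. if i = k then B $ i $ m *s A $ m else A $ i)
          = det (\<chi> i. if i = k then B $ k $ m *s A $ m else A $ i)"
        by (rule arg_cong[of _ _ det]) (simp add: vec_eq_iff)
      also have "\<dots> = B $ k $ m * det (\<chi> i. if i = k then A $ m else A $ i)"
        by (rule det_row_mul)
      also have "\<dots> = (if m = k then B $ k $ k * det A else 0)"
      proof (cases "m = k")
        case True
        have "(\<chi> i. if i = k then A $ k else A $ i) = A" by (simp add: vec_eq_iff)
        then show ?thesis unfolding True by simp
      next
        case False
        have "det (\<chi> i. if i = k then A $ m else A $ i) = 0"
          by (rule det_identical_rows[OF False]) (simp add: row_def vec_eq_iff False)
        then show ?thesis using False by simp
      qed
      finally show "det (\<chi> i. if i = k then B $ i $ m *s A $ m else A $ i)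
          = (if m = k then B $ k $ k * det A else 0)" .
    qed
    finally show ?thesis by simp
  qed
  then show ?thesis by (simp add: trace_def sum_distrib_right)
qed

text \<open>The derivative of a determinant, for a Gram matrix: the two terms of the product rule have
  the same trace.\<close>

lemma sum_det_replace_row_gram:
  fixes A B :: "real^'n^'n"
  assumes "det A \<noteq> 0" "transpose A = A"
  shows "(\<Sum>k\<in>UNIV. det (\<chi> i. if i = k then (B ** A + A ** transpose B) $ i else A $ i))
    = 2 * trace B * det A"
proof -
  obtain I where inv: "A ** I = mat 1" "I ** A = mat 1"
    using assms(1) by (auto simp: invertible_det_nz[symmetric] invertible_def)
  have eq: "B ** A + A ** transpose B = (B + A ** transpose B ** I) ** A"
  proof -
    have "(P + Q) ** A = P ** A + Q ** A" for P Q :: "real^'n^'n"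
      by (simp add: matrix_matrix_mult_def vec_eq_iff sum.distrib distrib_right)
    then show ?thesis by (simp add: matrix_mul_assoc[symmetric] inv)
  qed
  have "trace (A ** transpose B ** I) = trace (I ** (A ** transpose B))"
    by (rule trace_mul_sym)
  also have "\<dots> = trace B"
    by (simp add: matrix_mul_assoc inv trace_def transpose_def)
  finally show ?thesis
    unfolding eq sum_det_replace_row_mult by (simp add: trace_add)
qed

lemma continuous_on_extend_by_zero:
  fixes h :: "'a::t2_space \<Rightarrow> real"
  assumes "open S" "continuous_on S h" "compact K" "K \<subseteq> S" "\<And>y. y \<in> S \<Longrightarrow> y \<notin> K \<Longrightarrow> h y = 0"
  shows "continuous_on UNIV (\<lambda>y. if y \<in> S then h y else 0)"
proof -
  have "continuous_on (S \<union> - K) (\<lambda>y. if y \<in> S then h y else 0)"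
    by (rule continuous_on_cases_local_open[of S "- K"])
      (use assms compact_imp_closed[OF assms(3)] in \<open>auto simp: continuous_on_const intro: open_subset\<close>)
  moreover have "S \<union> - K = UNIV" using assms(4) by auto
  ultimately show ?thesis by simp
qed

lemma integrable_compact_support:
  fixes h :: "'a::euclidean_space \<Rightarrow> real"
  assumes "continuous_on UNIV h" "compact K" "\<And>y. y \<notin> K \<Longrightarrow> h y = 0"
  shows "integrable lborel h"
proof -
  have "(\<lambda>x. indicator K x *\<^sub>R h x) = h" using assms(3) by (auto simp: fun_eq_iff indicator_def)
  then show ?thesis
    using borel_integrable_compact[OF assms(2) continuous_on_subset[OF assms(1)]] by simp
qed

text \<open>A derivative of a compactly supported function is a limit of difference quotients, whose
  integrals vanish by translation invariance.\<close>

lemma integral_directional_derivative_eq_0: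
  fixes F :: "'a::euclidean_space \<Rightarrow> real"
  assumes der: "\<And>y. (F has_derivative F' y) (at y)"
    and cont: "continuous_on UNIV (\<lambda>y. F' y v)" and K: "compact K" "\<And>y. y \<notin> K \<Longrightarrow> F y = 0"
  shows "(\<integral>y. F' y v \<partial>lborel) = 0"
proof -
  have F_cont: "continuous_on UNIV F"
    by (intro continuous_at_imp_continuous_on ballI has_derivative_continuous[OF der])
  have F_int: "integrable lborel F" by (rule integrable_compact_support[OF F_cont K])
  have F'_zero: "F' y v = 0" if "y \<notin> K" for y
  proof -
    have "((\<lambda>_. 0) has_derivative F' y) (at y)"
      by (rule has_derivative_transform_within_open[OF der, of "- K"])
        (use K that compact_imp_closed in auto)
    then have "F' y = (\<lambda>_. 0)" using has_derivative_unique has_derivative_const by blast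
    then show ?thesis by simp
  qed
  obtain M where M: "\<And>y. \<bar>F' y v\<bar> \<le> M"
  proof -
    have "bounded ((\<lambda>y. F' y v) ` K)"
      by (intro compact_imp_bounded compact_continuous_image K continuous_on_subset[OF cont]) auto
    then obtain M where "\<forall>y\<in>K. \<bar>F' y v\<bar> \<le> M" by (auto simp: bounded_iff)
    then have "\<bar>F' y v\<bar> \<le> max M 0" for y
      using F'_zero[of y] by (cases "y \<in> K") (auto simp: max.coboundedI1)
    then show ?thesis using that by blast
  qed
  have quot_bound: "\<bar>F (y + t *\<^sub>R v) - F y\<bar> \<le> M * t" if t: "t \<ge> 0" for y t
  proof (cases "t = 0")
    case False
    have d: "((\<lambda>s. F (y + s *\<^sub>R v)) has_real_derivative F' (y + s *\<^sub>R v) v) (at s)" for s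
    proof -
      have "((\<lambda>s. F (y + s *\<^sub>R v)) has_derivative (\<lambda>h. F' (y + s *\<^sub>R v) (h *\<^sub>R v))) (at s)"
        by (rule has_derivative_compose[where g = F and f = "\<lambda>s. y + s *\<^sub>R v", OF _ der])
          (auto intro!: derivative_eq_intros)
      then show ?thesis
        using linear_scale[OF has_derivative_linear[OF der]]
        by (simp add: has_field_derivative_def mult.commute[of _ "F' _ _"])
    qed
    then obtain s where "F (y + t *\<^sub>R v) - F (y + 0 *\<^sub>R v) = (t - 0) * F' (y + s *\<^sub>R v) v"
      using MVT2[of 0 t "\<lambda>s. F (y + s *\<^sub>R v)" "\<lambda>s. F' (y + s *\<^sub>R v) v"] t False by fastforce
    then show ?thesis
      using mult_left_mono[OF M[of "y + s *\<^sub>R v"] t] t by (simp add: abs_mult mult.commute)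
  qed simp
  obtain R where R: "\<And>y. y \<in> K \<Longrightarrow> norm y \<le> R"
    using compact_imp_bounded[OF K(1)] by (auto simp: bounded_iff)
  define S where "S = cball (0::'a) (R + norm v)"
  let ?t = "\<lambda>m::nat. inverse (real (Suc m))"
  let ?q = "\<lambda>m y. (F (y + ?t m *\<^sub>R v) - F y) / ?t m"
  have shift: "integrable lborel (\<lambda>y. F (y + w))" "(\<integral>y. F (y + w) \<partial>lborel) = (\<integral>y. F y \<partial>lborel)" for w
  proof -
    have c: "continuous_on UNIV (\<lambda>y. F (y + w))"
      by (rule continuous_on_compose2[OF F_cont]) (auto intro!: continuous_intros)
    have Kw: "compact ((\<lambda>y. y - w) ` K)"
      by (intro compact_continuous_image K continuous_intros)
    show "integrable lborel (\<lambda>y. F (y + w))"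
      by (rule integrable_compact_support[OF c Kw]) (use K(2) in force)
    have "(\<integral>y. F y \<partial>lborel) = (\<integral>y. F y \<partial>distr lborel borel ((+) w))"
      by (simp add: lborel_distr_plus)
    also have "\<dots> = (\<integral>y. F (w + y) \<partial>lborel)"
      by (rule integral_distr) (use borel_measurable_integrable[OF F_int] in auto)
    finally show "(\<integral>y. F (y + w) \<partial>lborel) = (\<integral>y. F y \<partial>lborel)" by (simp add: add.commute)
  qed
  have "(\<lambda>m. \<integral>y. ?q m y \<partial>lborel) \<longlonglongrightarrow> (\<integral>y. F' y v \<partial>lborel)"
  proof (rule integral_dominated_convergence[where w = "\<lambda>y. indicator S y * M"])
    show "(\<lambda>y. F' y v) \<in> borel_measurable lborel"
      using cont by (simp add: borel_measurable_continuous_onI)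
    show "?q m \<in> borel_measurable lborel" for m
      using shift(1)[of "?t m *\<^sub>R v"] F_int
      by (intro borel_measurable_divide borel_measurable_diff borel_measurable_integrable) auto
    show "integrable lborel (\<lambda>y. indicator S y * M)"
      using borel_integrable_compact[of S "\<lambda>_. M"] by (simp add: S_def)
    show "AE y in lborel. (\<lambda>m. ?q m y) \<longlonglongrightarrow> F' y v"
    proof (rule AE_I2)
      fix y :: 'a
      have "((\<lambda>s. F (y + s *\<^sub>R v)) has_derivative (\<lambda>h. F' (y + 0 *\<^sub>R v) (h *\<^sub>R v))) (at 0)"
        by (rule has_derivative_compose[where g = F and f = "\<lambda>s. y + s *\<^sub>R v", OF _ der])
          (auto intro!: derivative_eq_intros)
      then have "((\<lambda>s. F (y + s *\<^sub>R v)) has_real_derivative F' y v) (at 0)"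
        using linear_scale[OF has_derivative_linear[OF der]]
        by (simp add: has_field_derivative_def mult.commute[of _ "F' _ _"])
      then have "((\<lambda>h. (F (y + h *\<^sub>R v) - F y) / h) \<longlongrightarrow> F' y v) (at 0)"
        by (simp add: DERIV_def)
      moreover have "filterlim ?t (at 0) sequentially"
        using LIMSEQ_inverse_real_of_nat by (auto simp: filterlim_at)
      ultimately show "(\<lambda>m. ?q m y) \<longlonglongrightarrow> F' y v"
        using filterlim_compose by blast
    qed
    show "AE y in lborel. norm (?q m y) \<le> indicator S y * M" for m
    proof (rule AE_I2)
      fix y :: 'a
      have t: "0 < ?t m" "?t m \<le> 1" by (auto simp: field_simps)
      show "norm (?q m y) \<le> indicator S y * M"
      proof (cases "y \<in> S")
        case True
        have "\<bar>F (y + ?t m *\<^sub>R v) - F y\<bar> / ?t m \<le> M"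
          by (rule pos_divide_le_eq[OF t(1), THEN iffD2]) (rule quot_bound[OF less_imp_le[OF t(1)]])
        then show ?thesis using True t(1) by (simp only: real_norm_def abs_divide abs_of_pos) simp
      next
        case False
        then have big: "norm y > R + norm v" by (simp add: S_def)
        have tv: "norm (?t m *\<^sub>R v) \<le> 1 * norm v"
          unfolding norm_scaleR using t by (intro mult_right_mono) auto
        have "norm (y + ?t m *\<^sub>R v) \<ge> norm y - norm (?t m *\<^sub>R v)"
          by (metis norm_diff_ineq)
        then have "y \<notin> K" "y + ?t m *\<^sub>R v \<notin> K"
          using R[of y] R[of "y + ?t m *\<^sub>R v"] big tv norm_ge_zero[of v] by linarith+
        then show ?thesis using K(2) False by simp
      qed
    qed
  qed
  moreover have "(\<integral>y. ?q m y \<partial>lborel) = 0" for m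
    using shift[of "?t m *\<^sub>R v"] F_int by simp
  ultimately show ?thesis by (simp add: LIMSEQ_const_iff)
qed

lemma integral_compact_support_eq:
  fixes h :: "'a::euclidean_space \<Rightarrow> real"
  assumes "continuous_on UNIV h" "compact K" "\<And>y. y \<notin> K \<Longrightarrow> h y = 0"
  shows "(\<integral>y. h y \<partial>lborel) = integral K h"
proof -
  have eq: "(\<lambda>x. indicator K x *\<^sub>R h x) = h" using assms(3) by (auto simp: fun_eq_iff indicator_def)
  then have "set_integrable lborel K h"
    using integrable_compact_support[OF assms] by (simp add: set_integrable_def)
  from set_borel_integral_eq_integral(2)[OF this] show ?thesis
    unfolding set_lebesgue_integral_def eq .
qed

text \<open>The change of variables formula for vector-valued integrands, applied in one dimension.\<close>

lemma integral_change_of_variables_real: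
  fixes h :: "real^'m::{finite,wellorder} \<Rightarrow> real" and \<tau> :: "real^'m::_ \<Rightarrow> real^'m::_"
  assumes S: "compact S" and der: "\<And>y. y \<in> S \<Longrightarrow> (\<tau> has_derivative \<tau>' y) (at y)"
    and inj: "inj_on \<tau> S" and h: "continuous_on (\<tau> ` S) h"
  shows "integral (\<tau> ` S) h = integral S (\<lambda>y. \<bar>det (matrix (\<tau>' y))\<bar> * h (\<tau> y))"
proof -
  let ?f = "\<lambda>z. (\<chi> _. h z) :: real^1"
  have der': "(\<tau> has_derivative \<tau>' y) (at y within S)" if "y \<in> S" for y
    using der[OF that] has_derivative_at_withinI by blast
  have \<tau>: "continuous_on S \<tau>"
    using der' by (rule has_derivative_continuous_on)
  have "continuous_on (\<tau> ` S) ?f" using h by (intro continuous_intros)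
  then have "integrable lborel (\<lambda>x. indicator (\<tau> ` S) x *\<^sub>R ?f x)"
    by (intro borel_integrable_compact compact_continuous_image \<tau> S)
  then have f: "?f absolutely_integrable_on (\<tau> ` S)"
    unfolding set_integrable_def
    using integrable_completion[OF borel_measurable_integrable] by blast
  have S_leb: "S \<in> sets lebesgue"
    using compact_imp_closed[OF S] by (simp add: lborelD)
  have g: "(\<lambda>y. \<bar>det (matrix (\<tau>' y))\<bar> *\<^sub>R ?f (\<tau> y)) absolutely_integrable_on S"
    using absolutely_integrable_change_of_variables[OF S_leb der' inj, of ?f] f by blast
  have "integral (\<tau> ` S) ?f = integral S (\<lambda>y. \<bar>det (matrix (\<tau>' y))\<bar> *\<^sub>R ?f (\<tau> y))"
    by (rule integral_change_of_variables[OF S_leb der' inj]) (use f in auto)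
  then have "integral (\<tau> ` S) ?f $ 1 = integral S (\<lambda>y. \<bar>det (matrix (\<tau>' y))\<bar> *\<^sub>R ?f (\<tau> y)) $ 1"
    by simp
  then show ?thesis
    using integral_component_eq_cart[OF set_lebesgue_integral_eq_integral(1)[OF f], of 1]
      integral_component_eq_cart[OF set_lebesgue_integral_eq_integral(1)[OF g], of 1]
    by simp
qed

lemma continuous_integral_eq_0:
  fixes h :: "'a::euclidean_space \<Rightarrow> real"
  assumes "continuous_on UNIV h" "integrable lborel h" "\<And>y. h y \<ge> 0" "(\<integral>y. h y \<partial>lborel) = 0"
  shows "h y = 0"
proof -
  have "AE y in lborel. h y = 0"
    using assms integral_nonneg_eq_0_iff_AE[OF assms(2)] by simp
  moreover have o: "open {y. h y \<noteq> 0}"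
    by (intro open_Collect_neq assms(1) continuous_on_const)
  ultimately have "{y. h y \<noteq> 0} \<in> null_sets lborel"
    by (subst AE_iff_null_sets) auto
  then have "negligible {y. h y \<noteq> 0}"
    unfolding negligible_iff_null_sets by (rule null_sets_completionI)
  moreover note o
  ultimately show ?thesis using open_not_negligible by blast
qed

subsection \<open>The Riemannian density in a coordinate system\<close>

lemma (in smooth_manifold) tangent_prod:
  assumes v: "v \<in> tangent_space A q" and f: "\<And>i. i \<in> I \<Longrightarrow> f i \<in> smooth_fun A" and I: "finite I"
  shows "v (\<Prod>i\<in>I. f i) = (\<Sum>k\<in>I. v (f k) * (\<Prod>i\<in>I - {k}. f i q))"
  using I f
proof (induction I)
  case empty
  then show ?case using tangent_const[OF v, of 1] by (simp add: one_fun_def)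
next
  case (insert j I)
  have "v (f j * (\<Prod>i\<in>I. f i)) = v (f j) * (\<Prod>i\<in>I. f i) q + f j q * v (\<Prod>i\<in>I. f i)"
    by (rule tangent_mult[OF v]) (use insert.prems in auto)
  moreover have "(\<Prod>i\<in>insert j I. f i) = f j * (\<Prod>i\<in>I. f i)"
    by (rule prod.insert[OF insert.hyps])
  moreover have "f j q * (\<Sum>k\<in>I. v (f k) * (\<Prod>i\<in>I - {k}. f i q))
      = (\<Sum>k\<in>I. v (f k) * (\<Prod>i\<in>insert j I - {k}. f i q))"
    unfolding sum_distrib_left
  proof (intro sum.cong refl)
    fix k assume k: "k \<in> I"
    then have "insert j I - {k} = insert j (I - {k})" using insert.hyps by auto
    then show "f j q * (v (f k) * (\<Prod>i\<in>I - {k}. f i q)) = v (f k) * (\<Prod>i\<in>insert j I - {k}. f i q)"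
      using insert.hyps by simp
  qed
  moreover have "insert j I - {j} = I" using insert.hyps by auto
  ultimately show ?case
    using insert.IH insert.prems insert.hyps by (simp add: prod_fun_apply)
qed

lemma (in smooth_manifold) smooth_fun_det:
  fixes G :: "'k::finite \<Rightarrow> 'k \<Rightarrow> 'm \<Rightarrow> real"
  assumes G: "\<And>i j. G i j \<in> smooth_fun A"
  shows "(\<lambda>q. det (\<chi> i j. G i j q)) \<in> smooth_fun A"
    and "v \<in> tangent_space A q \<Longrightarrow> v (\<lambda>q. det (\<chi> i j. G i j q))
      = (\<Sum>k\<in>UNIV. det (\<chi> i j. if i = k then v (G i j) else G i j q))"
proof -
  let ?P = "{p. p permutes (UNIV :: 'k set)}"
  have eq: "(\<lambda>q. det (\<chi> i j. G i j q)) = (\<Sum>p\<in>?P. of_int (sign p) *\<^sub>R (\<Prod>i\<in>UNIV. G i (p i)))"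
    by (simp add: fun_eq_iff det_def sum_fun_apply scaleR_fun_def prod_fun_apply)
  show "(\<lambda>q. det (\<chi> i j. G i j q)) \<in> smooth_fun A"
    unfolding eq using G by (intro smooth_fun_sum smooth_fun_scaleR smooth_fun_prod)
  assume v: "v \<in> tangent_space A q"
  have "v (\<lambda>q. det (\<chi> i j. G i j q)) = (\<Sum>p\<in>?P. v (of_int (sign p) *\<^sub>R (\<Prod>i\<in>UNIV. G i (p i))))"
    unfolding eq by (rule tangent_sum[OF v]) (use G in \<open>auto intro!: smooth_fun_scaleR smooth_fun_prod\<close>)
  also have "\<dots> = (\<Sum>p\<in>?P. of_int (sign p) * (\<Sum>k\<in>UNIV. v (G k (p k)) * (\<Prod>i\<in>UNIV - {k}. G i (p i) q)))"
    using G by (intro sum.cong refl, subst tangent_scaleR[OF v])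
      (auto intro!: smooth_fun_prod simp: tangent_prod[OF v])
  also have "\<dots> = (\<Sum>k\<in>UNIV. \<Sum>p\<in>?P. of_int (sign p) * (v (G k (p k)) * (\<Prod>i\<in>UNIV - {k}. G i (p i) q)))"
    unfolding sum_distrib_left by (rule sum.swap)
  also have "\<dots> = (\<Sum>k\<in>UNIV. det (\<chi> i j. if i = k then v (G i j) else G i j q))"
  proof (intro sum.cong refl)
    fix k :: 'k
    have "(\<Prod>i\<in>UNIV. if i = k then v (G i (p i)) else G i (p i) q)
        = v (G k (p k)) * (\<Prod>i\<in>UNIV - {k}. G i (p i) q)" for p
      by (subst prod.remove[of _ k]) auto
    then show "(\<Sum>p\<in>?P. of_int (sign p) * (v (G k (p k)) * (\<Prod>i\<in>UNIV - {k}. G i (p i) q)))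
        = det (\<chi> i j. if i = k then v (G i j) else G i j q)"
      by (simp add: det_def)
  qed
  finally show "v (\<lambda>q. det (\<chi> i j. G i j q))
      = (\<Sum>k\<in>UNIV. det (\<chi> i j. if i = k then v (G i j) else G i j q))" .
qed

text \<open>Coordinates with the Riemannian density \<open>sqrt \<bar>det g\<bar>\<close>. Under the absolute value only
  \<open>det g \<noteq> 0\<close> matters, and this is the nondegeneracy of the metric.\<close>

locale riemannian_coords = almost_hermitian_lc A g J n D
  for A :: "('m::t2_space, 'e::euclidean_space) chart set" and g J n D +
  fixes N :: "'m set" and \<xi> :: "'m \<Rightarrow> real ^ 'e coord" and \<eta> and e :: "'e coord \<Rightarrow> 'm vfield" and x
  assumes coords: "coord_system N \<xi> \<eta> e x"
begin

lemma N_open: "open N" and \<xi>_open: "open (\<xi> ` N)" and hom: "homeomorphism N (\<xi> ` N) \<xi> \<eta>"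
  and e_vf [simp, intro]: "e k \<in> vector_fields A" and x_smooth [simp, intro]: "x k \<in> smooth_fun A"
  and x_eq: "q \<in> N \<Longrightarrow> x k q = \<xi> q $ k"
  and expand: "q \<in> N \<Longrightarrow> X \<in> vector_fields A \<Longrightarrow> X q f = (\<Sum>k\<in>UNIV. X q (x k) * e k q f)"
  and coord_derivative: "f \<in> smooth_fun A \<Longrightarrow> y \<in> \<xi> ` N \<Longrightarrow>
    (f \<circ> \<eta> has_derivative (\<lambda>v. \<Sum>k\<in>UNIV. v $ k * e k (\<eta> y) f)) (at y)"
  using coords by (auto simp: coord_system_def)

lemma \<eta>_\<xi>: "q \<in> N \<Longrightarrow> \<eta> (\<xi> q) = q" and \<xi>_\<eta>: "y \<in> \<xi> ` N \<Longrightarrow> \<xi> (\<eta> y) = y"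
  and \<eta>_N: "y \<in> \<xi> ` N \<Longrightarrow> \<eta> y \<in> N"
  using homeomorphism_apply1[OF hom] by auto

lemmas one_form_expand = one_form_coord_expansion[OF coords]

definition gram :: "'m \<Rightarrow> real ^ 'e coord ^ 'e coord"
  where "gram q = (\<chi> k l. g (e k) (e l) q)"

definition density :: "'m \<Rightarrow> real"
  where "density q = sqrt \<bar>det (gram q)\<bar>"

lemma det_gram_smooth: "(\<lambda>q. det (gram q)) \<in> smooth_fun A"
  unfolding gram_def by (rule smooth_fun_det) auto

lemma det_gram_nonzero:
  assumes q: "q \<in> N" shows "det (gram q) \<noteq> 0"
proof
  assume "det (gram q) = 0"
  then have "\<not> invertible (gram q)" by (simp add: invertible_det_nz)
  then obtain v where v: "gram q *v v = 0" "v \<noteq> 0"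
    using matrix_left_invertible_ker[of "gram q"] by (auto simp: invertible_left_inverse)
  define X where "X = (\<Sum>k\<in>UNIV. (v $ k) *\<^sub>R e k)"
  have X: "X \<in> vector_fields A" by (auto simp: X_def)
  have gX: "g X Y q = (\<Sum>k\<in>UNIV. v $ k * g (e k) Y q)" if "Y \<in> vector_fields A" for Y
    unfolding X_def using that
    by (simp add: g_sum_left g_scale sum_fun_apply) (simp add: scaleR_fun_def)
  have "g X (e l) q = 0" for l
  proof -
    have "g X (e l) q = (\<Sum>k\<in>UNIV. g (e l) (e k) q * v $ k)"
      using gX[of "e l"] g_commute[of "e l"] by (simp add: mult.commute)
    also have "\<dots> = (gram q *v v) $ l" by (simp add: gram_def matrix_vector_mult_def)
    finally show ?thesis using v(1) by simp
  qed
  then have "g X X q = 0" using gX[OF X] g_commute[OF X] by simp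
  then have "X q = 0" using g_eq_0_iff[OF X] by simp
  then have "v $ l = 0" for l
    using coord_field_coord[OF coords q]
    by (auto simp: X_def sum_fun_apply scaleR_fun_def fun_eq_iff fun_app mult_delta_right dest!: spec[of _ "x l"])
  then show False using v(2) by (simp add: vec_eq_iff)
qed

lemma vf_deriv_det_gram:
  assumes q: "q \<in> N" and X: "X \<in> vector_fields A"
  shows "X q (\<lambda>q. det (gram q)) = 2 * (\<Sum>k\<in>UNIV. D X (e k) q (x k)) * det (gram q)"
proof -
  define B where "B = (\<chi> k m. D X (e k) q (x m))"
  have DX: "g (D X (e k)) (e l) q = (\<Sum>m\<in>UNIV. B $ k $ m * g (e m) (e l) q)" for k l
    using one_form_expand[OF q g_right, of "e l" "D X (e k)"] X by (simp add: B_def)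
  have M: "X q (g (e k) (e l)) = (B ** gram q + gram q ** transpose B) $ k $ l" for k l
  proof -
    have "X q (g (e k) (e l)) = g (D X (e k)) (e l) q + g (D X (e l)) (e k) q"
      using fun_cong[OF D_metric[OF X, of "e k" "e l"], of q] X g_commute[of "e k" "D X (e l)"]
      by (simp add: vf_deriv_def fun_app)
    then show ?thesis
      unfolding DX using g_commute[of "e k"]
      by (simp add: gram_def matrix_matrix_mult_def transpose_def mult.commute)
  qed
  have "X q (\<lambda>q. det (gram q))
      = (\<Sum>k\<in>UNIV. det (\<chi> i j. if i = k then X q (g (e i) (e j)) else g (e i) (e j) q))"
    unfolding gram_def by (rule smooth_fun_det(2)[OF _ vf_tangent[OF X]]) auto
  also have "\<dots> = (\<Sum>k\<in>UNIV. det (\<chi> i. if i = k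
      then (B ** gram q + gram q ** transpose B) $ i else gram q $ i))"
    by (intro sum.cong refl arg_cong[of _ _ det]) (simp add: vec_eq_iff M, simp add: gram_def)
  also have "\<dots> = 2 * trace B * det (gram q)"
    by (rule sum_det_replace_row_gram[OF det_gram_nonzero[OF q]])
      (simp add: gram_def transpose_def vec_eq_iff g_commute)
  finally show ?thesis by (simp add: B_def trace_def)
qed

lemma lie_bracket_coord:
  assumes q: "q \<in> N" shows "lie_bracket (e k) (e l) q = 0"
proof
  fix f
  have zero: "e k q (vf_deriv (e l) (x m)) = 0" for k l m
  proof -
    have "e k q (vf_deriv (e l) (x m)) = e k q (\<lambda>_. if l = m then 1 else 0)"
      by (rule tangent_local[OF vf_tangent[OF e_vf] vf_deriv_smooth[OF e_vf x_smooth]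
            smooth_fun_const N_open q]) (simp add: vf_deriv_def coord_field_coord[OF coords])
    then show ?thesis using tangent_const[OF vf_tangent[OF e_vf]] by simp
  qed
  have "lie_bracket (e k) (e l) q f = (\<Sum>m\<in>UNIV. lie_bracket (e k) (e l) q (x m) * e m q f)"
    by (rule expand[OF q]) auto
  then show "lie_bracket (e k) (e l) q f = 0 f"
    by (simp add: lie_bracket_def zero fun_app)
qed

text \<open>The divergence is the trace of \<open>DW\<close> in the coordinate basis. Coordinate fields commute and \<open>D\<close> is
  torsion-free, so the contracted Christoffel symbols are half the logarithmic derivative of \<open>det g\<close>.\<close>

lemma divergence_coord:
  assumes q: "q \<in> N" and W: "W \<in> vector_fields A"
  shows "divergence W q = (\<Sum>k\<in>UNIV. e k q (vf_deriv W (x k))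
    + W q (x k) * (e k q (\<lambda>q. det (gram q)) / (2 * det (gram q))))"
proof -
  let ?E = "SOME E. onb_at g q E"
  let ?I = "{..<DIM('e)}"
  have E: "onb_at g q ?E" by (rule onb_at_some)
  have vf: "?E i \<in> vector_fields A" if "i \<in> ?I" for i using onb_at_vf[OF E] that by simp
  have "divergence W q = (\<Sum>i\<in>?I. g (D (?E i) W) (?E i) q)"
    by (simp add: divergence_def tr_g_def Let_def)
  also have "\<dots> = (\<Sum>i\<in>?I. \<Sum>k\<in>UNIV. ?E i q (x k) * g (D (e k) W) (?E i) q)"
  proof (intro sum.cong refl)
    fix i assume i: "i \<in> ?I"
    show "g (D (?E i) W) (?E i) q = (\<Sum>k\<in>UNIV. ?E i q (x k) * g (D (e k) W) (?E i) q)"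
      by (rule one_form_expand[OF q one_form_compose[OF g_right[OF vf[OF i]] D_endo[OF W]] vf[OF i]])
  qed
  also have "\<dots> = (\<Sum>k\<in>UNIV. \<Sum>i\<in>?I. g (D (e k) W) (?E i) q * ?E i q (x k))"
    by (subst sum.swap) (simp add: mult.commute)
  also have "\<dots> = (\<Sum>k\<in>UNIV. D (e k) W q (x k))"
  proof (intro sum.cong refl)
    fix k
    show "(\<Sum>i\<in>?I. g (D (e k) W) (?E i) q * ?E i q (x k)) = D (e k) W q (x k)"
      using onb_expansion[OF E one_form_ext_d0[OF x_smooth] D_closed[OF e_vf W], of k k]
      by (simp add: vf_deriv_def)
  qed
  finally have div: "divergence W q = (\<Sum>k\<in>UNIV. D (e k) W q (x k))" .
  obtain \<theta> M K where \<theta>: "\<theta> \<in> smooth_fun A" "open M" "q \<in> M" "M \<subseteq> N" "\<And>q. q \<in> M \<Longrightarrow> \<theta> q = 1"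
    "closed K" "K \<subseteq> N" "\<And>q. q \<notin> K \<Longrightarrow> \<theta> q = 0" "\<And>q. 0 \<le> \<theta> q"
    using bump_exists[OF N_open q] by metis
  let ?w = "\<lambda>l. \<theta> * vf_deriv W (x l)"
  have \<theta>W: "\<theta> \<odot> W = (\<Sum>l\<in>UNIV. ?w l \<odot> e l)"
  proof (intro ext)
    fix p f
    show "(\<theta> \<odot> W) p f = (\<Sum>l\<in>UNIV. ?w l \<odot> e l) p f"
    proof (cases "p \<in> N")
      case True
      then show ?thesis using expand[OF True W, of f]
        by (simp add: vf_scale_def scaleR_fun_def sum_fun_apply vf_deriv_def sum_distrib_left mult_ac fun_app)
    next
      case False
      then have "\<theta> p = 0" using \<theta> by blast
      then show ?thesis by (simp add: vf_scale_def scaleR_fun_def sum_fun_apply fun_app)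
    qed
  qed
  have D_sum: "D X (\<Sum>l\<in>I. Y l) = (\<Sum>l\<in>I. D X (Y l))"
    if "X \<in> vector_fields A" "finite I" "\<And>l. Y l \<in> vector_fields A" for X Y and I :: "'e coord set"
    using that(2)
  proof induction
    case empty
    have "D X 0 = 0" using D_scaleR[OF that(1) vf_zero, of 0] by (simp only: scaleR_zero_left)
    then show ?case by (simp only: sum.empty)
  next
    case (insert l I)
    then show ?case using that by (simp add: D_add vf_sum)
  qed
  have comp: "D (e k) W q (x k) = e k q (vf_deriv W (x k)) + (\<Sum>l\<in>UNIV. W q (x l) * D (e k) (e l) q (x k))" for k
  proof -
    have loc: "e k q (\<theta> * h) = e k q h" if "h \<in> smooth_fun A" for h
      by (rule tangent_local[OF vf_tangent[OF e_vf] _ that \<theta>(2,3)]) (use \<theta> that in \<open>auto simp: fun_app\<close>)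
    have "e k q \<theta> = 0"
      using loc[of 1] tangent_const[OF vf_tangent[OF e_vf], where c = 1] by (simp add: one_fun_def times_fun_def)
    then have "D (e k) (\<theta> \<odot> W) q (x k) = D (e k) W q (x k)"
      using W \<theta>(1,3,5) by (simp add: D_scale fun_app) (simp add: vf_scale_def scaleR_fun_def vf_deriv_def)
    moreover have "D (e k) (\<theta> \<odot> W) q (x k)
        = (\<Sum>l\<in>UNIV. e k q (vf_deriv W (x l)) * e l q (x k) + W q (x l) * D (e k) (e l) q (x k))"
    proof -
      have "D (e k) (\<theta> \<odot> W) = (\<Sum>l\<in>UNIV. vf_deriv (e k) (?w l) \<odot> e l + ?w l \<odot> D (e k) (e l))"
        unfolding \<theta>W using \<theta>(1) W by (subst D_sum) (auto simp: D_scale)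
      then show ?thesis
        using loc[of "vf_deriv W (x _)"] W \<theta>(3,5)
        by (simp add: sum_fun_apply fun_app, simp add: vf_scale_def scaleR_fun_def vf_deriv_def,
            simp add: fun_app)
    qed
    ultimately show ?thesis
      by (simp add: sum.distrib coord_field_coord[OF coords q] mult_delta_right)
  qed
  have "(\<Sum>k\<in>UNIV. \<Sum>l\<in>UNIV. W q (x l) * D (e k) (e l) q (x k))
      = (\<Sum>l\<in>UNIV. W q (x l) * (\<Sum>k\<in>UNIV. D (e l) (e k) q (x k)))"
  proof -
    have "D (e k) (e l) q = D (e l) (e k) q" for k l
      using fun_cong[OF D_torsion[OF e_vf e_vf, of k l], of q] lie_bracket_coord[OF q, of k l]
      by (simp add: fun_app)
    then show ?thesis by (subst sum.swap) (simp add: sum_distrib_left)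
  qed
  also have "\<dots> = (\<Sum>l\<in>UNIV. W q (x l) * (e l q (\<lambda>q. det (gram q)) / (2 * det (gram q))))"
    using det_gram_nonzero[OF q] vf_deriv_det_gram[OF q e_vf] by simp
  finally show ?thesis
    unfolding div comp by (simp add: sum.distrib)
qed

end

subsection \<open>Integrals over a coordinate system\<close>

lemma has_real_derivative_sqrt_abs:
  assumes "t \<noteq> 0"
  shows "((\<lambda>t. sqrt \<bar>t\<bar>) has_real_derivative sqrt \<bar>t\<bar> / (2 * t)) (at t)"
proof (cases "t > 0")
  case True
  have "((\<lambda>t. sqrt t) has_real_derivative sqrt t / (2 * t)) (at t)"
    using True by (auto intro!: derivative_eq_intros simp: field_simps)
  then have "((\<lambda>t. sqrt \<bar>t\<bar>) has_real_derivative sqrt t / (2 * t)) (at t)"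
    by (rule has_field_derivative_transform_within_open[of _ _ _ "{0<..}"]) (use True in auto)
  then show ?thesis using True by simp
next
  case False
  then have t: "t < 0" using assms by simp
  have "((\<lambda>t. sqrt (- t)) has_real_derivative sqrt (- t) / (2 * t)) (at t)"
    using t by (auto intro!: derivative_eq_intros simp: field_simps)
  then have "((\<lambda>t. sqrt \<bar>t\<bar>) has_real_derivative sqrt (- t) / (2 * t)) (at t)"
    by (rule has_field_derivative_transform_within_open[of _ _ _ "{..<0}"]) (use t in auto)
  then show ?thesis using t by simp
qed

context riemannian_coords
begin

definition lift :: "('m \<Rightarrow> real) \<Rightarrow> real ^ 'e coord \<Rightarrow> real"
  where "lift h y = (if y \<in> \<xi> ` N then h (\<eta> y) else 0)"

definition coord_integral :: "('m \<Rightarrow> real) \<Rightarrow> real"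
  where "coord_integral F = (\<integral>y. lift (\<lambda>q. F q * density q) y \<partial>lborel)"

lemma density_continuous: "continuous_on UNIV density"
  unfolding density_def[abs_def]
  by (intro continuous_on_real_sqrt continuous_on_rabs smooth_fun_continuous det_gram_smooth)

lemma density_pos: "q \<in> N \<Longrightarrow> density q > 0"
  using det_gram_nonzero by (simp add: density_def)

context
  fixes K assumes K: "compact K" "K \<subseteq> N"
begin

lemma compact_\<xi>_K: "compact (\<xi> ` K)"
  using continuous_on_subset[OF homeomorphism_cont1[OF hom] K(2)] K(1) by (rule compact_continuous_image)

lemma lift_continuous:
  assumes "continuous_on N h" "\<And>q. q \<in> N \<Longrightarrow> q \<notin> K \<Longrightarrow> h q = 0"
  shows "continuous_on UNIV (lift h)" "\<And>y. y \<notin> \<xi> ` K \<Longrightarrow> lift h y = 0"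
proof -
  have "continuous_on (\<xi> ` N) (\<lambda>y. h (\<eta> y))"
    by (rule continuous_on_compose2[OF assms(1) homeomorphism_cont2[OF hom]]) (use \<eta>_N in auto)
  moreover have zero: "h (\<eta> y) = 0" if y: "y \<in> \<xi> ` N" "y \<notin> \<xi> ` K" for y
  proof -
    obtain q where "q \<in> N" "y = \<xi> q" using y(1) by blast
    moreover from this have "q \<notin> K" using y(2) by blast
    ultimately show ?thesis using assms(2) \<eta>_\<xi> by simp
  qed
  ultimately show "continuous_on UNIV (lift h)"
    unfolding lift_def[abs_def]
    by (intro continuous_on_extend_by_zero[OF \<xi>_open _ compact_\<xi>_K]) (use K in auto)
  show "\<And>y. y \<notin> \<xi> ` K \<Longrightarrow> lift h y = 0" using zero by (simp add: lift_def)
qed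

lemma lift_integrable:
  assumes "continuous_on N h" "\<And>q. q \<in> N \<Longrightarrow> q \<notin> K \<Longrightarrow> h q = 0"
  shows "integrable lborel (lift h)"
  by (rule integrable_compact_support[OF lift_continuous(1)[OF assms] compact_\<xi>_K lift_continuous(2)[OF assms]])

text \<open>In coordinates \<open>sqrt \<bar>det g\<bar> div W\<close> is the sum of the partial derivatives of the compactly supported
  functions \<open>sqrt \<bar>det g\<bar> W\<^sup>k\<close>.\<close>

lemma coord_integral_divergence:
  assumes W: "W \<in> vector_fields A" "\<And>q. q \<notin> K \<Longrightarrow> W q = 0"
  shows "coord_integral (divergence W) = 0"
proof -
  define \<delta> where "\<delta> q = det (gram q)" for q
  have \<delta>: "\<delta> \<in> smooth_fun A" using det_gram_smooth by (simp add: \<delta>_def[abs_def])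
  have \<delta>_nz: "\<delta> q \<noteq> 0" if "q \<in> N" for q using det_gram_nonzero[OF that] by (simp add: \<delta>_def)
  define w where "w k = vf_deriv W (x k)" for k
  have w: "w k \<in> smooth_fun A" for k using W by (simp add: w_def)
  have K_closed: "closed K" using compact_imp_closed[OF K(1)] .
  have w_zero1: "w k q = 0" if "q \<notin> K" for k q
    using W(2)[OF that] by (simp add: w_def vf_deriv_def fun_app)
  have w_zero2: "e l q (w k) = 0" if "q \<notin> K" for k l q
  proof -
    have "e l q (w k) = e l q (\<lambda>_. 0)"
      by (rule tangent_local[OF vf_tangent[OF e_vf] w smooth_fun_const, of "- K"])
        (use that w_zero1 K_closed in auto)
    then show ?thesis using tangent_const[OF vf_tangent[OF e_vf]] by simp
  qed
  note w_zero = w_zero1 w_zero2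
  have w_lift: "lift (\<lambda>q. w k q * density q) y = 0" if "y \<notin> \<xi> ` K" for k y
    using that w_zero1 \<eta>_\<xi> unfolding lift_def by (metis image_iff mult_zero_left)
  define P where "P k l q = (e l q (w k) + w k q * (e l q \<delta> / (2 * \<delta> q))) * density q" for k l q
  have P_cont: "continuous_on N (P k l)" for k l
  proof -
    have c: "continuous_on N (\<lambda>q. e l q f)" if "f \<in> smooth_fun A" for f
      using smooth_fun_continuous[OF vf_deriv_smooth[OF e_vf that, of l]] continuous_on_subset
      by (auto simp: vf_deriv_def)
    have "continuous_on N (w k)" "continuous_on N \<delta>"
      using smooth_fun_continuous w \<delta> continuous_on_subset by blast+
    then show ?thesis
      unfolding P_def[abs_def]
      by (intro continuous_on_mult continuous_on_add continuous_on_divide continuous_on_const c w \<delta>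
          continuous_on_subset[OF density_continuous]) (use \<delta>_nz in auto)
  qed
  have P_zero: "P k l q = 0" if "q \<notin> K" for k l q using w_zero[OF that] by (simp add: P_def)
  have der: "(lift (\<lambda>q. w k q * density q) has_derivative
      (\<lambda>v. \<Sum>l\<in>UNIV. v $ l * lift (P k l) y)) (at y)" for k y
  proof (cases "y \<in> \<xi> ` N")
    case True
    have dw: "((\<lambda>y. w k (\<eta> y)) has_derivative (\<lambda>v. \<Sum>l\<in>UNIV. v $ l * e l (\<eta> y) (w k))) (at y)"
      using coord_derivative[OF w True] by (simp add: o_def)
    have d\<delta>: "((\<lambda>y. \<delta> (\<eta> y)) has_derivative (\<lambda>v. \<Sum>l\<in>UNIV. v $ l * e l (\<eta> y) \<delta>)) (at y)"
      using coord_derivative[OF \<delta> True] by (simp add: o_def)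
    have "((\<lambda>t. sqrt \<bar>t\<bar>) has_derivative (\<lambda>h. sqrt \<bar>\<delta> (\<eta> y)\<bar> / (2 * \<delta> (\<eta> y)) * h)) (at (\<delta> (\<eta> y)))"
      using has_real_derivative_sqrt_abs[OF \<delta>_nz[OF \<eta>_N[OF True]]]
      by (simp only: has_field_derivative_def)
    from has_derivative_compose[OF d\<delta> this]
    have d\<rho>: "((\<lambda>y. density (\<eta> y)) has_derivative
        (\<lambda>v. density (\<eta> y) / (2 * \<delta> (\<eta> y)) * (\<Sum>l\<in>UNIV. v $ l * e l (\<eta> y) \<delta>))) (at y)"
      by (simp add: density_def \<delta>_def)
    have "((\<lambda>y. w k (\<eta> y) * density (\<eta> y)) has_derivative (\<lambda>v. \<Sum>l\<in>UNIV. v $ l * lift (P k l) y)) (at y)"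
      by (rule has_derivative_eq_rhs[OF has_derivative_mult[OF dw d\<rho>]])
        (use True in \<open>simp add: lift_def P_def fun_eq_iff sum_distrib_left sum_distrib_right
          sum_divide_distrib sum.distrib[symmetric] algebra_simps\<close>)
    then show ?thesis
      by (rule has_derivative_transform_within_open[OF _ \<xi>_open True]) (simp add: lift_def)
  next
    case False
    then have y: "y \<in> - (\<xi> ` K)" using K(2) by auto
    have "((\<lambda>_. 0) has_derivative (\<lambda>v. \<Sum>l\<in>UNIV. v $ l * lift (P k l) y)) (at y)"
      using False by (simp add: lift_def)
    then show ?thesis
      by (rule has_derivative_transform_within_open[OF _ _ y])
        (use compact_imp_closed[OF compact_\<xi>_K] w_lift in auto)
  qed
  have axis: "(\<Sum>l\<in>UNIV. axis k 1 $ l * lift (P k l) y) = lift (P k k) y" for k y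
    by (simp add: axis_def if_distrib[of "\<lambda>z. z * _"] sum.delta cong: if_cong)
  have zero: "(\<integral>y. lift (P k k) y \<partial>lborel) = 0" for k
  proof -
    have c: "continuous_on UNIV (\<lambda>y. \<Sum>l\<in>UNIV. axis k 1 $ l * lift (P k l) y)"
      unfolding axis using lift_continuous(1)[OF P_cont P_zero] by (simp add: eta_contract_eq)
    have "(\<integral>y. (\<Sum>l\<in>UNIV. axis k 1 $ l * lift (P k l) y) \<partial>lborel) = 0"
      by (rule integral_directional_derivative_eq_0[OF der c compact_\<xi>_K])
        (rule w_lift)
    then show ?thesis by (simp only: axis)
  qed
  have eq: "lift (\<lambda>q. divergence W q * density q) = (\<lambda>y. \<Sum>k\<in>UNIV. lift (P k k) y)"
    using divergence_coord[OF \<eta>_N W(1)]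
    by (simp add: fun_eq_iff lift_def P_def w_def \<delta>_def[abs_def] vf_deriv_def sum_distrib_right)
  have "coord_integral (divergence W) = (\<Sum>k\<in>UNIV. \<integral>y. lift (P k k) y \<partial>lborel)"
    unfolding coord_integral_def eq
    by (simp add: Bochner_Integration.integral_sum[OF lift_integrable[OF P_cont P_zero]])
  then show ?thesis by (simp add: zero)
qed

end

lemma coord_integral_eq_integral:
  assumes K: "compact K" "K \<subseteq> N" and F: "F \<in> smooth_fun A" "\<And>q. q \<notin> K \<Longrightarrow> F q = 0"
  shows "coord_integral F = integral (\<xi> ` K) (\<lambda>y. F (\<eta> y) * density (\<eta> y))"
    and "integrable lborel (lift (\<lambda>q. F q * density q))"
proof -
  let ?h = "\<lambda>q. F q * density q"
  have cont: "continuous_on N ?h"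
    by (intro continuous_on_mult continuous_on_subset[OF smooth_fun_continuous[OF F(1)]]
        continuous_on_subset[OF density_continuous]) auto
  have zero: "?h q = 0" if "q \<notin> K" for q using F(2)[OF that] by simp
  note l = lift_continuous[OF K cont zero]
  have "coord_integral F = integral (\<xi> ` K) (lift ?h)"
    unfolding coord_integral_def by (rule integral_compact_support_eq[OF l(1) compact_\<xi>_K[OF K] l(2)])
  also have "\<dots> = integral (\<xi> ` K) (\<lambda>y. F (\<eta> y) * density (\<eta> y))"
    by (rule integral_cong) (use K(2) in \<open>auto simp: lift_def\<close>)
  finally show "coord_integral F = integral (\<xi> ` K) (\<lambda>y. F (\<eta> y) * density (\<eta> y))" .
  show "integrable lborel (lift ?h)" by (rule lift_integrable[OF K cont zero])
qed

lemma coord_integral_sum: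
  assumes K: "compact K" "K \<subseteq> N" and I: "finite I"
    and F: "\<And>i. i \<in> I \<Longrightarrow> F i \<in> smooth_fun A" "\<And>i q. i \<in> I \<Longrightarrow> q \<notin> K \<Longrightarrow> F i q = 0"
  shows "coord_integral (\<Sum>i\<in>I. F i) = (\<Sum>i\<in>I. coord_integral (F i))"
proof -
  have eq: "lift (\<lambda>q. (\<Sum>i\<in>I. F i) q * density q) = (\<lambda>y. \<Sum>i\<in>I. lift (\<lambda>q. F i q * density q) y)"
    by (simp add: fun_eq_iff lift_def sum_fun_apply sum_distrib_right)
  show ?thesis
    unfolding coord_integral_def eq
    by (simp add: Bochner_Integration.integral_sum[OF coord_integral_eq_integral(2)[OF K F]])
qed

lemma coord_integral_nonneg:
  assumes "\<And>q. F q \<ge> 0" shows "coord_integral F \<ge> 0"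
  unfolding coord_integral_def
  by (rule integral_nonneg_AE) (simp add: lift_def assms density_def)

lemma coord_integral_eq_0:
  assumes K: "compact K" "K \<subseteq> N" and F: "F \<in> smooth_fun A" "\<And>q. q \<notin> K \<Longrightarrow> F q = 0"
    and nonneg: "\<And>q. F q \<ge> 0" and zero: "coord_integral F = 0"
  shows "F q = 0"
proof (cases "q \<in> K")
  case True
  then have q: "q \<in> N" using K by blast
  let ?h = "\<lambda>q. F q * density q"
  have cont: "continuous_on N ?h"
    by (intro continuous_on_mult continuous_on_subset[OF smooth_fun_continuous[OF F(1)]]
        continuous_on_subset[OF density_continuous]) auto
  have "lift ?h (\<xi> q) = 0"
    by (rule continuous_integral_eq_0[OF lift_continuous(1)[OF K cont] coord_integral_eq_integral(2)[OF K F]])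
      (use F nonneg zero in \<open>auto simp: lift_def density_def coord_integral_def\<close>)
  then show ?thesis using q density_pos[OF q] \<eta>_\<xi>[OF q] by (auto simp: lift_def)
qed (use F in auto)

end

context almost_hermitian_lc
begin

text \<open>If \<open>T\<close> is the Jacobian matrix of the transition map, the Gram matrices are related by
  \<open>G\<^sub>1 = T\<^sup>t G\<^sub>2 T\<close>, so the densities differ by the factor \<open>\<bar>det T\<bar>\<close> of the change of variables.\<close>

lemma coord_integral_change:
  assumes "riemannian_coords A g J n D N1 \<xi>1 \<eta>1 e1 x1" "riemannian_coords A g J n D N2 \<xi>2 \<eta>2 e2 x2"
    and K: "compact K" "K \<subseteq> N1" "K \<subseteq> N2" and F: "F \<in> smooth_fun A" "\<And>q. q \<notin> K \<Longrightarrow> F q = 0"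
  shows "riemannian_coords.coord_integral g N1 \<xi>1 \<eta>1 e1 F
    = riemannian_coords.coord_integral g N2 \<xi>2 \<eta>2 e2 F"
proof -
  interpret a: riemannian_coords A g J n D N1 \<xi>1 \<eta>1 e1 x1 by fact
  interpret b: riemannian_coords A g J n D N2 \<xi>2 \<eta>2 e2 x2 by fact
  define T where "T q = (\<chi> l k. e1 k q (x2 l))" for q
  have density: "a.density q = \<bar>det (T q)\<bar> * b.density q" if q: "q \<in> N2" for q
  proof -
    have "a.gram q = transpose (T q) ** b.gram q ** T q"
    proof -
      have "g (e1 k) (e1 k') q = (\<Sum>l'\<in>UNIV. (\<Sum>l\<in>UNIV. e1 k q (x2 l) * g (e2 l) (e2 l') q) * e1 k' q (x2 l'))"
        for k k'
      proof -
        have "g (e1 k) (e1 k') q = (\<Sum>l'\<in>UNIV. e1 k' q (x2 l') * g (e1 k) (e2 l') q)"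
          by (rule b.one_form_expand[OF q g_left]) auto
        also have "\<dots> = (\<Sum>l'\<in>UNIV. e1 k' q (x2 l') * (\<Sum>l\<in>UNIV. e1 k q (x2 l) * g (e2 l) (e2 l') q))"
          by (intro sum.cong refl arg_cong[of _ _ "\<lambda>z. _ * z"] b.one_form_expand[OF q g_right]) auto
        finally show ?thesis by (simp add: mult.commute)
      qed
      then show ?thesis
        by (simp add: a.gram_def b.gram_def T_def matrix_matrix_mult_def transpose_def)
    qed
    then show ?thesis
      by (simp add: a.density_def b.density_def det_mul det_transpose abs_mult real_sqrt_mult)
  qed
  define \<tau> where "\<tau> y = (\<chi> l. x2 l (\<eta>1 y))" for y
  define \<tau>' where "\<tau>' y v = (\<chi> l. \<Sum>k\<in>UNIV. v $ k * e1 k (\<eta>1 y) (x2 l))" for y and v :: "real ^ 'e coord"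
  let ?S = "\<xi>1 ` K"
  have S: "y \<in> \<xi>1 ` N1 \<and> \<eta>1 y \<in> K \<and> \<tau> y = \<xi>2 (\<eta>1 y)" if "y \<in> ?S" for y
    using that K a.\<eta>_\<xi> b.x_eq by (auto simp: \<tau>_def vec_eq_iff subset_iff)
  have \<tau>_S: "\<tau> ` ?S = \<xi>2 ` K"
    using S a.\<eta>_\<xi> K(2) by (force simp: image_iff)
  have der: "(\<tau> has_derivative \<tau>' y) (at y)" if "y \<in> ?S" for y
    unfolding \<tau>_def[abs_def] \<tau>'_def[abs_def]
    by (subst has_derivative_componentwise_within)
      (use a.coord_derivative[OF b.x_smooth] S[OF that] in \<open>auto simp: o_def Basis_vec_def inner_axis\<close>)
  have inj: "inj_on \<tau> ?S"
  proof (rule inj_onI)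
    fix y z assume yz: "y \<in> ?S" "z \<in> ?S" "\<tau> y = \<tau> z"
    then have "\<eta>1 y = \<eta>1 z"
      using S b.\<eta>_\<xi> K(3) by (metis subset_iff)
    then show "y = z" using yz S a.\<xi>_\<eta> by metis
  qed
  have h: "continuous_on (\<tau> ` ?S) (\<lambda>z. F (\<eta>2 z) * b.density (\<eta>2 z))"
  proof -
    have c: "continuous_on (\<xi>2 ` K) \<eta>2"
      using continuous_on_subset[OF homeomorphism_cont2[OF b.hom]] K(3) by blast
    show ?thesis
      unfolding \<tau>_S
      by (intro continuous_on_mult continuous_on_compose2[OF smooth_fun_continuous[OF F(1)] c]
          continuous_on_compose2[OF b.density_continuous c]) auto
  qed
  have "b.coord_integral F = integral (\<tau> ` ?S) (\<lambda>z. F (\<eta>2 z) * b.density (\<eta>2 z))"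
    unfolding \<tau>_S by (rule b.coord_integral_eq_integral[OF K(1,3) F])
  also have "\<dots> = integral ?S (\<lambda>y. \<bar>det (matrix (\<tau>' y))\<bar> * (F (\<eta>2 (\<tau> y)) * b.density (\<eta>2 (\<tau> y))))"
    by (rule integral_change_of_variables_real[OF a.compact_\<xi>_K[OF K(1,2)] der inj h])
  also have "\<dots> = integral ?S (\<lambda>y. F (\<eta>1 y) * a.density (\<eta>1 y))"
  proof (rule integral_cong)
    fix y assume y: "y \<in> ?S"
    have "matrix (\<tau>' y) = T (\<eta>1 y)"
      by (simp add: matrix_def \<tau>'_def T_def vec_eq_iff axis_def if_distrib[of "\<lambda>z. z * _"] sum.delta cong: if_cong)
    moreover have "\<eta>2 (\<tau> y) = \<eta>1 y" using S[OF y] b.\<eta>_\<xi> K(3) by auto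
    moreover have "\<eta>1 y \<in> N2" using S[OF y] K(3) by auto
    ultimately show "\<bar>det (matrix (\<tau>' y))\<bar> * (F (\<eta>2 (\<tau> y)) * b.density (\<eta>2 (\<tau> y)))
        = F (\<eta>1 y) * a.density (\<eta>1 y)"
      using density by simp
  qed
  also have "\<dots> = a.coord_integral F"
    by (rule a.coord_integral_eq_integral(1)[OF K(1,2) F, symmetric])
  finally show ?thesis by simp
qed

text \<open>The divergence theorem on a compact manifold, in the form in which it is used. A partition of
  unity reduces it to vector fields supported in one coordinate system, and the change of variables
  formula makes the coordinate integrals compatible.\<close>

theorem divergence_nonneg_imp_eq_0:
  assumes compact: "compact (UNIV :: 'm set)"
    and X: "X \<in> vector_fields A" and nonneg: "\<And>q. divergence X q \<ge> 0"
  shows "divergence X = 0"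
proof -
  have closed_compact: "compact K" if "closed K" for K :: "'m set"
    using compact_Int_closed[OF compact that] by simp
  \<comment> \<open>At every point a coordinate system, with a bump function \<open>\<theta>\<close> that is 1 on the neighbourhood \<open>M\<close> and
    supported in \<open>K\<close>; the choice is made for the whole tuple at once.\<close>
  let ?Q = "\<lambda>p (N, \<xi>, \<eta>, e, x, \<theta>, M, K). coord_system N \<xi> \<eta> e x \<and> \<theta> \<in> smooth_fun A \<and> open M \<and> p \<in> M \<and>
    (\<forall>q\<in>M. \<theta> q = 1) \<and> closed K \<and> K \<subseteq> N \<and> (\<forall>q. q \<notin> K \<longrightarrow> \<theta> q = 0) \<and> (\<forall>q. 0 \<le> \<theta> q)"
  have "\<exists>d. ?Q p d" for p
  proof -
    obtain N \<xi> \<eta> e x where c: "coord_system N \<xi> \<eta> e x" "p \<in> N" by (rule coord_system_exists)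
    then have "open N" by (simp add: coord_system_def)
    from bump_exists[OF this c(2)] obtain \<theta> M K where "\<theta> \<in> smooth_fun A" "open M" "p \<in> M" "M \<subseteq> N"
      "\<And>q. q \<in> M \<Longrightarrow> \<theta> q = 1" "closed K" "K \<subseteq> N" "\<And>q. q \<notin> K \<Longrightarrow> \<theta> q = 0" "\<And>q. 0 \<le> \<theta> q"
      by metis
    then have "?Q p (N, \<xi>, \<eta>, e, x, \<theta>, M, K)" using c by simp
    then show ?thesis by blast
  qed
  then have "\<exists>d. \<forall>p. ?Q p (d p)" by (intro choice allI)
  then obtain d where d: "\<And>p. ?Q p (d p)" by blast
  define N where "N p = fst (d p)" for p
  define \<xi> where "\<xi> p = fst (snd (d p))" for p
  define \<eta> where "\<eta> p = fst (snd (snd (d p)))" for p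
  define e where "e p = fst (snd (snd (snd (d p))))" for p
  define x where "x p = fst (snd (snd (snd (snd (d p)))))" for p
  define \<theta> where "\<theta> p = fst (snd (snd (snd (snd (snd (d p))))))" for p
  define M where "M p = fst (snd (snd (snd (snd (snd (snd (d p)))))))" for p
  define K where "K p = snd (snd (snd (snd (snd (snd (snd (d p)))))))" for p
  have data: "coord_system (N p) (\<xi> p) (\<eta> p) (e p) (x p)" "\<theta> p \<in> smooth_fun A" "open (M p)" "p \<in> M p"
    "\<And>q. q \<in> M p \<Longrightarrow> \<theta> p q = 1" "closed (K p)" "K p \<subseteq> N p" "\<And>q. q \<notin> K p \<Longrightarrow> \<theta> p q = 0" "\<And>q. 0 \<le> \<theta> p q" for p
    using d[of p]
    by (auto simp: N_def \<xi>_def \<eta>_def e_def x_def \<theta>_def M_def K_def case_prod_unfold)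
  have rc: "riemannian_coords A g J n D (N p) (\<xi> p) (\<eta> p) (e p) (x p)" for p
    by unfold_locales (rule data(1))
  have "UNIV \<subseteq> (\<Union>p\<in>UNIV. M p)" using data(4) by auto
  then obtain I where I: "finite I" "UNIV \<subseteq> (\<Union>p\<in>I. M p)"
    by (rule compactE_image[OF compact data(3)])
  define s where "s = (\<Sum>p\<in>I. \<theta> p)"
  have s_pos: "s q > 0" for q
  proof -
    obtain p where p: "p \<in> I" "q \<in> M p" using I(2) by blast
    have "0 < \<theta> p q" using data(5)[OF p(2)] by simp
    also have "\<dots> \<le> (\<Sum>p\<in>I. \<theta> p q)" using p I(1) data(9) by (intro member_le_sum) auto
    finally show ?thesis by (simp add: s_def sum_fun_apply)
  qed
  have s: "s \<in> smooth_fun A" unfolding s_def using data(2) by auto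
  \<comment> \<open>The partition of unity.\<close>
  define c where "c p = \<theta> p * (\<lambda>q. inverse (s q))" for p
  have c_smooth: "c p \<in> smooth_fun A" for p
    unfolding c_def using data(2) smooth_fun_inverse[OF s] s_pos by (auto simp: less_imp_neq[symmetric])
  have c_zero: "c p q = 0" if "q \<notin> K p" for p q using data(8)[OF that] by (simp add: c_def fun_app)
  have c_nonneg: "c p q \<ge> 0" for p q using data(9)[of p q] s_pos[of q] by (simp add: c_def fun_app)
  have c_sum: "(\<Sum>p\<in>I. c p) = 1"
  proof
    fix q
    have "(\<Sum>p\<in>I. c p) q = (\<Sum>p\<in>I. \<theta> p q) * inverse (s q)"
      by (simp add: c_def sum_fun_apply fun_app sum_distrib_right)
    also have "\<dots> = 1" using s_pos[of q] by (simp add: s_def sum_fun_apply)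
    finally show "(\<Sum>p\<in>I. c p) q = 1 q" by simp
  qed
  let ?L = "\<lambda>p. riemannian_coords.coord_integral g (N p) (\<xi> p) (\<eta> p) (e p)"
  define W where "W p = c p \<odot> X" for p
  have W: "W p \<in> vector_fields A" for p unfolding W_def using c_smooth X by auto
  have W_zero: "W p q = 0" if "q \<notin> K p" for p q
    using c_zero[OF that] by (simp add: W_def vf_scale_def)
  have divW_zero: "divergence (W p) q = 0" if "q \<notin> K p" for p q
  proof -
    have "X q (c p) = X q (\<lambda>_. 0)"
      by (rule tangent_local[OF vf_tangent[OF X] c_smooth smooth_fun_const, of "- K p"])
        (use that c_zero data(6) in auto)
    then have "vf_deriv X (c p) q = 0" using tangent_const[OF vf_tangent[OF X]] by (simp add: vf_deriv_def)
    then show ?thesis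
      unfolding W_def divergence_scale[OF c_smooth X] using c_zero[OF that] by (simp add: fun_app)
  qed
  have div_sum: "divergence X = (\<Sum>j\<in>I. divergence (W j))"
  proof -
    have "(\<Sum>j\<in>I. divergence (W j)) = (\<Sum>j\<in>I. c j * divergence X) + (\<Sum>j\<in>I. vf_deriv X (c j))"
      unfolding W_def divergence_scale[OF c_smooth X] by (rule sum.distrib)
    also have "(\<Sum>j\<in>I. c j * divergence X) = (\<Sum>j\<in>I. c j) * divergence X"
      by (rule sum_distrib_right[symmetric])
    also have "(\<Sum>j\<in>I. vf_deriv X (c j)) = vf_deriv X (\<Sum>j\<in>I. c j)"
      by (simp add: vf_deriv_def fun_eq_iff sum_fun_apply tangent_sum[OF vf_tangent[OF X] c_smooth])
    also have "vf_deriv X (\<Sum>j\<in>I. c j) = 0"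
      unfolding c_sum using tangent_const[OF vf_tangent[OF X], where c = 1]
      by (simp add: vf_deriv_def fun_eq_iff one_fun_def fun_app)
    finally show ?thesis unfolding c_sum mult_1 add_0_right by (rule sym)
  qed
  have cont: "?L i (c i * divergence (W j)) = ?L j (c i * divergence (W j))" for i j
    by (rule coord_integral_change[OF rc rc, of "K i \<inter> K j"])
      (use data(6,7) closed_compact c_smooth W c_zero divW_zero in \<open>auto simp: fun_app\<close>)
  have "(\<Sum>i\<in>I. ?L i (c i * divergence X)) = (\<Sum>i\<in>I. \<Sum>j\<in>I. ?L i (c i * divergence (W j)))"
  proof (intro sum.cong refl)
    fix i assume "i \<in> I"
    show "?L i (c i * divergence X) = (\<Sum>j\<in>I. ?L i (c i * divergence (W j)))"
      unfolding div_sum sum_distrib_left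
      by (rule riemannian_coords.coord_integral_sum[OF rc, of "K i"])
        (use data(6,7) closed_compact I c_smooth W c_zero in \<open>auto simp: fun_app\<close>)
  qed
  also have "\<dots> = (\<Sum>i\<in>I. \<Sum>j\<in>I. ?L j (c i * divergence (W j)))"
    by (intro sum.cong refl cont)
  also have "\<dots> = (\<Sum>j\<in>I. \<Sum>i\<in>I. ?L j (c i * divergence (W j)))"
    by (rule sum.swap)
  also have "\<dots> = (\<Sum>j\<in>I. ?L j (divergence (W j)))"
  proof (intro sum.cong refl)
    fix j assume "j \<in> I"
    have "(\<Sum>i\<in>I. ?L j (c i * divergence (W j))) = ?L j (\<Sum>i\<in>I. c i * divergence (W j))"
      by (rule riemannian_coords.coord_integral_sum[OF rc, of "K j", symmetric])
        (use data(6,7) closed_compact I c_smooth W divW_zero in \<open>auto simp: fun_app\<close>)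
    also have "(\<Sum>i\<in>I. c i * divergence (W j)) = divergence (W j)"
      using sum_distrib_right[of c I "divergence (W j)"] c_sum by simp
    finally show "(\<Sum>i\<in>I. ?L j (c i * divergence (W j))) = ?L j (divergence (W j))" .
  qed
  also have "\<dots> = 0"
    by (intro sum.neutral ballI riemannian_coords.coord_integral_divergence[OF rc
          closed_compact[OF data(6)] data(7) W W_zero])
  finally have total: "(\<Sum>i\<in>I. ?L i (c i * divergence X)) = 0" .
  have nn: "(c i * divergence X) q \<ge> 0" for i q using c_nonneg nonneg by (simp add: fun_app)
  have "c i * divergence X = 0" if i: "i \<in> I" for i
  proof
    fix q
    have zero: "?L i (c i * divergence X) = 0"
      using total I(1) i riemannian_coords.coord_integral_nonneg[OF rc nn]
      by (simp add: sum_nonneg_eq_0_iff)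
    have "(c i * divergence X) q = 0"
      by (rule riemannian_coords.coord_integral_eq_0[OF rc closed_compact[OF data(6)] data(7) _ _ nn zero])
        (use c_smooth X c_zero in \<open>auto simp: fun_app\<close>)
    then show "(c i * divergence X) q = 0 q" by (simp only: zero_fun_apply)
  qed
  then have "(\<Sum>i\<in>I. c i) * divergence X = 0"
    by (simp add: sum_distrib_right)
  then show ?thesis by (simp add: c_sum)
qed

end

section \<open>Almost-Kaehler geometry\<close>

locale almost_kaehler_manifold = almost_hermitian_lc A g J n D
  for A :: "('m::t2_space, 'e::euclidean_space) chart set" and g J n D +
  fixes \<omega> :: "'m form2"
  assumes almost_kaehler: "almost_kaehler A \<omega> J g"
begin

lemmas J_linear = J_add J_diff J_uminus J_scaleR
lemmas D_linear = D_add D_diff D_uminus D_scaleR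

lemma \<omega>_two_form: "two_form A \<omega>"
  and \<omega>_closed: "X \<in> vector_fields A \<Longrightarrow> Y \<in> vector_fields A \<Longrightarrow> Z \<in> vector_fields A \<Longrightarrow> ext_d2 \<omega> X Y Z = 0"
  and g_eq_\<omega>: "X \<in> vector_fields A \<Longrightarrow> Y \<in> vector_fields A \<Longrightarrow> g X Y = \<omega> X (J Y)"
  using almost_kaehler by (auto simp: almost_kaehler_def symplectic_form_def)

lemma \<omega>_bilinear: "bilinear_field A \<omega>" using \<omega>_two_form by (simp add: two_form_def)

lemma \<omega>_eq: "X \<in> vector_fields A \<Longrightarrow> Y \<in> vector_fields A \<Longrightarrow> \<omega> X Y = g (J X) Y"
proof -
  assume XY: "X \<in> vector_fields A" "Y \<in> vector_fields A"
  have "g X (J Y) = - \<omega> X Y"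
    using g_eq_\<omega>[of X "J Y"] XY one_form_uminus[OF bilinear_fieldD(1)[OF \<omega>_bilinear XY(1)] XY(2)] by simp
  then show ?thesis using g_J[OF XY] by simp
qed

lemma \<omega>_skew: "X \<in> vector_fields A \<Longrightarrow> Y \<in> vector_fields A \<Longrightarrow> \<omega> X Y = - \<omega> Y X"
  using g_J[of X Y] g_commute[of X "J Y"] by (simp add: \<omega>_eq)

abbreviation DJ :: "'m vfield \<Rightarrow> 'm vfield \<Rightarrow> 'm vfield"
  where "DJ X Y \<equiv> cov_endo D X J Y"

lemma DJ_closed [simp, intro]: "X \<in> vector_fields A \<Longrightarrow> Y \<in> vector_fields A \<Longrightarrow> DJ X Y \<in> vector_fields A"
  by (auto simp: cov_endo_def)

lemma DJ_endo_left: "Y \<in> vector_fields A \<Longrightarrow> endo_field A (\<lambda>X. DJ X Y)"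
  by (rule endo_fieldI)
    (simp_all add: cov_endo_def D_left J_add J_scale,
      simp_all add: vf_scale_def fun_eq_iff scaleR_fun_def fun_app algebra_simps)

lemma DJ_endo_right: "X \<in> vector_fields A \<Longrightarrow> endo_field A (DJ X)"
  by (rule endo_fieldI)
    (simp_all add: cov_endo_def D_add D_scale J_add J_scale,
      simp_all add: vf_scale_def fun_eq_iff scaleR_fun_def fun_app algebra_simps)

lemma DJ_J: "X \<in> vector_fields A \<Longrightarrow> Y \<in> vector_fields A \<Longrightarrow> DJ X (J Y) = - J (DJ X Y)"
  by (simp add: cov_endo_def D_linear J_linear)

lemma DJ_uminus: "X \<in> vector_fields A \<Longrightarrow> Y \<in> vector_fields A \<Longrightarrow> DJ X (- Y) = - DJ X Y"
  by (simp add: cov_endo_def D_linear J_linear)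

lemma DJ_skew:
  assumes "X \<in> vector_fields A" "Y \<in> vector_fields A" "Z \<in> vector_fields A"
  shows "g (DJ X Y) Z = - g (DJ X Z) Y"
proof -
  have "g (D X (J Y)) Z + g (J Y) (D X Z) = vf_deriv X (g (J Y) Z)"
    using assms by (simp add: D_metric)
  also have "\<dots> = - vf_deriv X (g (J Z) Y)"
    using assms g_J[of Y Z] g_commute[of Y "J Z"] by (simp add: vf_deriv_fun_uminus)
  also have "\<dots> = - (g (D X (J Z)) Y + g (J Z) (D X Y))"
    using assms by (simp add: D_metric)
  finally show ?thesis
    using assms g_J[of Y "D X Z"] g_J[of Z "D X Y"] g_commute[of Y "J (D X Z)"] g_commute[of Z "J (D X Y)"]
    by (simp add: cov_endo_def g_linear algebra_simps)
qed

lemma DJ_J_right: "X \<in> vector_fields A \<Longrightarrow> Y \<in> vector_fields A \<Longrightarrow> Z \<in> vector_fields A \<Longrightarrow>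
    g (DJ X (J Y)) Z = g (DJ X Y) (J Z)"
  by (simp add: DJ_J g_scale g_J)

lemma cov_\<omega>:
  assumes "X \<in> vector_fields A" "Y \<in> vector_fields A" "Z \<in> vector_fields A"
  shows "cov_form2 D X \<omega> Y Z = g (DJ X Y) Z"
  using assms by (simp add: cov_form2_def \<omega>_eq D_metric cov_endo_def g_linear)

text \<open>For a torsion-free connection the exterior derivative is the cyclic sum of the covariant
  derivative.\<close>

lemma ext_d2_eq_cov:
  assumes \<psi>: "bilinear_field A \<psi>"
    and skew: "\<And>X Y. X \<in> vector_fields A \<Longrightarrow> Y \<in> vector_fields A \<Longrightarrow> \<psi> X Y = - \<psi> Y X"
    and vf: "X \<in> vector_fields A" "Y \<in> vector_fields A" "Z \<in> vector_fields A"
  shows "ext_d2 \<psi> X Y Z = cov_form2 D X \<psi> Y Z + cov_form2 D Y \<psi> Z X + cov_form2 D Z \<psi> X Y"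
proof -
  have diff: "\<psi> (U - V) Z = \<psi> U Z - \<psi> V Z"
    if "U \<in> vector_fields A" "V \<in> vector_fields A" "Z \<in> vector_fields A" for U V Z
    using one_form_diff[OF bilinear_fieldD(2)[OF \<psi> that(3)]] that by simp
  have "vf_deriv Y (\<psi> Z X) = - vf_deriv Y (\<psi> X Z)"
    using vf skew[of Z X] one_form_closed[OF bilinear_fieldD(1)[OF \<psi>]] by (simp add: vf_deriv_fun_uminus)
  then show ?thesis
    unfolding ext_d2_def cov_form2_def
    using vf skew[of Y "D X Z"] skew[of Z "D Y X"] skew[of X "D Z Y"] skew[of X "D Y Z"] skew[of "D X Z" Y]
      skew[of "D Z X" Y] skew[of "D Y Z" X] skew[of Y "D Z X"]
    by (simp add: D_torsion diff algebra_simps)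
qed

lemma DJ_cyclic:
  assumes "X \<in> vector_fields A" "Y \<in> vector_fields A" "Z \<in> vector_fields A"
  shows "g (DJ X Y) Z + g (DJ Y Z) X + g (DJ Z X) Y = 0"
proof -
  from ext_d2_eq_cov[OF \<omega>_bilinear \<omega>_skew assms] show ?thesis
    using assms by (simp add: \<omega>_closed cov_\<omega>)
qed

text \<open>The quasi-Kaehler identity \<open>D\<^bsub>JX\<^esub> J = (D\<^sub>X J) J\<close>. It follows by adding the four cyclic
  identities obtained from \<open>d\<omega> = 0\<close> by applying \<open>J\<close> to each argument and to all of them.\<close>

lemma DJ_J_left:
  assumes X: "X \<in> vector_fields A" and Y: "Y \<in> vector_fields A"
  shows "DJ (J X) Y = DJ X (J Y)"
proof (rule vf_eq_via_g)
  fix Z assume Z: "Z \<in> vector_fields A"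
  note vf = X Y Z
  define a b c a' b' c' where abc: "a = g (DJ X (J Y)) Z" "b = g (DJ Y (J Z)) X" "c = g (DJ Z (J X)) Y"
    "a' = g (DJ (J X) Y) Z" "b' = g (DJ (J Y) Z) X" "c' = g (DJ (J Z) X) Y"
  have "a' + b + c = 0" using DJ_cyclic[of "J X" Y Z] vf by (simp add: abc DJ_J_right)
  moreover have "a + b' + c = 0" using DJ_cyclic[of X "J Y" Z] vf by (simp add: abc DJ_J_right)
  moreover have "a + b + c' = 0" using DJ_cyclic[of X Y "J Z"] vf by (simp add: abc DJ_J_right)
  moreover have "- a' - b' - c' = 0"
    using DJ_cyclic[of "J X" "J Y" "J Z"] vf
    by (simp add: abc DJ_J_right g_scale)
  ultimately have "a' p = a p" for p
    by (auto dest!: fun_cong[of _ _ p] simp: fun_app)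
  then show "g (DJ (J X) Y) Z = g (DJ X (J Y)) Z" by (simp add: abc fun_eq_iff)
qed (use assms in auto)

subsection \<open>The canonical connection\<close>

abbreviation nabla :: "'m vfield \<Rightarrow> 'm vfield \<Rightarrow> 'm vfield"
  where "nabla \<equiv> canonical_connection J D"

lemma nabla_closed [simp, intro]: "X \<in> vector_fields A \<Longrightarrow> Y \<in> vector_fields A \<Longrightarrow> nabla X Y \<in> vector_fields A"
  by (auto simp: canonical_connection_def)

lemma vf_half: "(1/2) *\<^sub>R X + (1/2) *\<^sub>R X = (X :: 'm vfield)"
  by (simp add: scaleR_add_left[symmetric])

lemma nabla_J:
  assumes "X \<in> vector_fields A" "Y \<in> vector_fields A"
  shows "nabla X (J Y) = J (nabla X Y)"
proof -
  have "nabla X (J Y) = D X (J Y) - (1/2) *\<^sub>R DJ X Y"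
    using assms by (simp add: canonical_connection_def DJ_J J_linear)
  moreover have "J (nabla X Y) = J (D X Y) + (1/2) *\<^sub>R DJ X Y"
    using assms by (simp add: canonical_connection_def J_linear)
  moreover have "D X (J Y) = J (D X Y) + ((1/2) *\<^sub>R DJ X Y + (1/2) *\<^sub>R DJ X Y)"
    unfolding vf_half by (simp add: cov_endo_def)
  ultimately show ?thesis by simp
qed

lemma nabla_add: "X \<in> vector_fields A \<Longrightarrow> Y \<in> vector_fields A \<Longrightarrow> Z \<in> vector_fields A \<Longrightarrow>
    nabla X (Y + Z) = nabla X Y + nabla X Z"
  using endo_fieldD(2)[OF DJ_endo_right[of X], of Y Z]
  by (simp add: canonical_connection_def D_add J_add scaleR_add_right)

lemma nabla_diff: "X \<in> vector_fields A \<Longrightarrow> Y \<in> vector_fields A \<Longrightarrow> Z \<in> vector_fields A \<Longrightarrow>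
    nabla X (Y - Z) = nabla X Y - nabla X Z"
  using nabla_add[of X "Y - Z" Z] by (simp add: algebra_simps)

lemma nabla_metric:
  assumes "X \<in> vector_fields A" "Y \<in> vector_fields A" "Z \<in> vector_fields A"
  shows "vf_deriv X (g Y Z) = g (nabla X Y) Z + g Y (nabla X Z)"
proof -
  have "g (J (DJ X Y)) Z = - g Y (J (DJ X Z))"
    using assms DJ_skew[of X Y "J Z"] DJ_J_right[of X Z Y] g_commute[of Y "J (DJ X Z)"]
    by (simp add: g_J)
  then have "g ((1/2) *\<^sub>R J (DJ X Y)) Z + g Y ((1/2) *\<^sub>R J (DJ X Z)) = 0"
    using assms by (simp add: g_scale)
  then show ?thesis
    using assms by (simp add: canonical_connection_def g_linear D_metric algebra_simps)
qed

text \<open>The torsion of \<open>\<nabla>\<close> is complex antilinear in each argument (\<open>torsion_J\<close>): it is a quarter of the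
  Nijenhuis tensor.\<close>

definition torsion :: "'m vfield \<Rightarrow> 'm vfield \<Rightarrow> 'm vfield"
  where "torsion X Y = nabla X Y - nabla Y X - lie_bracket X Y"

lemma torsion_closed [simp, intro]:
  "X \<in> vector_fields A \<Longrightarrow> Y \<in> vector_fields A \<Longrightarrow> torsion X Y \<in> vector_fields A"
  by (auto simp: torsion_def)

lemma torsion_skew: "torsion X Y = - torsion Y X"
  using lie_bracket_skew[of X Y] by (simp add: torsion_def)

lemma g_torsion:
  assumes "X \<in> vector_fields A" "Y \<in> vector_fields A" "Z \<in> vector_fields A"
  shows "g (torsion X Y) Z = - (1/2) *\<^sub>R g (DJ Z (J X)) Y"
proof -
  let ?V = "DJ X Y - DJ Y X"
  have "torsion X Y = - (1/2) *\<^sub>R J ?V"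
    using assms by (simp add: torsion_def canonical_connection_def D_torsion J_linear algebra_simps)
  then have "g (torsion X Y) Z = (1/2) *\<^sub>R g ?V (J Z)"
    using assms by (simp add: g_scale g_J)
  also have "g ?V (J Z) = - g (DJ (J Z) X) Y"
    using assms DJ_cyclic[of X Y "J Z"] DJ_skew[of Y X "J Z"]
    by (simp add: g_linear) (simp add: fun_eq_iff fun_app eq_neg_iff_add_eq_0)
  finally show ?thesis using assms by (simp add: DJ_J_left)
qed

lemma torsion_J:
  assumes "X \<in> vector_fields A" "Y \<in> vector_fields A"
  shows "torsion (J X) Y = - J (torsion X Y)" "torsion X (J Y) = - J (torsion X Y)"
proof -
  have *: "torsion (J X) Y = - J (torsion X Y)" if "X \<in> vector_fields A" "Y \<in> vector_fields A" for X Y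
  proof (rule vf_eq_via_g)
    fix Z assume Z: "Z \<in> vector_fields A"
    show "g (torsion (J X) Y) Z = g (- J (torsion X Y)) Z"
      using that Z by (simp add: g_scale g_J g_torsion DJ_J_left DJ_J DJ_uminus J_linear)
  qed (use that in auto)
  show "torsion (J X) Y = - J (torsion X Y)" by (rule *[OF assms])
  show "torsion X (J Y) = - J (torsion X Y)"
    using *[of Y X] torsion_skew[of X "J Y"] torsion_skew[of X Y] assms by (simp add: J_linear)
qed

text \<open>The \<open>(0,1)\<close>-part of the canonical connection depends on \<open>J\<close> only, so it is preserved by every
  field that preserves \<open>J\<close>.\<close>

lemma nabla_01:
  assumes "Y \<in> vector_fields A" "Z \<in> vector_fields A"
  shows "2 *\<^sub>R (nabla Y Z + J (nabla (J Y) Z))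
    = lie_bracket Y Z + J (lie_bracket (J Y) Z) + lie_bracket (J Y) (J Z) - J (lie_bracket Y (J Z))"
proof -
  have bracket: "lie_bracket U V = nabla U V - nabla V U - torsion U V" for U V
    by (simp add: torsion_def)
  show ?thesis
    unfolding bracket
    using assms by (simp add: J_linear nabla_J torsion_J scaleR_2 algebra_simps)
qed

end

section \<open>Holomorphic vector fields\<close>

context almost_kaehler_manifold
begin

lemma holomorphicD:
  assumes "X \<in> holomorphic_fields A J"
  shows "X \<in> vector_fields A" "Y \<in> vector_fields A \<Longrightarrow> lie_bracket X (J Y) = J (lie_bracket X Y)"
  using assms by (auto simp: holomorphic_fields_def lie_endo_def)

lemma holomorphic_bracket:
  assumes X: "X \<in> holomorphic_fields A J" and Y: "Y \<in> holomorphic_fields A J"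
  shows "lie_bracket X Y \<in> holomorphic_fields A J"
proof -
  note XY = holomorphicD(1)[OF X] holomorphicD(1)[OF Y]
  have "lie_bracket (lie_bracket X Y) (J Z) = J (lie_bracket (lie_bracket X Y) Z)"
    if Z: "Z \<in> vector_fields A" for Z
  proof -
    have eq: "lie_bracket (lie_bracket X Y) Z = lie_bracket X (lie_bracket Y Z) - lie_bracket Y (lie_bracket X Z)"
      if "Z \<in> vector_fields A" for Z
      using Jacobi[OF XY that] by simp
    show ?thesis
      using XY Z by (simp add: eq holomorphicD(2)[OF X] holomorphicD(2)[OF Y] J_linear)
  qed
  then show ?thesis using XY by (auto simp: holomorphic_fields_def lie_endo_def)
qed

text \<open>The Lie derivative of the canonical connection along a holomorphic field is complex linear in
  the direction of differentiation, because it annihilates the \<open>(0,1)\<close>-part.\<close>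

definition lie_nabla :: "'m vfield \<Rightarrow> 'm vfield \<Rightarrow> 'm vfield \<Rightarrow> 'm vfield"
  where "lie_nabla X Y Z = lie_bracket X (nabla Y Z) - nabla (lie_bracket X Y) Z - nabla Y (lie_bracket X Z)"

lemma lie_nabla_01:
  assumes X: "X \<in> holomorphic_fields A J" and Y: "Y \<in> vector_fields A" and Z: "Z \<in> vector_fields A"
  shows "lie_nabla X Y Z + J (lie_nabla X (J Y) Z) = 0"
proof -
  note vf = holomorphicD(1)[OF X] Y Z
  define P where "P Y Z = nabla Y Z + J (nabla (J Y) Z)" for Y Z
  have P: "P Y Z \<in> vector_fields A" if "Y \<in> vector_fields A" "Z \<in> vector_fields A" for Y Z
    using that by (simp add: P_def)
  have "lie_nabla X Y Z + J (lie_nabla X (J Y) Z)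
      = lie_bracket X (P Y Z) - P (lie_bracket X Y) Z - P Y (lie_bracket X Z)"
    using vf by (simp add: lie_nabla_def P_def lie_bracket_linear J_linear holomorphicD(2)[OF X] algebra_simps)
  then have "2 *\<^sub>R (lie_nabla X Y Z + J (lie_nabla X (J Y) Z))
      = lie_bracket X (2 *\<^sub>R P Y Z) - 2 *\<^sub>R P (lie_bracket X Y) Z - 2 *\<^sub>R P Y (lie_bracket X Z)"
    using vf P by (simp add: lie_bracket_linear scaleR_right_diff_distrib)
  also have "\<dots> = 0"
    using vf by (simp add: P_def nabla_01 lie_bracket_linear J_linear holomorphicD(2)[OF X] Jacobi[OF vf(1)])
  finally show ?thesis by (simp only: scaleR_eq_0_iff) simp
qed

text \<open>The endomorphism \<open>\<nabla>\<^sub>X - L\<^sub>X\<close>. Its trace and complex trace are the divergences of \<open>X\<close> and \<open>JX\<close>, and its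
  covariant derivative is curvature plus the Lie derivative of the connection.\<close>

definition defect :: "'m vfield \<Rightarrow> 'm vfield \<Rightarrow> 'm vfield"
  where "defect X Y = nabla X Y - lie_bracket X Y"

lemma defect_eq: "defect X Y = nabla Y X + torsion X Y"
  by (simp add: defect_def torsion_def)

lemma defect_closed [simp, intro]:
  "X \<in> vector_fields A \<Longrightarrow> Y \<in> vector_fields A \<Longrightarrow> defect X Y \<in> vector_fields A"
  by (auto simp: defect_def)

lemma lie_bracket_scale:
  assumes "X \<in> vector_fields A" "Y \<in> vector_fields A" "f \<in> smooth_fun A"
  shows "lie_bracket X (f \<odot> Y) = vf_deriv X f \<odot> Y + f \<odot> lie_bracket X Y"
  using assms
  by (simp add: D_torsion D_scale D_left) (simp add: vf_scale_def fun_eq_iff scaleR_fun_def fun_app algebra_simps)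

lemma nabla_scale:
  assumes "X \<in> vector_fields A" "Y \<in> vector_fields A" "f \<in> smooth_fun A"
  shows "nabla X (f \<odot> Y) = vf_deriv X f \<odot> Y + f \<odot> nabla X Y"
  using assms endo_fieldD(3)[OF DJ_endo_right[of X], of f Y]
  by (simp add: canonical_connection_def D_scale J_scale)
    (simp add: vf_scale_def fun_eq_iff scaleR_fun_def fun_app algebra_simps)

lemma defect_endo: "X \<in> vector_fields A \<Longrightarrow> endo_field A (defect X)"
  by (rule endo_fieldI)
    (simp_all add: defect_def nabla_add lie_bracket_linear nabla_scale lie_bracket_scale,
      simp_all add: vf_scale_def fun_eq_iff scaleR_fun_def fun_app algebra_simps)

lemma nabla_defect:
  assumes "X \<in> vector_fields A" "Y \<in> vector_fields A" "Z \<in> vector_fields A"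
  shows "nabla Y (defect X Z) - defect X (nabla Y Z) = curvature nabla X Y Z + lie_nabla X Y Z"
  using assms by (simp add: defect_def curvature_def lie_nabla_def nabla_diff)

text \<open>On the diagonal the torsion of \<open>\<nabla>\<close> cancels the difference between \<open>\<nabla>\<close> and \<open>D\<close>. With \<open>J\<close> in front,
  a term in \<open>DJ\<close> is left over, which is anti-invariant and has no trace.\<close>

lemma g_defect:
  assumes "X \<in> vector_fields A" "Z \<in> vector_fields A"
  shows "g (defect X Z) Z = g (D Z X) Z"
    and "g (J (defect X Z)) Z = g (D Z (J X)) Z - g (DJ Z X) Z"
proof -
  have t: "g (torsion X Z) Z = - (1/2) *\<^sub>R g (DJ Z X) (J Z)"
    "g (torsion X Z) (J Z) = (1/2) *\<^sub>R g (DJ Z X) Z"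
    using assms by (simp_all add: g_torsion DJ_J_right DJ_J_left DJ_uminus g_scale)
  show "g (defect X Z) Z = g (D Z X) Z"
    using assms t(1) by (simp add: defect_eq canonical_connection_def g_linear g_scale g_J)
  have "g (D Z (J X)) Z = g (DJ Z X) Z - g (D Z X) (J Z)"
    using assms g_J[of "D Z X" Z] g_linear(1)[of "DJ Z X" "J (D Z X)" Z] by (simp add: cov_endo_def)
  then show "g (J (defect X Z)) Z = g (D Z (J X)) Z - g (DJ Z X) Z"
    using assms t(2)
    by (simp add: defect_eq canonical_connection_def g_linear g_scale g_J g_J_J J_linear)
qed

lemma tr_DJ_eq_0:
  assumes "X \<in> vector_fields A" shows "tr_g (\<lambda>Y Z. g (DJ Y X) Z) = 0"
  by (rule tr_g_J_anti[OF bilinear_field_compose[OF g_bilinear DJ_endo_left[OF assms] endo_field_id]])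
    (use assms in \<open>simp add: DJ_J_left DJ_J_right[symmetric] DJ_uminus g_scale\<close>)

lemma tr_defect:
  assumes "X \<in> vector_fields A"
  shows "tr_g (\<lambda>Y Z. g (defect X Y) Z) = divergence X"
    and "tr_g (\<lambda>Y Z. g (J (defect X Y)) Z) = divergence (J X)"
proof -
  show "tr_g (\<lambda>Y Z. g (defect X Y) Z) = divergence X"
    unfolding divergence_def by (rule tr_g_cong) (rule g_defect(1)[OF assms])
  have "tr_g (\<lambda>Y Z. g (J (defect X Y)) Z) = tr_g (\<lambda>Y Z. g (D Y (J X)) Z - g (DJ Y X) Z)"
    by (rule tr_g_cong) (rule g_defect(2)[OF assms])
  then show "tr_g (\<lambda>Y Z. g (J (defect X Y)) Z) = divergence (J X)"
    unfolding tr_g_diff tr_DJ_eq_0[OF assms] by (simp add: divergence_def)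
qed

lemma curvature_closed [simp, intro]:
  "X \<in> vector_fields A \<Longrightarrow> Y \<in> vector_fields A \<Longrightarrow> Z \<in> vector_fields A \<Longrightarrow>
    curvature nabla X Y Z \<in> vector_fields A"
  by (auto simp: curvature_def)

lemma lie_nabla_closed [simp, intro]:
  "X \<in> vector_fields A \<Longrightarrow> Y \<in> vector_fields A \<Longrightarrow> Z \<in> vector_fields A \<Longrightarrow>
    lie_nabla X Y Z \<in> vector_fields A"
  by (auto simp: lie_nabla_def)

text \<open>The real trace of the curvature vanishes because \<open>\<nabla>\<close> is metric: twice the left-hand side is the
  action of \<open>[X,Y]\<close> on \<open>g(Z,Z)\<close> minus the commutator of the actions of \<open>X\<close> and \<open>Y\<close>.\<close>

lemma curvature_skew:
  assumes "X \<in> vector_fields A" "Y \<in> vector_fields A" "Z \<in> vector_fields A"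
  shows "g (curvature nabla X Y Z) Z = 0"
proof -
  have half: "vf_deriv U (g Z Z) = 2 *\<^sub>R g (nabla U Z) Z" if "U \<in> vector_fields A" for U
    using nabla_metric[OF that assms(3,3)] g_commute[of Z "nabla U Z"] that assms(3) by (simp add: scaleR_2)
  have second: "vf_deriv U (vf_deriv V (g Z Z))
      = 2 *\<^sub>R (g (nabla U (nabla V Z)) Z + g (nabla V Z) (nabla U Z))"
    if "U \<in> vector_fields A" "V \<in> vector_fields A" for U V
    unfolding half[OF that(2)] using that assms(3) by (simp add: vf_deriv_fun_scaleR nabla_metric)
  have "2 *\<^sub>R g (curvature nabla X Y Z) Z
      = 2 *\<^sub>R g (nabla (lie_bracket X Y) Z) Z
        - 2 *\<^sub>R g (nabla X (nabla Y Z)) Z + 2 *\<^sub>R g (nabla Y (nabla X Z)) Z"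
    using assms by (simp add: curvature_def g_linear algebra_simps)
  moreover have "2 *\<^sub>R g (nabla (lie_bracket X Y) Z) Z
      = vf_deriv X (vf_deriv Y (g Z Z)) - vf_deriv Y (vf_deriv X (g Z Z))"
    using assms half[of "lie_bracket X Y"] by (simp add: lie_bracket_deriv)
  moreover have "vf_deriv X (vf_deriv Y (g Z Z)) - vf_deriv Y (vf_deriv X (g Z Z))
      = 2 *\<^sub>R g (nabla X (nabla Y Z)) Z - 2 *\<^sub>R g (nabla Y (nabla X Z)) Z"
    using assms second[of X Y] second[of Y X] g_commute[of "nabla Y Z" "nabla X Z"]
    by (simp add: algebra_simps)
  ultimately have "2 *\<^sub>R g (curvature nabla X Y Z) Z = 0" by simp
  then show ?thesis by (simp only: scaleR_eq_0_iff) simp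
qed

text \<open>Taking traces in the covariant derivative of the defect, in the directions \<open>Y\<close> and \<open>JY\<close>, the
  connection terms cancel and only the Ricci form of the canonical connection is left.\<close>

theorem divergence_chern_ricci:
  assumes X: "X \<in> holomorphic_fields A J" and Y: "Y \<in> vector_fields A"
  shows "vf_deriv Y (divergence X) + vf_deriv (J Y) (divergence (J X))
    = - 2 *\<^sub>R chern_ricci A J g D X (J Y)"
proof
  fix p
  have vf: "X \<in> vector_fields A" "Y \<in> vector_fields A" "J Y \<in> vector_fields A"
    using holomorphicD(1)[OF X] Y by auto
  \<comment> \<open>The frame in which the Ricci form at \<open>p\<close> is evaluated.\<close>
  let ?E = "SOME E. \<exists>W. p \<in> W \<and> adapted_frame A J g W E"
  obtain E0 W0 where "p \<in> W0" "adapted_frame A J g W0 E0" by (rule adapted_frame_exists)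
  then have "\<exists>W. p \<in> W \<and> adapted_frame A J g W ?E"
    using someI[of "\<lambda>E. \<exists>W. p \<in> W \<and> adapted_frame A J g W E" E0] by blast
  then obtain W where W: "p \<in> W" "orthonormal_frame A g W ?E" by (auto simp: adapted_frame_def)
  have E: "?E i \<in> vector_fields A" if "i < DIM('e)" for i using W(2) that by (simp add: orthonormal_frame_def)
  let ?I = "{..<DIM('e)}"
  have B: "bilinear_field A (\<lambda>Z V. g (defect X Z) V)"
    by (rule bilinear_field_compose[OF g_bilinear defect_endo[OF vf(1)] endo_field_id])
  have JB: "bilinear_field A (\<lambda>Z V. g (J (defect X Z)) V)"
    using bilinear_field_compose[OF bilinear_field_compose[OF g_bilinear J_endo endo_field_id]
        defect_endo[OF vf(1)] endo_field_id] .
  have "vf_deriv Y (divergence X) p = (\<Sum>i\<in>?I. (vf_deriv Y (g (defect X (?E i)) (?E i))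
      - g (defect X (nabla Y (?E i))) (?E i) - g (defect X (?E i)) (nabla Y (?E i))) p)"
    unfolding tr_defect(1)[OF vf(1), symmetric]
    by (rule vf_deriv_tr_g[OF W(2,1) B Y nabla_closed[OF Y] nabla_metric[OF Y]])
  also have "\<dots> = (\<Sum>i\<in>?I. g (curvature nabla X Y (?E i) + lie_nabla X Y (?E i)) (?E i) p)"
    using vf E by (intro sum.cong refl)
      (simp add: nabla_metric nabla_defect[symmetric] g_linear(3))
  finally have 1: "vf_deriv Y (divergence X) p
      = (\<Sum>i\<in>?I. g (curvature nabla X Y (?E i) + lie_nabla X Y (?E i)) (?E i) p)" .
  have "vf_deriv (J Y) (divergence (J X)) p = (\<Sum>i\<in>?I. (vf_deriv (J Y) (g (J (defect X (?E i))) (?E i))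
      - g (J (defect X (nabla (J Y) (?E i)))) (?E i) - g (J (defect X (?E i))) (nabla (J Y) (?E i))) p)"
    unfolding tr_defect(2)[OF vf(1), symmetric]
    by (rule vf_deriv_tr_g[OF W(2,1) JB vf(3) nabla_closed[OF vf(3)] nabla_metric[OF vf(3)]])
  also have "\<dots> = (\<Sum>i\<in>?I. g (J (curvature nabla X (J Y) (?E i) + lie_nabla X (J Y) (?E i))) (?E i) p)"
    using vf E by (intro sum.cong refl)
      (simp add: nabla_metric nabla_J nabla_defect[symmetric] g_linear(3) J_diff)
  finally have 2: "vf_deriv (J Y) (divergence (J X)) p
      = (\<Sum>i\<in>?I. g (J (curvature nabla X (J Y) (?E i) + lie_nabla X (J Y) (?E i))) (?E i) p)" .
  have "vf_deriv Y (divergence X) p + vf_deriv (J Y) (divergence (J X)) p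
      = (\<Sum>i\<in>?I. - g (curvature nabla X (J Y) (?E i)) (J (?E i)) p)"
    unfolding 1 2 sum.distrib[symmetric]
  proof (intro sum.cong refl)
    fix i assume "i \<in> ?I"
    then have Ei: "?E i \<in> vector_fields A" using E by simp
    have "lie_nabla X Y (?E i) = - J (lie_nabla X (J Y) (?E i))"
      using lie_nabla_01[OF X Y Ei] by (simp add: eq_neg_iff_add_eq_0)
    then show "g (curvature nabla X Y (?E i) + lie_nabla X Y (?E i)) (?E i) p
        + g (J (curvature nabla X (J Y) (?E i) + lie_nabla X (J Y) (?E i))) (?E i) p
        = - g (curvature nabla X (J Y) (?E i)) (J (?E i)) p"
      using vf Ei by (simp add: g_linear g_scale J_linear curvature_skew g_J fun_app)
  qed
  then show "(vf_deriv Y (divergence X) + vf_deriv (J Y) (divergence (J X))) p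
      = (- 2 *\<^sub>R chern_ricci A J g D X (J Y)) p"
    by (simp add: fun_app chern_ricci_def Let_def scaleR_fun_def sum_negf)
qed

end

section \<open>Consequences of the Einstein condition\<close>

context almost_kaehler_manifold
begin

lemma hessian_symmetric:
  assumes "f \<in> smooth_fun A" "Y \<in> vector_fields A" "Z \<in> vector_fields A"
  shows "g (D Y (gradient f)) Z = g (D Z (gradient f)) Y"
proof -
  have h: "g (D Y (gradient f)) Z = vf_deriv Y (vf_deriv Z f) - vf_deriv (D Y Z) f"
    if "Y \<in> vector_fields A" "Z \<in> vector_fields A" for Y Z
    using D_metric[of Y "gradient f" Z] assms(1) that by (simp add: g_gradient)
  have "vf_deriv Y (vf_deriv Z f) - vf_deriv Z (vf_deriv Y f) = vf_deriv (D Y Z) f - vf_deriv (D Z Y) f"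
    using lie_bracket_deriv[of Y Z f] assms by (simp add: D_torsion)
  then show ?thesis unfolding h[OF assms(2,3)] h[OF assms(3,2)] by (simp add: algebra_simps)
qed

text \<open>\<open>\<delta> d\<^sup>c f = 0\<close>: the trace of a symmetric form against \<open>J\<close> vanishes, and so does the trace of \<open>DJ\<close>.\<close>

lemma divergence_J_gradient:
  assumes f: "f \<in> smooth_fun A" shows "divergence (J (gradient f)) = 0"
proof -
  let ?F = "gradient f"
  have F: "?F \<in> vector_fields A" using f by auto
  have "divergence (J ?F) = tr_g (\<lambda>Y Z. g (DJ Y ?F) Z - g (D Y ?F) (J Z))"
    unfolding divergence_def
  proof (rule tr_g_cong)
    fix Y assume "Y \<in> vector_fields A"
    then show "g (D Y (J ?F)) Y = g (DJ Y ?F) Y - g (D Y ?F) (J Y)"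
      using F g_J[of "D Y ?F" Y] g_linear(1)[of "DJ Y ?F" "J (D Y ?F)" Y] by (simp add: cov_endo_def)
  qed
  also have "\<dots> = - tr_g (\<lambda>Y Z. g (D Y ?F) (J Z))"
    by (simp add: tr_g_diff tr_DJ_eq_0[OF F])
  also have "tr_g (\<lambda>Y Z. g (D Y ?F) (J Z)) = 0"
    by (rule tr_g_J_anti[OF bilinear_field_compose[OF g_bilinear D_endo[OF F] J_endo]])
      (use F hessian_symmetric[OF f] in \<open>simp add: g_scale\<close>)
  finally show ?thesis by simp
qed

text \<open>The gradient form of the key identity: on a first-Chern--Einstein manifold a holomorphic field is
  determined, up to the Einstein constant, by two functions.\<close>

lemma holomorphic_decomposition:
  assumes eq: "chern_ricci_eq A \<omega> J g D c" and X: "X \<in> holomorphic_fields A J"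
  shows "(2 * c) *\<^sub>R X = J (gradient (divergence (J X))) - gradient (divergence X)"
    and "divergence (gradient (divergence X)) = - (2 * c) *\<^sub>R divergence X"
    and "divergence (gradient (divergence (J X))) = - (2 * c) *\<^sub>R divergence (J X)"
proof -
  note X' = holomorphicD(1)[OF X]
  let ?a = "divergence X" and ?b = "divergence (J X)"
  have vf: "gradient ?a \<in> vector_fields A" "gradient ?b \<in> vector_fields A" using X' by auto
  show dec: "(2 * c) *\<^sub>R X = J (gradient ?b) - gradient ?a"
  proof (rule vf_eq_via_g)
    fix Y assume Y: "Y \<in> vector_fields A"
    have "chern_ricci A J g D X (J Y) = c *\<^sub>R g X Y"
      using eq X' Y by (simp add: chern_ricci_eq_def g_eq_\<omega>)
    then have key: "vf_deriv Y ?a + vf_deriv (J Y) ?b = - (2 * c) *\<^sub>R g X Y"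
      using divergence_chern_ricci[OF X Y] by simp
    have "(2 * c) *\<^sub>R g X Y = - (vf_deriv Y ?a + vf_deriv (J Y) ?b)"
      unfolding key by simp
    then show "g ((2 * c) *\<^sub>R X) Y = g (J (gradient ?b) - gradient ?a) Y"
      using X' Y vf by (simp add: g_scale(3) g_linear g_J g_gradient)
  qed (use X' vf in auto)
  have "(2 * c) *\<^sub>R ?a = - divergence (gradient ?a)"
    using arg_cong[OF dec, of divergence] X' vf by (simp add: divergence_scaleR divergence_diff divergence_J_gradient)
  then show "divergence (gradient ?a) = - (2 * c) *\<^sub>R ?a" by simp
  have "(2 * c) *\<^sub>R J X = - gradient ?b - J (gradient ?a)"
    using arg_cong[OF dec, of J] X' vf by (simp add: J_scaleR J_diff)
  from arg_cong[OF this, of divergence]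
  have "(2 * c) *\<^sub>R ?b = - divergence (gradient ?b)"
    using X' vf by (simp add: divergence_scaleR divergence_diff divergence_J_gradient divergence_uminus)
  then show "divergence (gradient ?b) = - (2 * c) *\<^sub>R ?b" by simp
qed

subsection \<open>Harmonic functions and eigenfunctions\<close>

lemma gradient_eq_0_imp:
  "f \<in> smooth_fun A \<Longrightarrow> gradient f = 0 \<Longrightarrow> X \<in> vector_fields A \<Longrightarrow> vf_deriv X f = 0"
  using g_gradient[of f X] one_form_zero[OF g_right] by simp

lemma divergence_times_gradient:
  "f \<in> smooth_fun A \<Longrightarrow> divergence (f \<odot> gradient f) = f * divergence (gradient f) + g (gradient f) (gradient f)"
  by (simp add: divergence_scale g_gradient)

text \<open>In both of the following lemmas the divergence of \<open>f grad f\<close> is a sum of squares.\<close>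

lemma harmonic_imp_gradient_eq_0:
  assumes "compact (UNIV :: 'm set)" "f \<in> smooth_fun A" "divergence (gradient f) = 0"
  shows "gradient f = 0"
proof
  fix p
  have eq: "divergence (f \<odot> gradient f) = g (gradient f) (gradient f)"
    using divergence_times_gradient[OF assms(2)] assms(3) by simp
  have "divergence (f \<odot> gradient f) = 0"
    by (rule divergence_nonneg_imp_eq_0[OF assms(1)]) (use assms(2) g_nonneg eq in auto)
  then show "gradient f p = 0 p" using g_eq_0_iff[of "gradient f" p] eq assms(2) by (simp add: fun_app)
qed

lemma negative_eigenfunction_eq_0:
  assumes "compact (UNIV :: 'm set)" "f \<in> smooth_fun A" "divergence (gradient f) = 2 *\<^sub>R f"
  shows "f = 0"
proof
  fix p
  have eq: "divergence (f \<odot> gradient f) q = 2 * (f q)\<^sup>2 + g (gradient f) (gradient f) q" for q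
    unfolding divergence_times_gradient[OF assms(2)] assms(3)
    by (simp add: fun_app scaleR_fun_def power2_eq_square)
  have "divergence (f \<odot> gradient f) = 0"
    by (rule divergence_nonneg_imp_eq_0[OF assms(1)]) (use assms(2) g_nonneg eq in auto)
  then have "2 * (f p)\<^sup>2 + g (gradient f) (gradient f) p = 0" using eq[of p] by (simp add: fun_app)
  then have "(f p)\<^sup>2 = 0"
    using g_nonneg[OF gradient_closed[OF assms(2)], of p] zero_le_power2[of "f p"] by linarith
  then show "f p = 0 p" by (simp add: fun_app)
qed

text \<open>A locally constant divergence vanishes, since \<open>div (f X) = f\<^sup>2\<close> for \<open>f = div X\<close>.\<close>

lemma constant_divergence_eq_0:
  assumes "compact (UNIV :: 'm set)" "X \<in> vector_fields A" "gradient (divergence X) = 0"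
  shows "divergence X = 0"
proof -
  let ?f = "divergence X"
  have f: "?f \<in> smooth_fun A" using assms(2) by auto
  have eq: "divergence (?f \<odot> X) = ?f * ?f"
    using gradient_eq_0_imp[OF f assms(3,2)] by (simp add: divergence_scale[OF f assms(2)])
  have "divergence (?f \<odot> X) = 0"
    by (rule divergence_nonneg_imp_eq_0[OF assms(1)]) (use f assms(2) eq in \<open>auto simp: fun_app\<close>)
  then show ?thesis using eq by (simp add: fun_eq_iff fun_app)
qed

lemma ricci_flat_divergence_eq_0:
  assumes compact: "compact (UNIV :: 'm set)" and eq: "chern_ricci_eq A \<omega> J g D 0"
    and X: "X \<in> holomorphic_fields A J"
  shows "divergence X = 0" "divergence (J X) = 0"
proof -
  note X' = holomorphicD(1)[OF X]
  have "divergence (gradient (divergence X)) = 0" "divergence (gradient (divergence (J X))) = 0"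
    using holomorphic_decomposition(2,3)[OF eq X] by (simp_all only: mult_zero_right minus_zero scaleR_zero_left)
  then have "gradient (divergence X) = 0" "gradient (divergence (J X)) = 0"
    using harmonic_imp_gradient_eq_0[OF compact] X' by auto
  then show "divergence X = 0" "divergence (J X) = 0"
    using constant_divergence_eq_0[OF compact] X' by auto
qed

subsection \<open>The deformation tensor of a holomorphic field\<close>

text \<open>The strain of \<open>X\<close> is the Lie derivative of the metric (\<open>strain_eq_lie\<close>), written with the
  Levi-Civita connection so that it is visibly a symmetric tensor.\<close>

definition strain :: "'m vfield \<Rightarrow> 'm form2"
  where "strain X Y Z = g (D Y X) Z + g (D Z X) Y"

lemma strain_eq_lie:
  assumes "X \<in> vector_fields A" "Y \<in> vector_fields A" "Z \<in> vector_fields A"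
  shows "lie_bilinear X g Y Z = strain X Y Z"
  using assms g_commute[of Y "D Z X"]
  by (simp add: lie_bilinear_def strain_def D_metric D_torsion g_linear algebra_simps)

lemma strain_bilinear:
  assumes X: "X \<in> vector_fields A" shows "bilinear_field A (strain X)"
  unfolding strain_def[abs_def]
  by (intro bilinear_field_plus divergence_bilinear bilinear_field_flip[OF divergence_bilinear] X)

lemma strain_commute: "strain X Y Z = strain X Z Y"
  by (simp add: strain_def add.commute)

lemma tr_strain: "X \<in> vector_fields A \<Longrightarrow> tr_g (strain X) = 2 *\<^sub>R divergence X"
proof -
  assume X: "X \<in> vector_fields A"
  have "tr_g (strain X) = tr_g (\<lambda>Y Z. 2 *\<^sub>R g (D Y X) Z)"
    by (rule tr_g_cong) (simp add: strain_def scaleR_2)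
  then show ?thesis by (simp only: tr_g_scaleR divergence_def)
qed

text \<open>The exterior derivative of \<open>\<omega>(X, \<cdot>)\<close>, which is the Lie derivative of \<open>\<omega>\<close>.\<close>

definition lie_\<omega> :: "'m vfield \<Rightarrow> 'm form2"
  where "lie_\<omega> X Y Z = g (D Y (J X)) Z - g (D Z (J X)) Y"

lemma ext_d1_eq_lie_\<omega>:
  assumes "X \<in> vector_fields A" "Y \<in> vector_fields A" "Z \<in> vector_fields A"
  shows "ext_d1 (\<omega> X) Y Z = lie_\<omega> X Y Z"
  using assms by (simp add: ext_d1_def lie_\<omega>_def \<omega>_eq D_metric D_torsion g_linear algebra_simps)

lemma lie_\<omega>_bilinear:
  assumes X: "X \<in> vector_fields A" shows "bilinear_field A (lie_\<omega> X)"
  unfolding lie_\<omega>_def[abs_def]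
  by (intro bilinear_field_minus divergence_bilinear bilinear_field_flip[OF divergence_bilinear]
      J_closed X)

lemma lie_\<omega>_skew: "lie_\<omega> X Y Z = - lie_\<omega> X Z Y"
  by (simp add: lie_\<omega>_def)

lemma ext_d2_lie_\<omega>:
  assumes X: "X \<in> vector_fields A" and vf: "Y \<in> vector_fields A" "Z \<in> vector_fields A" "V \<in> vector_fields A"
  shows "ext_d2 (lie_\<omega> X) Y Z V = 0"
proof -
  define \<beta> where "\<beta> = \<omega> X"
  have \<beta>: "one_form A \<beta>" unfolding \<beta>_def by (rule bilinear_fieldD(1)[OF \<omega>_bilinear X])
  have lie: "lie_\<omega> X U V = vf_deriv U (\<beta> V) - vf_deriv V (\<beta> U) - \<beta> (lie_bracket U V)"
    if "U \<in> vector_fields A" "V \<in> vector_fields A" for U V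
    using ext_d1_eq_lie_\<omega>[OF X that] by (simp add: ext_d1_def \<beta>_def)
  have J: "\<beta> (lie_bracket (lie_bracket Y Z) V) = \<beta> (lie_bracket Y (lie_bracket Z V)) - \<beta> (lie_bracket Z (lie_bracket Y V))"
    using Jacobi[OF vf] one_form_diff[OF \<beta>, of "lie_bracket Y (lie_bracket Z V)" "lie_bracket Z (lie_bracket Y V)"] vf
    by (simp add: algebra_simps)
  have skew: "\<beta> (lie_bracket U V) = - \<beta> (lie_bracket V U)" if "U \<in> vector_fields A" "V \<in> vector_fields A" for U V
    using lie_bracket_skew[of U V] one_form_uminus[OF \<beta>, of "lie_bracket V U"] that by simp
  have s: "\<beta> (lie_bracket (lie_bracket Y V) Z) = - \<beta> (lie_bracket Z (lie_bracket Y V))"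
    "\<beta> (lie_bracket (lie_bracket Z V) Y) = - \<beta> (lie_bracket Y (lie_bracket Z V))"
    using skew[of "lie_bracket Y V" Z] skew[of "lie_bracket Z V" Y] vf by auto
  show ?thesis
    unfolding ext_d2_def
    using vf one_form_closed[OF \<beta>]
    by (simp add: lie vf_deriv_fun_diff vf_deriv_fun_add lie_bracket_deriv J s algebra_simps)
qed

text \<open>A field that preserves \<open>J\<close> changes \<open>g = \<omega>(\<cdot>, J\<cdot>)\<close> in the same way as \<open>\<omega>\<close>. Symmetry of the strain then
  makes the Lie derivative of \<open>\<omega>\<close> invariant under \<open>J\<close>.\<close>

lemma strain_eq_lie_\<omega>:
  assumes X: "X \<in> holomorphic_fields A J" and vf: "Y \<in> vector_fields A" "Z \<in> vector_fields A"
  shows "strain X Y Z = lie_\<omega> X Y (J Z)"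
proof -
  note X' = holomorphicD(1)[OF X]
  have "D (J Z) X = D X (J Z) - J (lie_bracket X Z)"
    using holomorphicD(2)[OF X vf(2)] X' vf by (simp add: D_torsion algebra_simps)
  then have hol: "D (J Z) X = J (D Z X) + DJ X Z"
    using X' vf by (simp add: D_torsion J_diff cov_endo_def)
  have DJX: "D U (J X) = DJ U X + J (D U X)" for U by (simp add: cov_endo_def)
  have "lie_\<omega> X Y (J Z) = g (DJ Y X) (J Z) + g (D Y X) Z - g (DJ (J Z) X) Y + g (D Z X) Y - g (J (DJ X Z)) Y"
    unfolding lie_\<omega>_def DJX hol using X' vf
    by (simp add: g_linear g_J_J J_add g_scale algebra_simps)
  moreover have "g (J (DJ X Z)) Y = - g (DJ X (J Z)) Y"
    using X' vf by (simp add: DJ_J g_scale)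
  moreover have "g (DJ Y X) (J Z) - g (DJ (J Z) X) Y + g (DJ X (J Z)) Y = 0"
    using DJ_cyclic[of Y X "J Z"] DJ_skew[of "J Z" X Y] X' vf by (simp add: algebra_simps)
  ultimately show ?thesis
    by (simp add: strain_def fun_eq_iff fun_app algebra_simps)
qed

lemma lie_\<omega>_J_J:
  assumes X: "X \<in> holomorphic_fields A J" and vf: "Y \<in> vector_fields A" "Z \<in> vector_fields A"
  shows "lie_\<omega> X (J Y) (J Z) = lie_\<omega> X Y Z"
proof -
  note X' = holomorphicD(1)[OF X]
  have "lie_\<omega> X (J Y) (J Z) = strain X Z (J Y)"
    using strain_eq_lie_\<omega>[OF X, of "J Y" Z] strain_commute[of X "J Y" Z] vf by simp
  also have "\<dots> = lie_\<omega> X Z (- Y)" using strain_eq_lie_\<omega>[OF X, of Z "J Y"] vf by simp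
  also have "\<dots> = lie_\<omega> X Y Z"
    using one_form_uminus[OF bilinear_fieldD(1)[OF lie_\<omega>_bilinear[OF X'] vf(2)] vf(1)]
      lie_\<omega>_skew[of X Z Y] by simp
  finally show ?thesis .
qed

subsection \<open>Volume-preserving holomorphic fields are Killing\<close>

lemma cov_form2_bilinear:
  assumes \<psi>: "bilinear_field A \<psi>" and X: "X \<in> vector_fields A"
  shows "bilinear_field A (cov_form2 D X \<psi>)"
    and "bilinear_field A (\<lambda>Y. cov_form2 D Y \<psi> X)"
proof -
  note l = one_formD[OF bilinear_fieldD(1)[OF \<psi>]] and r = one_formD[OF bilinear_fieldD(2)[OF \<psi>]]
  show "bilinear_field A (cov_form2 D X \<psi>)"
    by (intro bilinear_fieldI one_formI)
      (use X in \<open>simp_all add: cov_form2_def l r vf_deriv_fun_add vf_deriv_fun_mult D_add D_scale algebra_simps\<close>)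
  show "bilinear_field A (\<lambda>Y. cov_form2 D Y \<psi> X)"
    by (intro bilinear_fieldI one_formI)
      (use X in \<open>simp_all add: cov_form2_def l r vf_deriv_fun_add vf_deriv_fun_mult D_add D_scale D_left algebra_simps\<close>)
qed

lemma tr_cov_form2:
  assumes \<psi>: "bilinear_field A \<psi>" and X: "X \<in> vector_fields A"
  shows "tr_g (cov_form2 D X \<psi>) = vf_deriv X (tr_g \<psi>)"
proof
  fix p
  obtain E W where E: "p \<in> W" "orthonormal_frame A g W E" by (rule orthonormal_frame_exists)
  have "vf_deriv X (tr_g \<psi>) p = (\<Sum>i<DIM('e). cov_form2 D X \<psi> (E i) (E i) p)"
    unfolding cov_form2_def by (rule vf_deriv_tr_g[OF E(2,1) \<psi> X D_closed[OF X] D_metric[OF X]])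
  then show "tr_g (cov_form2 D X \<psi>) p = vf_deriv X (tr_g \<psi>) p"
    using tr_g_eq[OF cov_form2_bilinear(1)[OF \<psi> X] orthonormal_frame_onb_at[OF E(2,1)]] by simp
qed

text \<open>For a closed \<open>J\<close>-invariant form \<open>\<phi>\<close> the divergence of \<open>h = \<phi>(\<cdot>, J\<cdot>)\<close> is half the differential of
  its trace. So a closed primitive form of type \<open>(1,1)\<close> is divergence-free.\<close>

lemma divergence_strain:
  assumes X: "X \<in> holomorphic_fields A J" and div: "divergence X = 0" and V: "V \<in> vector_fields A"
  shows "tr_g (\<lambda>Y Z. cov_form2 D Y (strain X) V Z) = 0"
proof -
  note X' = holomorphicD(1)[OF X]
  let ?\<phi> = "lie_\<omega> X" and ?h = "strain X"
  note \<phi> = lie_\<omega>_bilinear[OF X'] and h = strain_bilinear[OF X']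
  have cov: "cov_form2 D U ?h Y Z = cov_form2 D U ?\<phi> Y (J Z) + ?\<phi> Y (DJ U Z)"
    if "U \<in> vector_fields A" "Y \<in> vector_fields A" "Z \<in> vector_fields A" for U Y Z
    using that one_form_diff[OF bilinear_fieldD(1)[OF \<phi> that(2)]]
    by (simp add: cov_form2_def strain_eq_lie_\<omega>[OF X] cov_endo_def algebra_simps)
  have cov_skew: "cov_form2 D U ?\<phi> Y Z = - cov_form2 D U ?\<phi> Z Y"
    if "U \<in> vector_fields A" "Y \<in> vector_fields A" "Z \<in> vector_fields A" for U Y Z
    using that one_form_closed[OF bilinear_fieldD(1)[OF \<phi> that(3)] that(2)]
      lie_\<omega>_skew[of X Y Z] lie_\<omega>_skew[of X "D U Y" Z] lie_\<omega>_skew[of X Y "D U Z"]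
    by (simp add: cov_form2_def vf_deriv_fun_uminus)
  \<comment> \<open>The trace of \<open>d\<phi> = 0\<close> against \<open>J\<close> shows that the trace of \<open>D\<^sub>V \<phi>\<close> against \<open>J\<close> is \<open>2 t\<close>.\<close>
  define t where "t = tr_g (\<lambda>Y Z. cov_form2 D Y ?\<phi> V (J Z))"
  have key: "cov_form2 D V ?\<phi> Y (J Y) = cov_form2 D Y ?\<phi> V (J Y) - cov_form2 D (J Y) ?\<phi> V Y"
    if Y: "Y \<in> vector_fields A" for Y
    using ext_d2_eq_cov[OF \<phi> lie_\<omega>_skew V Y J_closed[OF Y]] ext_d2_lie_\<omega>[OF X' V Y J_closed[OF Y]]
      cov_skew[of Y "J Y" V] Y V
    by (simp add: algebra_simps)
  have "tr_g (\<lambda>Y Z. cov_form2 D V ?\<phi> Y (J Z))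
      = tr_g (\<lambda>Y Z. cov_form2 D Y ?\<phi> V (J Z) - cov_form2 D (J Y) ?\<phi> V Z)"
    by (rule tr_g_cong) (rule key)
  also have "\<dots> = t - tr_g (\<lambda>Y Z. cov_form2 D (J Y) ?\<phi> V Z)"
    by (simp add: tr_g_diff t_def)
  also have "tr_g (\<lambda>Y Z. cov_form2 D (J Y) ?\<phi> V Z) = - t"
    unfolding t_def by (rule tr_g_J_right[OF cov_form2_bilinear(2)[OF \<phi> V]])
  finally have 1: "tr_g (\<lambda>Y Z. cov_form2 D V ?\<phi> Y (J Z)) = t + t" by simp
  have "tr_g (cov_form2 D V ?h) = tr_g (\<lambda>Y Z. cov_form2 D V ?\<phi> Y (J Z) + ?\<phi> Y (DJ V Z))"
    by (rule tr_g_cong) (rule cov[OF V])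
  also have "\<dots> = t + t + tr_g (\<lambda>Y Z. ?\<phi> Y (DJ V Z))" by (simp add: tr_g_add 1)
  also have "tr_g (\<lambda>Y Z. ?\<phi> Y (DJ V Z)) = 0"
  proof (rule tr_g_J_anti[OF bilinear_field_compose[OF \<phi> endo_field_id DJ_endo_right[OF V]]])
    fix Y assume Y: "Y \<in> vector_fields A"
    show "?\<phi> (J Y) (DJ V (J Y)) = - ?\<phi> Y (DJ V Y)"
      using Y V lie_\<omega>_J_J[OF X Y, of "DJ V Y"]
        one_form_uminus[OF bilinear_fieldD(1)[OF \<phi> J_closed[OF Y]], of "J (DJ V Y)"]
      by (simp add: DJ_J)
  qed
  also have "tr_g (cov_form2 D V ?h) = 0"
    unfolding tr_cov_form2[OF h V] tr_strain[OF X'] div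
    using vf_deriv_fun_zero[OF V] by simp
  finally have "t = 0" by (simp add: fun_eq_iff fun_app)
  have "tr_g (\<lambda>Y Z. cov_form2 D Y ?h V Z) = tr_g (\<lambda>Y Z. cov_form2 D Y ?\<phi> V (J Z) + ?\<phi> V (DJ Y Z))"
    by (rule tr_g_cong) (rule cov[OF _ V])
  also have "\<dots> = t + tr_g (\<lambda>Y Z. ?\<phi> V (DJ Y Z))" by (simp add: tr_g_add t_def)
  also have "tr_g (\<lambda>Y Z. ?\<phi> V (DJ Y Z)) = 0"
  proof (rule tr_g_J_anti)
    show "bilinear_field A (\<lambda>Y Z. ?\<phi> V (DJ Y Z))"
      using one_form_compose[OF bilinear_fieldD(1)[OF \<phi> V] DJ_endo_right]
        one_form_compose[OF bilinear_fieldD(1)[OF \<phi> V] DJ_endo_left]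
      by (intro bilinear_fieldI)
    fix Y assume Y: "Y \<in> vector_fields A"
    show "?\<phi> V (DJ (J Y) (J Y)) = - ?\<phi> V (DJ Y Y)"
      using Y V one_form_uminus[OF bilinear_fieldD(1)[OF \<phi> V], of "DJ Y Y"]
      by (simp add: DJ_J_left DJ_uminus)
  qed
  finally show ?thesis using \<open>t = 0\<close> by simp
qed

text \<open>Integration by parts: the strain \<open>h\<close> is divergence-free, so the divergence of the field dual to
  \<open>h(X, \<cdot>)\<close> is \<open>\<Sum>i. h(D\<^sub>i X, E i)\<close>, and this is half the squared norm of \<open>h\<close>.\<close>

lemma divergence_free_holomorphic_strain_eq_0:
  assumes compact: "compact (UNIV :: 'm set)"
    and X: "X \<in> holomorphic_fields A J" and div: "divergence X = 0"
    and YZ: "Y \<in> vector_fields A" "Z \<in> vector_fields A"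
  shows "strain X Y Z = 0"
proof
  fix p
  note X' = holomorphicD(1)[OF X]
  let ?h = "strain X" and ?I = "{..<DIM('e)}"
  note h = strain_bilinear[OF X']
  define W where "W = raise (?h X)"
  have hX: "one_form A (?h X)" by (rule bilinear_fieldD(1)[OF h X'])
  have W: "W \<in> vector_fields A" unfolding W_def using hX by auto
  have "divergence W = tr_g (\<lambda>Y Z. cov_form2 D Y ?h X Z + ?h (D Y X) Z)"
    unfolding divergence_def
  proof (rule tr_g_cong)
    fix Y assume Y: "Y \<in> vector_fields A"
    have "g W (D Y Y) = ?h X (D Y Y)" "g W Y = ?h X Y"
      unfolding W_def using Y by (simp_all add: g_raise[OF hX])
    then show "g (D Y W) Y = cov_form2 D Y ?h X Y + ?h (D Y X) Y"
      using D_metric[OF Y W Y] by (simp add: cov_form2_def algebra_simps)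
  qed
  then have divW: "divergence W = tr_g (\<lambda>Y Z. ?h (D Y X) Z)"
    by (simp add: tr_g_add divergence_strain[OF X div X'])
  have norm: "2 * divergence W q = (\<Sum>i\<in>?I. \<Sum>j\<in>?I. (?h (E i) (E j) q)\<^sup>2)" if E: "onb_at g q E" for q E
  proof -
    have vf: "E i \<in> vector_fields A" if "i \<in> ?I" for i using onb_at_vf[OF E] that by simp
    define a where "a i j = g (D (E i) X) (E j) q" for i j
    have hij: "?h (E i) (E j) q = a i j + a j i" for i j by (simp add: strain_def a_def fun_app)
    have "divergence W q = (\<Sum>i\<in>?I. ?h (D (E i) X) (E i) q)"
      unfolding divW by (rule tr_g_eq[OF bilinear_field_compose[OF h D_endo[OF X'] endo_field_id] E])
    also have "\<dots> = (\<Sum>i\<in>?I. \<Sum>j\<in>?I. a i j * (a i j + a j i))"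
    proof (intro sum.cong refl)
      fix i assume i: "i \<in> ?I"
      have "?h (D (E i) X) (E i) q = (\<Sum>j\<in>?I. a i j * ?h (E j) (E i) q)"
        unfolding a_def by (rule onb_expansion[OF E bilinear_fieldD(2)[OF h vf[OF i]]]) (use vf[OF i] X' in auto)
      then show "?h (D (E i) X) (E i) q = (\<Sum>j\<in>?I. a i j * (a i j + a j i))"
        by (simp add: hij add.commute)
    qed
    finally have 1: "divergence W q = (\<Sum>i\<in>?I. \<Sum>j\<in>?I. a i j * (a i j + a j i))" .
    also have "\<dots> = (\<Sum>i\<in>?I. \<Sum>j\<in>?I. a j i * (a j i + a i j))" by (rule sum.swap)
    finally have "2 * divergence W q = (\<Sum>i\<in>?I. \<Sum>j\<in>?I. a i j * (a i j + a j i) + a j i * (a j i + a i j))"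
      using 1 by (simp add: sum.distrib)
    then show ?thesis by (simp add: hij power2_eq_square algebra_simps)
  qed
  have "divergence W q \<ge> 0" for q
  proof -
    have "0 \<le> (\<Sum>i\<in>?I. \<Sum>j\<in>?I. (?h ((SOME E. onb_at g q E) i) ((SOME E. onb_at g q E) j) q)\<^sup>2)"
      by (intro sum_nonneg) simp
    then show ?thesis using norm[OF onb_at_some, of q] by simp
  qed
  then have "divergence W = 0" by (rule divergence_nonneg_imp_eq_0[OF compact W])
  let ?E = "SOME E. onb_at g p E"
  have E: "onb_at g p ?E" by (rule onb_at_some)
  have "(\<Sum>i\<in>?I. \<Sum>j\<in>?I. (?h (?E i) (?E j) p)\<^sup>2) = 0"
    using norm[OF E] \<open>divergence W = 0\<close> by (simp add: fun_app)
  then have h0: "?h (?E i) (?E j) p = 0" if "i \<in> ?I" "j \<in> ?I" for i j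
    using that by (simp add: sum_nonneg_eq_0_iff sum_nonneg)
  have "?h (?E i) Z p = 0" if "i \<in> ?I" for i
    using onb_expansion[OF E bilinear_fieldD(1)[OF h onb_at_vf[OF E]] YZ(2), of i] h0 that by simp
  then show "?h Y Z p = 0 p"
    using onb_expansion[OF E bilinear_fieldD(2)[OF h YZ(2)] YZ(1)] by (simp add: fun_app)
qed

end

section \<open>The three cases\<close>

context almost_kaehler_manifold
begin

lemma ricci_flat_strain_eq_0:
  assumes "compact (UNIV :: 'm set)" "chern_ricci_eq A \<omega> J g D 0" "X \<in> holomorphic_fields A J"
    "Y \<in> vector_fields A" "Z \<in> vector_fields A"
  shows "strain X Y Z = 0"
  by (rule divergence_free_holomorphic_strain_eq_0[OF assms(1,3) ricci_flat_divergence_eq_0(1)[OF assms(1-3)] assms(4,5)])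

lemma ricci_flat_lie_\<omega>_eq_0:
  assumes "compact (UNIV :: 'm set)" "chern_ricci_eq A \<omega> J g D 0" "X \<in> holomorphic_fields A J"
    and YZ: "Y \<in> vector_fields A" "Z \<in> vector_fields A"
  shows "lie_\<omega> X Y Z = 0"
proof -
  note X' = holomorphicD(1)[OF assms(3)]
  have "lie_\<omega> X Y (- Z) = 0"
    using strain_eq_lie_\<omega>[OF assms(3), of Y "J Z"] ricci_flat_strain_eq_0[OF assms(1-3), of Y "J Z"] YZ by simp
  then show ?thesis
    using one_form_uminus[OF bilinear_fieldD(1)[OF lie_\<omega>_bilinear[OF X'] YZ(1)] YZ(2)] by simp
qed

theorem ricci_flat_killing:
  assumes "compact (UNIV :: 'm set)" "chern_ricci_eq A \<omega> J g D 0" "X \<in> holomorphic_fields A J"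
  shows "X \<in> killing_fields A g"
  using holomorphicD(1)[OF assms(3)] ricci_flat_strain_eq_0[OF assms]
  by (simp add: killing_fields_def strain_eq_lie)

text \<open>The bracket of two symplectic fields \<open>X\<close>, \<open>Y\<close> is Hamiltonian with potential \<open>\<omega>(X,Y)\<close>; in the
  Ricci-flat case this potential is harmonic.\<close>

theorem ricci_flat_abelian:
  assumes compact: "compact (UNIV :: 'm set)" and eq: "chern_ricci_eq A \<omega> J g D 0"
    and X: "X \<in> holomorphic_fields A J" and Y: "Y \<in> holomorphic_fields A J"
  shows "lie_bracket X Y = 0"
proof -
  note X' = holomorphicD(1)[OF X] and Y' = holomorphicD(1)[OF Y]
  define f where "f = \<omega> X Y"
  have f: "f \<in> smooth_fun A"
    unfolding f_def by (rule one_form_closed[OF bilinear_fieldD(1)[OF \<omega>_bilinear X'] Y'])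
  let ?V = "lie_bracket X Y"
  have V: "?V \<in> vector_fields A" using X' Y' by auto
  have ham: "g (J ?V) Z = - vf_deriv Z f" if Z: "Z \<in> vector_fields A" for Z
  proof -
    have f': "\<omega> Y X = - f" using \<omega>_skew[OF Y' X'] by (simp add: f_def)
    have 1: "vf_deriv Y (\<omega> X Z) - vf_deriv Z f - \<omega> X (lie_bracket Y Z) = 0"
      using ext_d1_eq_lie_\<omega>[OF X' Y' Z] ricci_flat_lie_\<omega>_eq_0[OF compact eq X Y' Z]
      by (simp add: ext_d1_def f_def)
    have 2: "vf_deriv X (\<omega> Y Z) + vf_deriv Z f - \<omega> Y (lie_bracket X Z) = 0"
      using ext_d1_eq_lie_\<omega>[OF Y' X' Z] ricci_flat_lie_\<omega>_eq_0[OF compact eq Y X' Z] Z f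
      by (simp add: ext_d1_def f' vf_deriv_fun_uminus)
    have 3: "vf_deriv X (\<omega> Y Z) - vf_deriv Y (\<omega> X Z) + vf_deriv Z f
        - \<omega> ?V Z - \<omega> Y (lie_bracket X Z) + \<omega> X (lie_bracket Y Z) = 0"
      using \<omega>_closed[OF X' Y' Z] \<omega>_skew[of "lie_bracket X Z" Y] \<omega>_skew[of "lie_bracket Y Z" X] X' Y' Z
      by (simp add: ext_d2_def f_def)
    have "\<omega> ?V Z p = - vf_deriv Z f p" for p
      using fun_cong[OF 1, of p] fun_cong[OF 2, of p] fun_cong[OF 3, of p]
      by (simp add: fun_app)
    then show ?thesis using V Z by (simp add: \<omega>_eq fun_eq_iff fun_app)
  qed
  have JV: "J ?V = - gradient f"
    by (rule vf_eq_via_g) (use V f ham in \<open>auto simp: g_scale g_gradient\<close>)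
  have "divergence (J ?V) = 0"
    by (rule ricci_flat_divergence_eq_0(2)[OF compact eq holomorphic_bracket[OF X Y]])
  then have "divergence (gradient f) = 0"
    using f by (simp add: JV divergence_uminus)
  then have "gradient f = 0" by (rule harmonic_imp_gradient_eq_0[OF compact f])
  then have "J (J ?V) = J 0" using JV by simp
  then show ?thesis using V by (simp add: J_zero)
qed

lemma codiff2_eq_0:
  assumes "\<And>U V. U \<in> vector_fields A \<Longrightarrow> V \<in> vector_fields A \<Longrightarrow> \<psi> U V = 0" "Y \<in> vector_fields A"
  shows "codiff2 A g D \<psi> Y = 0"
proof
  fix p
  let ?E = "SOME E. \<exists>W. p \<in> W \<and> orthonormal_frame A g W E"
  obtain E W where "p \<in> W" "orthonormal_frame A g W E" by (rule orthonormal_frame_exists)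
  then have "\<exists>W. p \<in> W \<and> orthonormal_frame A g W ?E"
    using someI[of "\<lambda>E. \<exists>W. p \<in> W \<and> orthonormal_frame A g W E" E] by blast
  then have "onb_at g p ?E" using orthonormal_frame_onb_at by blast
  then have E: "?E i \<in> vector_fields A" if "i < DIM('e)" for i using onb_at_vf that by blast
  have "cov_form2 D (?E i) \<psi> (?E i) Y = 0" if "i < DIM('e)" for i
    using E[OF that] assms by (simp add: cov_form2_def vf_deriv_fun_zero)
  then show "codiff2 A g D \<psi> Y p = 0 p"
    by (simp add: codiff2_def Let_def fun_app)
qed

theorem ricci_flat_twisted_harmonic:
  assumes compact: "compact (UNIV :: 'm set)" and eq: "chern_ricci_eq A \<omega> J g D 0"
    and X: "X \<in> holomorphic_fields A J" and Y: "Y \<in> vector_fields A"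
  shows "twisted_laplacian1 A J g D (flat g X) Y = 0"
proof -
  note X' = holomorphicD(1)[OF X]
  define \<gamma> where "\<gamma> = J_form_inv J (flat g X)"
  have \<gamma>: "\<gamma> Z = g X (J Z)" for Z by (simp add: \<gamma>_def J_form_inv_def flat_def)
  have \<gamma>_form: "one_form A \<gamma>"
    using one_form_compose[OF g_left[OF X'] J_endo] by (simp add: \<gamma>[symmetric])
  have "ext_d1 \<gamma> U V = 0" if UV: "U \<in> vector_fields A" "V \<in> vector_fields A" for U V
  proof -
    have \<gamma>\<omega>: "\<gamma> Z = - \<omega> X Z" if "Z \<in> vector_fields A" for Z
      using that X' by (simp add: \<gamma> \<omega>_eq g_J)
    have "\<omega> X Z \<in> smooth_fun A" if "Z \<in> vector_fields A" for Z
      using one_form_closed[OF bilinear_fieldD(1)[OF \<omega>_bilinear X'] that] .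
    then have "ext_d1 \<gamma> U V = - ext_d1 (\<omega> X) U V"
      using UV by (simp add: ext_d1_def \<gamma>\<omega> vf_deriv_fun_uminus)
    then show ?thesis
      using ext_d1_eq_lie_\<omega>[OF X' UV] ricci_flat_lie_\<omega>_eq_0[OF compact eq X UV] by simp
  qed
  then have 1: "codiff2 A g D (ext_d1 \<gamma>) (- J Y) = 0"
    by (rule codiff2_eq_0) (use Y in auto)
  have "codiff1 A g D \<gamma> = - divergence (- J X)"
    by (rule codiff1_eq_divergence[OF \<gamma>_form]) (use X' in \<open>auto simp: \<gamma> g_scale g_J\<close>)
  then have "codiff1 A g D \<gamma> = 0"
    using X' by (simp add: divergence_uminus ricci_flat_divergence_eq_0[OF compact eq X])
  then have 2: "ext_d0 (codiff1 A g D \<gamma>) (- J Y) = 0"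
    using Y by (simp add: ext_d0_def vf_deriv_fun_zero)
  show ?thesis
    unfolding twisted_laplacian1_def J_form_def \<gamma>_def[symmetric] laplacian1_def
    by (simp only: plus_fun_apply[where x = "- J Y"] 1 2 add_0_left)
qed

theorem negative_einstein_no_holomorphic:
  assumes compact: "compact (UNIV :: 'm set)" and eq: "chern_ricci_eq A \<omega> J g D (-1)"
    and X: "X \<in> holomorphic_fields A J"
  shows "X = 0"
proof -
  note X' = holomorphicD(1)[OF X] and dec = holomorphic_decomposition[OF eq X]
  have "divergence X = 0" "divergence (J X) = 0"
    using negative_eigenfunction_eq_0[OF compact] dec(2,3) X' by auto
  then show ?thesis using dec(1) by (simp add: J_zero gradient_zero)
qed

text \<open>In the positive case the two potentials are half the codifferentials of \<open>\<alpha>\<close> and of \<open>J\<^sup>-\<^sup>1 \<alpha>\<close>.\<close>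

context
  fixes X u h
  assumes eq: "chern_ricci_eq A \<omega> J g D 1" and X: "X \<in> holomorphic_fields A J"
  defines "u \<equiv> (1/2) *\<^sub>R divergence (J X)" and "h \<equiv> - (1/2) *\<^sub>R divergence X"
begin

lemma potentials_smooth: "u \<in> smooth_fun A" "h \<in> smooth_fun A"
  using holomorphicD(1)[OF X] by (auto simp: u_def h_def)

lemma potentials_decomposition: "X = J (gradient u) + gradient h"
proof -
  note X' = holomorphicD(1)[OF X]
  have "2 *\<^sub>R X = J (gradient (divergence (J X))) - gradient (divergence X)"
    using holomorphic_decomposition(1)[OF eq X] by simp
  then have "(1/2) *\<^sub>R (2 *\<^sub>R X) = (1/2) *\<^sub>R (J (gradient (divergence (J X))) - gradient (divergence X))"
    by simp
  then show ?thesis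
    using X' unfolding u_def h_def by (simp add: gradient_scaleR gradient_uminus J_scaleR scaleR_right_diff_distrib)
qed

lemma potentials_laplacian: "laplacian0 A g D u = 2 *\<^sub>R u" "laplacian0 A g D h = 2 *\<^sub>R h"
proof -
  note X' = holomorphicD(1)[OF X]
  have d: "divergence (gradient (divergence X)) = - 2 *\<^sub>R divergence X"
    "divergence (gradient (divergence (J X))) = - 2 *\<^sub>R divergence (J X)"
    using holomorphic_decomposition(2,3)[OF eq X] by simp_all
  show "laplacian0 A g D u = 2 *\<^sub>R u"
    unfolding laplacian0_eq[OF potentials_smooth(1)]
    using X' by (simp add: u_def gradient_scaleR divergence_scaleR d(2))
  show "laplacian0 A g D h = 2 *\<^sub>R h"
    unfolding laplacian0_eq[OF potentials_smooth(2)]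
    using X' by (simp add: h_def gradient_scaleR gradient_uminus divergence_uminus divergence_scaleR d(1))
qed

lemma potentials_flat:
  assumes Y: "Y \<in> vector_fields A" shows "flat g X Y = dc J u Y + ext_d0 h Y"
proof -
  have "g X Y = g (J (gradient u)) Y + g (gradient h) Y"
    using arg_cong[OF potentials_decomposition, of "\<lambda>X. g X Y"] potentials_smooth Y by (simp add: g_linear)
  then show ?thesis
    using potentials_smooth Y by (simp add: flat_def dc_def J_form_def ext_d0_def g_J g_gradient)
qed

text \<open>\<open>d d\<^sup>c h = d(\<omega>(X, \<cdot>))\<close> is \<open>J\<close>-invariant. Its \<open>J\<close>-anti-invariant part is \<open>D\<omega>\<close> in the direction of the
  gradient, because the Hessian contributes an invariant form.\<close>

lemma gradient_preserves_\<omega>: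
  assumes YZ: "Y \<in> vector_fields A" "Z \<in> vector_fields A"
  shows "cov_form2 D (sharp A g (ext_d0 h)) \<omega> Y Z = 0"
proof -
  note X' = holomorphicD(1)[OF X]
  let ?F = "gradient h"
  have F: "?F \<in> vector_fields A" using potentials_smooth by auto
  have DJF: "D U (J ?F) = DJ U ?F + J (D U ?F)" for U by (simp add: cov_endo_def)
  have lie: "lie_\<omega> X Y Z = g (DJ ?F Y) Z + (g (J (D Y ?F)) Z - g (J (D Z ?F)) Y)"
    if YZ: "Y \<in> vector_fields A" "Z \<in> vector_fields A" for Y Z
  proof -
    have "J X = - gradient u + J ?F"
      using arg_cong[OF potentials_decomposition, of J] potentials_smooth by (simp add: J_add)
    then have "D U (J X) = - D U (gradient u) + (DJ U ?F + J (D U ?F))" if "U \<in> vector_fields A" for U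
      using that F potentials_smooth by (simp add: D_diff DJF)
    then have "lie_\<omega> X Y Z = g (DJ Y ?F) Z - g (DJ Z ?F) Y + (g (J (D Y ?F)) Z - g (J (D Z ?F)) Y)"
      using YZ F potentials_smooth hessian_symmetric[OF potentials_smooth(1) YZ]
      by (simp add: lie_\<omega>_def g_linear g_scale)
    moreover have "g (DJ Y ?F) Z - g (DJ Z ?F) Y = g (DJ ?F Y) Z"
      using DJ_cyclic[OF YZ F] DJ_skew[OF YZ(1) F YZ(2)] DJ_skew[OF F YZ]
      by (simp add: algebra_simps)
    ultimately show ?thesis by simp
  qed
  have inv: "g (J (D (J Y) ?F)) (J Z) - g (J (D (J Z) ?F)) (J Y) = g (J (D Y ?F)) Z - g (J (D Z ?F)) Y"
    using YZ F hessian_symmetric[OF potentials_smooth(2), of "J Y" Z]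
      hessian_symmetric[OF potentials_smooth(2), of "J Z" Y]
    by (simp add: g_J_J g_J g_scale)
  have "g (DJ ?F (J Y)) (J Z) = - g (DJ ?F Y) Z"
    using YZ F by (simp add: DJ_J_right g_scale)
  moreover have "g (DJ ?F (J Y)) (J Z) = g (DJ ?F Y) Z"
    using lie[of "J Y" "J Z"] lie[OF YZ] lie_\<omega>_J_J[OF X YZ] inv YZ by simp
  ultimately have "g (DJ ?F Y) Z = 0" by (simp add: fun_eq_iff fun_app)
  then show ?thesis
    using cov_\<omega>[OF F YZ] sharp_eq_raise[OF ext_d0_one_form[OF potentials_smooth(2)]]
    by (simp add: gradient_def)
qed

lemma potentials_zero:
  assumes "u = 0" "h = 0" shows "X = 0"
proof -
  show ?thesis using potentials_decomposition assms by (simp add: J_zero gradient_zero)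
qed

lemma killing_imp_hamiltonian:
  assumes "X \<in> killing_fields A g" shows "X \<in> hamiltonian_fields A \<omega>"
proof -
  note X' = holomorphicD(1)[OF X]
  have "2 *\<^sub>R divergence X = 0"
    unfolding tr_strain[OF X', symmetric]
  proof -
    have "tr_g (strain X) = tr_g (\<lambda>_ _. 0)"
      by (rule tr_g_cong)
        (use assms strain_eq_lie[OF X'] in \<open>simp add: killing_fields_def\<close>)
    also have "\<dots> = 0" by (simp add: tr_g_def fun_eq_iff fun_app)
    finally show "tr_g (strain X) = 0" .
  qed
  then have "divergence X = 0" by (simp only: scaleR_eq_0_iff) simp
  then have "h = 0" by (simp add: h_def)
  have "\<omega> X Y = - ext_d0 u Y" if Y: "Y \<in> vector_fields A" for Y
  proof -
    have "\<omega> X Y = - flat g X (J Y)" using X' Y by (simp add: \<omega>_eq g_J flat_def)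
    also have "\<dots> = - ext_d0 u Y"
      using potentials_flat[OF J_closed[OF Y]] Y
      by (simp add: \<open>h = 0\<close> dc_def J_form_def ext_d0_def vf_deriv_fun_zero)
    finally show ?thesis .
  qed
  then show ?thesis using X' potentials_smooth(1) by (auto simp: hamiltonian_fields_def)
qed

end

end

theorem corollary19:
  fixes A :: "('m::{t2_space, second_countable_topology}, 'e::euclidean_space) chart set"
    and \<omega> g :: "'m form2"
    and J :: "'m vfield \<Rightarrow> 'm vfield"
    and D :: "'m connection"
    and n :: nat
  assumes "smooth_atlas A"
    and "DIM('e) = 2 * n"
    and "compact (UNIV :: 'm set)"
    and "almost_kaehler A \<omega> J g"
    and "levi_civita A g D"
    and "first_chern_einstein A \<omega> J g D"
  shows
    "(chern_ricci_eq A \<omega> J g D 0 \<longrightarrow>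
        holomorphic_fields A J \<subseteq> killing_fields A g \<and>
        (\<forall>X\<in>holomorphic_fields A J. \<forall>Y\<in>holomorphic_fields A J. lie_bracket X Y = 0) \<and>
        (\<forall>X\<in>holomorphic_fields A J. \<forall>Y\<in>vector_fields A.
           twisted_laplacian1 A J g D (flat g X) Y = 0)) \<and>
     (chern_ricci_eq A \<omega> J g D (-1) \<longrightarrow> (\<forall>X\<in>holomorphic_fields A J. X = 0)) \<and>
     (chern_ricci_eq A \<omega> J g D 1 \<longrightarrow>
        (\<forall>X\<in>holomorphic_fields A J. \<exists>u\<in>smooth_fun A. \<exists>h\<in>smooth_fun A.
           (\<forall>Y\<in>vector_fields A. flat g X Y = dc J u Y + ext_d0 h Y) \<and>
           laplacian0 A g D u = 2 *\<^sub>R u \<and>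
           laplacian0 A g D h = 2 *\<^sub>R h \<and>
           (\<forall>Y\<in>vector_fields A. \<forall>Z\<in>vector_fields A.
              cov_form2 D (sharp A g (ext_d0 h)) \<omega> Y Z = 0)) \<and>
        (\<not> eigenvalue0 A g D 2 \<longrightarrow> (\<forall>X\<in>holomorphic_fields A J. X = 0)) \<and>
        (\<forall>X\<in>holomorphic_fields A J. X \<in> killing_fields A g \<longrightarrow> X \<in> hamiltonian_fields A \<omega>))"
proof -
  interpret smooth_manifold A by unfold_locales (rule assms(1))
  have J: "almost_complex_structure A J" and \<omega>: "\<And>X Y. X \<in> vector_fields A \<Longrightarrow> Y \<in> vector_fields A \<Longrightarrow> \<omega> (J X) (J Y) = \<omega> X Y"
    and g: "\<And>X Y. X \<in> vector_fields A \<Longrightarrow> Y \<in> vector_fields A \<Longrightarrow> g X Y = \<omega> X (J Y)"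
    and metric: "riemannian_metric A g"
    using assms(4) by (auto simp: almost_kaehler_def)
  interpret almost_kaehler_manifold A g J n D \<omega>
  proof unfold_locales
    show "endo_field A J" "X \<in> vector_fields A \<Longrightarrow> J (J X) = - X" for X
      using J by (auto simp: almost_complex_structure_def)
    then show "g (J X) (J Y) = g X Y" if "X \<in> vector_fields A" "Y \<in> vector_fields A" for X Y
      using that \<omega>[of X "J Y"] g[of "J X" "J Y"] g[of X Y] endo_fieldD(1)[of J] by simp
  qed (use assms metric in auto)
  have potentials: "\<exists>u\<in>smooth_fun A. \<exists>h\<in>smooth_fun A.
      (\<forall>Y\<in>vector_fields A. flat g X Y = dc J u Y + ext_d0 h Y) \<and>
      laplacian0 A g D u = 2 *\<^sub>R u \<and> laplacian0 A g D h = 2 *\<^sub>R h \<and>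
      (\<forall>Y\<in>vector_fields A. \<forall>Z\<in>vector_fields A. cov_form2 D (sharp A g (ext_d0 h)) \<omega> Y Z = 0)"
    if "chern_ricci_eq A \<omega> J g D 1" "X \<in> holomorphic_fields A J" for X
    using potentials_smooth[OF that] potentials_flat[OF that] potentials_laplacian[OF that]
      gradient_preserves_\<omega>[OF that] by blast
  have no_eigenvalue: "X = 0"
    if "chern_ricci_eq A \<omega> J g D 1" "\<not> eigenvalue0 A g D 2" "X \<in> holomorphic_fields A J" for X
    using potentials_zero[OF that(1,3)] potentials_smooth[OF that(1,3)] potentials_laplacian[OF that(1,3)]
      that(2) unfolding eigenvalue0_def by blast
  show ?thesis
  proof (intro conjI impI ballI subsetI)
    fix X assume X: "chern_ricci_eq A \<omega> J g D 0" "X \<in> holomorphic_fields A J"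
    show "X \<in> killing_fields A g" by (rule ricci_flat_killing[OF assms(3) X])
    show "lie_bracket X Y = 0" if "Y \<in> holomorphic_fields A J" for Y
      by (rule ricci_flat_abelian[OF assms(3) X that])
    show "twisted_laplacian1 A J g D (flat g X) Y = 0" if "Y \<in> vector_fields A" for Y
      by (rule ricci_flat_twisted_harmonic[OF assms(3) X that])
  next
    fix X assume "chern_ricci_eq A \<omega> J g D (-1)" "X \<in> holomorphic_fields A J"
    then show "X = 0" by (rule negative_einstein_no_holomorphic[OF assms(3)])
  next
    fix X assume "chern_ricci_eq A \<omega> J g D 1" "\<not> eigenvalue0 A g D 2" "X \<in> holomorphic_fields A J"
    then show "X = 0" by (rule no_eigenvalue)
  next
    fix X assume "chern_ricci_eq A \<omega> J g D 1" "X \<in> holomorphic_fields A J" "X \<in> killing_fields A g"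
    then show "X \<in> hamiltonian_fields A \<omega>" by (rule killing_imp_hamiltonian)
  qed (rule potentials)
qed

end
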